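(* Let $G$ be a finite group, $\pi: G\to G'$ a surjective group homomorphism with kernel $F$, $S\subseteq G$ a subgroup, and $\alpha$ a non-degenerate 2-cocycle on $S$ with values in $k^*$. Let $A=A(G,S,\alpha)$ be the $k^G$-Galois object associated to $(S,\alpha)$, let $L=L(A,k^G)$ be its left Galois Hopf algebra, and let $L'\subseteq L$ be the Hopf subalgebra corresponding to the Hopf subalgebra $k^{G'}\subseteq k^G$ (embedded via $\pi$). Then $L'$ is a normal Hopf subalgebra of $L$ if and only if $F\subseteq C_G(s)$ for every $(\alpha,F)$-regular element $s\in S$.
   Context: $k$ is an algebraically closed field of characteristic zero. $k^G$ is the Hopf algebra of $k$-valued functions on the finite group $G$. For a 2-cocycle $\alpha: S\times S\to k^*$ (trivial action), $k_\alpha S$ is the twisted group algebra with basis $(x_s)_{s\in S}$ and $x_sx_t=\alpha(s,t)x_{st}$. An element $s\in S$ is $\alpha$-regular if $\alpha(s,t)=\alpha(t,s)$ for all $t\in C_S(s)$; $\alpha$ is non-degenerate if $1$ is the only $\alpha$-regular element. For $F$ normal in $G$, $s\in S$ is called $(\alpha,F)$-regular if $\alpha(s,t)=\alpha(t,s)$ for all $t\in C_S(s)\cap F$. $C_G(s)$ denotes the centralizer. Galois objects. A right $H$-Galois object is a right $H$-comodule algebra $A$, $\rho(a)=a_{(0)}\otimes a_{(1)}$, with $A^{\mathrm{co} H}=k$ and such that $A\otimes A\to A\otimes H$, $x\otimes y\mapsto xy_{(0)}\otimes y_{(1)}$, is bijective; left Galois objects are defined similarly. An $(L,H)$-bigalois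 object is an $(L,H)$-bicomodule algebra which is both a left $L$-Galois object and a right $H$-Galois object. A $k^G$-comodule algebra is the same as an algebra with $G$-action by algebra automorphisms, via $\rho(a)=\sum_{g\in G} g.a\otimes e_g$ with $e_g(h)=\delta_{g,h}$. The $k^G$-Galois object associated to $(S,\alpha)$ is $$A(G,S,\alpha)=\{f:G\to k_\alpha S\ :\ f(sg)=s\rhd f(g)\ \ \forall s\in S, g\in G\},$$ with pointwise product, where $s\rhd x_t=x_sx_tx_s^{-1}$, and with $G$-action $(g.f)(h)=f(hg)$. Left Galois Hopf algebra. For a right $H$-Galois object $A$ ($H$ finite dimensional), $L(A,H)$ denotes the (unique up to isomorphism) Hopf algebra $L$, with left coaction on $A$, such that $A$ is an $(L,H)$-bigalois object. Concretely, $A\simeq H^{(\sigma)}$ for a convolution invertible normalized 2-cocycle $\sigma:H\otimes H\to k$, where $H^{(\sigma)}=H$ as a right comodule with product $h\cdot g=\sigma(h_1,g_1)h_2g_2$, and then $L(A,H)\simeq H^\sigma$, which equals $H$ as a coalgebra with product $h\cdot_\sigma g=\sigma(h_1,g_1)h_2g_2\sigma^{-1}(h_3,g_3)$. Correspondence of Hopf subalgebras. For a Hopf subalgebra $H'\subseteq H$, set $A(H')=\rho^{-1}(A\otimes H')\simeq A\square_H H'$, a right $H'$-Galois object. The corresponding Hopf subalgebra of $L=L(A,H)$ is $L'=L(A(H'),H')$, which is a Hopf subalgebra of $L$ in the unique way such that $A(H')\subseteq A$ is an $(L,H)$-bicomodule subalgebra and $A(H')$ is $(L',H')$-bigalois.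 (In the realization $L=H^\sigma$, $L'$ is the subcoalgebra $H'$.) A Hopf subalgebra is normal if it is stable under the (left or right) adjoint action. *)

theory Defs
  imports
    "HOL-Library.Function_Algebras"
    "HOL-Computational_Algebra.Polynomial"
    "HOL-Algebra.Coset"
begin

section \<open>Algebras over a field\<close>

text \<open>
  The base field is a type \<open>'k\<close>. Every vector space is a linear subspace \<open>carrier V\<close> of an
  ambient vector space given by a type and a scalar multiplication \<open>scl V\<close>, so that
  subobjects are obtained by changing the carrier only.
\<close>

record ('k, 'v) kalg = "'v monoid" +
  scl :: "'k \<Rightarrow> 'v \<Rightarrow> 'v"

definition linear_map ::
  "('k::field, 'v::ab_group_add, 'x) kalg_scheme \<Rightarrow> ('k, 'w::ab_group_add, 'y) kalg_scheme
    \<Rightarrow> ('v \<Rightarrow> 'w) \<Rightarrow> bool" where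
  "linear_map V W f \<longleftrightarrow>
     f \<in> carrier V \<rightarrow> carrier W \<and>
     (\<forall>u\<in>carrier V. \<forall>v\<in>carrier V. f (u + v) = f u + f v) \<and>
     (\<forall>c. \<forall>v\<in>carrier V. f (scl V c v) = scl W c (f v))"

locale k_algebra = monoid A
  for A :: "('k::field, 'v::ab_group_add, 'x) kalg_scheme" (structure) +
  assumes ambient: "vector_space (scl A)"
    and subspace: "module.subspace (scl A) (carrier A)"
    and linear_mult_left: "a \<in> carrier A \<Longrightarrow> linear_map A A (\<lambda>x. a \<otimes> x)"
    and linear_mult_right: "a \<in> carrier A \<Longrightarrow> linear_map A A (\<lambda>x. x \<otimes> a)"

definition algebra_hom ::
  "('k::field, 'v::ab_group_add, 'x) kalg_scheme \<Rightarrow> ('k, 'w::ab_group_add, 'y) kalg_scheme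
    \<Rightarrow> ('v \<Rightarrow> 'w) \<Rightarrow> bool" where
  "algebra_hom A B f \<longleftrightarrow> linear_map A B f \<and> f \<in> hom A B \<and> f \<one>\<^bsub>A\<^esub> = \<one>\<^bsub>B\<^esub>"

definition base_field :: "('k::field, 'k) kalg" where
  "base_field = \<lparr>carrier = UNIV, mult = (*), one = 1, scl = (*)\<rparr>"

section \<open>Tensor products\<close>

text \<open>
  Over a field, the tensor product of the ambient spaces \<open>'v\<close> and \<open>'w\<close> embeds into the linear
  dual of the space of bilinear forms on \<open>'v \<times> 'w\<close>, a pure tensor being sent to evaluation at
  the corresponding pair. The tensor product of two spaces is realised as the span of its pure
  tensors there; this is compatible with passing to subspaces.
\<close>

type_synonym ('k, 'v, 'w) tensor = "('v \<Rightarrow> 'w \<Rightarrow> 'k) \<Rightarrow> 'k"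

definition bilinear_form ::
  "('k::field \<Rightarrow> 'v::ab_group_add \<Rightarrow> 'v) \<Rightarrow> ('k \<Rightarrow> 'w::ab_group_add \<Rightarrow> 'w)
    \<Rightarrow> ('v \<Rightarrow> 'w \<Rightarrow> 'k) \<Rightarrow> bool" where
  "bilinear_form s t B \<longleftrightarrow>
     (\<forall>w. Vector_Spaces.linear s (*) (\<lambda>v. B v w)) \<and> (\<forall>v. Vector_Spaces.linear t (*) (B v))"

definition tens ::
  "('k::field, 'v::ab_group_add, 'x) kalg_scheme \<Rightarrow> ('k, 'w::ab_group_add, 'y) kalg_scheme
    \<Rightarrow> 'v \<Rightarrow> 'w \<Rightarrow> ('k, 'v, 'w) tensor" where
  "tens V W v w = (\<lambda>B. if bilinear_form (scl V) (scl W) B then B v w else 0)"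

definition fun_scl :: "'k::field \<Rightarrow> ('a \<Rightarrow> 'k) \<Rightarrow> 'a \<Rightarrow> 'k" where
  "fun_scl c f = (\<lambda>x. c * f x)"

definition tensor_carrier ::
  "('k::field, 'v::ab_group_add, 'x) kalg_scheme \<Rightarrow> ('k, 'w::ab_group_add, 'y) kalg_scheme
    \<Rightarrow> ('k, 'v, 'w) tensor set" where
  "tensor_carrier V W =
     module.span fun_scl {tens V W v w | v w. v \<in> carrier V \<and> w \<in> carrier W}"

text \<open>The linear map on the tensor product induced by a map \<open>b\<close> that is bilinear on
  the carriers, for which the sum does not depend on the chosen representation of \<open>t\<close>.\<close>

definition tlift ::
  "('k::field, 'v::ab_group_add, 'x) kalg_scheme \<Rightarrow> ('k, 'w::ab_group_add, 'y) kalg_scheme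
    \<Rightarrow> ('v \<Rightarrow> 'w \<Rightarrow> 'u::ab_group_add) \<Rightarrow> ('k, 'v, 'w) tensor \<Rightarrow> 'u" where
  "tlift V W b t = (THE u. \<exists>ps. set ps \<subseteq> carrier V \<times> carrier W \<and>
     t = (\<Sum>(v, w)\<leftarrow>ps. tens V W v w) \<and> u = (\<Sum>(v, w)\<leftarrow>ps. b v w))"

definition tensor ::
  "('k::field, 'v::ab_group_add, 'x) kalg_scheme \<Rightarrow> ('k, 'w::ab_group_add, 'y) kalg_scheme
    \<Rightarrow> ('k, ('k, 'v, 'w) tensor) kalg" where
  "tensor A B = \<lparr>
     carrier = tensor_carrier A B,
     mult = (\<lambda>t u. tlift A B (\<lambda>a b. tlift A B
               (\<lambda>a' b'. tens A B (a \<otimes>\<^bsub>A\<^esub> a') (b \<otimes>\<^bsub>B\<^esub> b')) u) t),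
     one = tens A B \<one>\<^bsub>A\<^esub> \<one>\<^bsub>B\<^esub>,
     scl = fun_scl\<rparr>"

text \<open>\<open>tmap V W V' W' f g\<close> is the tensor product of \<open>f : V \<rightarrow> V'\<close> and \<open>g : W \<rightarrow> W'\<close>.\<close>

definition tmap ::
  "('k::field, 'v::ab_group_add, 'x) kalg_scheme \<Rightarrow> ('k, 'w::ab_group_add, 'y) kalg_scheme
    \<Rightarrow> ('k, 'v1::ab_group_add, 'x1) kalg_scheme \<Rightarrow> ('k, 'w1::ab_group_add, 'y1) kalg_scheme
    \<Rightarrow> ('v \<Rightarrow> 'v1) \<Rightarrow> ('w \<Rightarrow> 'w1) \<Rightarrow> ('k, 'v, 'w) tensor \<Rightarrow> ('k, 'v1, 'w1) tensor" where
  "tmap V W V' W' f g = tlift V W (\<lambda>v w. tens V' W' (f v) (g w))"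

text \<open>The associativity isomorphism from \<open>(U \<otimes> V) \<otimes> W\<close> to \<open>U \<otimes> (V \<otimes> W)\<close>.\<close>

definition tassoc ::
  "('k::field, 'u::ab_group_add, 'x) kalg_scheme \<Rightarrow> ('k, 'v::ab_group_add, 'y) kalg_scheme
    \<Rightarrow> ('k, 'w::ab_group_add, 'z) kalg_scheme
    \<Rightarrow> ('k, ('k, 'u, 'v) tensor, 'w) tensor \<Rightarrow> ('k, 'u, ('k, 'v, 'w) tensor) tensor" where
  "tassoc U V W = tlift (tensor U V) W
     (\<lambda>t w. tlift U V (\<lambda>u v. tens U (tensor V W) u (tens V W v w)) t)"

section \<open>Hopf algebras\<close>

record ('k, 'v) hopf = "('k, 'v) kalg" +
  comul :: "'v \<Rightarrow> ('k, 'v, 'v) tensor"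
  counit :: "'v \<Rightarrow> 'k"
  antipode :: "'v \<Rightarrow> 'v"

locale hopf_algebra = k_algebra H
  for H :: "('k::field, 'v::ab_group_add, 'x) hopf_scheme" (structure) +
  assumes comul_hom: "algebra_hom H (tensor H H) (comul H)"
    and counit_hom: "algebra_hom H base_field (counit H)"
    and antipode_linear: "linear_map H H (antipode H)"
    and coassoc: "h \<in> carrier H \<Longrightarrow>
      tassoc H H H (tmap H H (tensor H H) H (comul H) id (comul H h))
        = tmap H H H (tensor H H) id (comul H) (comul H h)"
    and counit_left: "h \<in> carrier H \<Longrightarrow>
      tlift H H (\<lambda>x y. scl H (counit H x) y) (comul H h) = h"
    and counit_right: "h \<in> carrier H \<Longrightarrow>
      tlift H H (\<lambda>x y. scl H (counit H y) x) (comul H h) = h"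
    and antipode_left: "h \<in> carrier H \<Longrightarrow>
      tlift H H (\<lambda>x y. antipode H x \<otimes> y) (comul H h) = scl H (counit H h) \<one>"
    and antipode_right: "h \<in> carrier H \<Longrightarrow>
      tlift H H (\<lambda>x y. x \<otimes> antipode H y) (comul H h) = scl H (counit H h) \<one>"

definition hopf_subalgebra ::
  "('k::field, 'v::ab_group_add, 'x) hopf_scheme \<Rightarrow> 'v set \<Rightarrow> bool" where
  "hopf_subalgebra H K \<longleftrightarrow>
     module.subspace (scl H) K \<and> submonoid K H \<and>
     comul H ` K \<subseteq> tensor_carrier (H\<lparr>carrier := K\<rparr>) (H\<lparr>carrier := K\<rparr>) \<and>
     antipode H ` K \<subseteq> K"

definition left_adjoint ::
  "('k::field, 'v::ab_group_add, 'x) hopf_scheme \<Rightarrow> 'v \<Rightarrow> 'v \<Rightarrow> 'v" where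
  "left_adjoint H h x =
     tlift H H (\<lambda>h1 h2. h1 \<otimes>\<^bsub>H\<^esub> x \<otimes>\<^bsub>H\<^esub> antipode H h2) (comul H h)"

definition right_adjoint ::
  "('k::field, 'v::ab_group_add, 'x) hopf_scheme \<Rightarrow> 'v \<Rightarrow> 'v \<Rightarrow> 'v" where
  "right_adjoint H h x =
     tlift H H (\<lambda>h1 h2. antipode H h1 \<otimes>\<^bsub>H\<^esub> x \<otimes>\<^bsub>H\<^esub> h2) (comul H h)"

text \<open>
  For finite-dimensional \<open>H\<close> the two stability conditions are equivalent, since the antipode is
  bijective, preserves \<open>K\<close> and exchanges the two adjoint actions.
\<close>

definition normal_hopf_subalgebra ::
  "('k::field, 'v::ab_group_add, 'x) hopf_scheme \<Rightarrow> 'v set \<Rightarrow> bool" where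
  "normal_hopf_subalgebra H K \<longleftrightarrow> hopf_subalgebra H K \<and>
     ((\<forall>h\<in>carrier H. \<forall>x\<in>K. left_adjoint H h x \<in> K) \<or>
      (\<forall>h\<in>carrier H. \<forall>x\<in>K. right_adjoint H h x \<in> K))"

section \<open>Galois objects\<close>

locale right_comodule_algebra = A: k_algebra A + H: hopf_algebra H
  for H :: "('k::field, 'v::ab_group_add, 'x) hopf_scheme"
    and A :: "('k, 'a::ab_group_add, 'y) kalg_scheme"
    and \<rho> :: "'a \<Rightarrow> ('k, 'a, 'v) tensor" +
  assumes coaction_hom: "algebra_hom A (tensor A H) \<rho>"
    and coaction_assoc: "a \<in> carrier A \<Longrightarrow>
      tassoc A H H (tmap A H (tensor A H) H \<rho> id (\<rho> a))
        = tmap A H A (tensor H H) id (comul H) (\<rho> a)"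
    and coaction_counit: "a \<in> carrier A \<Longrightarrow>
      tlift A H (\<lambda>x h. scl A (counit H h) x) (\<rho> a) = a"

locale left_comodule_algebra = A: k_algebra A + L: hopf_algebra L
  for L :: "('k::field, 'v::ab_group_add, 'x) hopf_scheme"
    and A :: "('k, 'a::ab_group_add, 'y) kalg_scheme"
    and \<delta> :: "'a \<Rightarrow> ('k, 'v, 'a) tensor" +
  assumes coaction_hom: "algebra_hom A (tensor L A) \<delta>"
    and coaction_assoc: "a \<in> carrier A \<Longrightarrow>
      tassoc L L A (tmap L A (tensor L L) A (comul L) id (\<delta> a))
        = tmap L A L (tensor L A) id \<delta> (\<delta> a)"
    and coaction_counit: "a \<in> carrier A \<Longrightarrow>
      tlift L A (\<lambda>h x. scl A (counit L h) x) (\<delta> a) = a"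

text \<open>
  Triviality of the coinvariants means that \<open>c \<mapsto> c 1\<close> identifies the base field with them;
  this includes \<open>1 \<noteq> 0\<close>.
\<close>

locale right_galois_object = right_comodule_algebra H A \<rho>
  for H :: "('k::field, 'v::ab_group_add, 'x) hopf_scheme"
    and A :: "('k, 'a::ab_group_add, 'y) kalg_scheme"
    and \<rho> :: "'a \<Rightarrow> ('k, 'a, 'v) tensor" +
  assumes nonzero: "\<one>\<^bsub>A\<^esub> \<noteq> 0"
    and coinvariants:
      "{a \<in> carrier A. \<rho> a = tens A H a \<one>\<^bsub>H\<^esub>} = range (\<lambda>c. scl A c \<one>\<^bsub>A\<^esub>)"
    and canonical_bij:
      "bij_betw (tlift A A (\<lambda>x y. tlift A H (\<lambda>y0 y1. tens A H (x \<otimes>\<^bsub>A\<^esub> y0) y1) (\<rho> y)))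
         (tensor_carrier A A) (tensor_carrier A H)"

locale left_galois_object = left_comodule_algebra L A \<delta>
  for L :: "('k::field, 'v::ab_group_add, 'x) hopf_scheme"
    and A :: "('k, 'a::ab_group_add, 'y) kalg_scheme"
    and \<delta> :: "'a \<Rightarrow> ('k, 'v, 'a) tensor" +
  assumes nonzero: "\<one>\<^bsub>A\<^esub> \<noteq> 0"
    and coinvariants:
      "{a \<in> carrier A. \<delta> a = tens L A \<one>\<^bsub>L\<^esub> a} = range (\<lambda>c. scl A c \<one>\<^bsub>A\<^esub>)"
    and canonical_bij:
      "bij_betw (tlift A A (\<lambda>x y. tlift L A (\<lambda>x1 x0. tens L A x1 (x0 \<otimes>\<^bsub>A\<^esub> y)) (\<delta> x)))
         (tensor_carrier A A) (tensor_carrier L A)"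

locale bigalois_object =
  left: left_galois_object L A \<delta> + right: right_galois_object H A \<rho>
  for L :: "('k::field, 'l::ab_group_add, 'x) hopf_scheme"
    and H :: "('k, 'h::ab_group_add, 'y) hopf_scheme"
    and A :: "('k, 'a::ab_group_add, 'z) kalg_scheme"
    and \<delta> :: "'a \<Rightarrow> ('k, 'l, 'a) tensor"
    and \<rho> :: "'a \<Rightarrow> ('k, 'a, 'h) tensor" +
  assumes bicomodule: "a \<in> carrier A \<Longrightarrow>
    tassoc L A H (tmap A H (tensor L A) H \<delta> id (\<rho> a))
      = tmap L A L (tensor A H) id \<rho> (\<delta> a)"

text \<open>
  \<open>(L, \<delta>)\<close> is the left Galois Hopf algebra of the right Galois object \<open>(A, \<rho>)\<close>. It is only
  determined up to isomorphism, so this is a predicate on the pair.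
\<close>

definition left_galois_hopf_algebra ::
  "('k::field, 'h::ab_group_add, 'y) hopf_scheme \<Rightarrow> ('k, 'a::ab_group_add, 'z) kalg_scheme
    \<Rightarrow> ('a \<Rightarrow> ('k, 'a, 'h) tensor) \<Rightarrow> ('k, 'l::ab_group_add, 'x) hopf_scheme
    \<Rightarrow> ('a \<Rightarrow> ('k, 'l, 'a) tensor) \<Rightarrow> bool" where
  "left_galois_hopf_algebra H A \<rho> L \<delta> \<longleftrightarrow> bigalois_object L H A \<delta> \<rho>"

text \<open>The subobject \<open>A(H')\<close> for a Hopf subalgebra \<open>K = H'\<close>.\<close>

definition galois_restriction ::
  "('k::field, 'h::ab_group_add, 'y) hopf_scheme \<Rightarrow> ('k, 'a::ab_group_add, 'z) kalg_scheme
    \<Rightarrow> ('a \<Rightarrow> ('k, 'a, 'h) tensor) \<Rightarrow> 'h set \<Rightarrow> 'a set" where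
  "galois_restriction H A \<rho> K = {a \<in> carrier A. \<rho> a \<in> tensor_carrier A (H\<lparr>carrier := K\<rparr>)}"

text \<open>
  \<open>M\<close> is the Hopf subalgebra of \<open>L\<close> corresponding to the Hopf subalgebra \<open>K\<close> of \<open>H\<close>. Bigaloisness of
  the restricted coactions contains that \<open>A(K)\<close> is an \<open>(L, H)\<close>-bicomodule subalgebra of \<open>A\<close>.
\<close>

definition corresponding_hopf_subalgebra ::
  "('k::field, 'h::ab_group_add, 'y) hopf_scheme \<Rightarrow> ('k, 'a::ab_group_add, 'z) kalg_scheme
    \<Rightarrow> ('a \<Rightarrow> ('k, 'a, 'h) tensor) \<Rightarrow> ('k, 'l::ab_group_add, 'x) hopf_scheme
    \<Rightarrow> ('a \<Rightarrow> ('k, 'l, 'a) tensor) \<Rightarrow> 'h set \<Rightarrow> 'l set \<Rightarrow> bool" where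
  "corresponding_hopf_subalgebra H A \<rho> L \<delta> K M \<longleftrightarrow>
     hopf_subalgebra H K \<and> hopf_subalgebra L M \<and>
     bigalois_object (L\<lparr>carrier := M\<rparr>) (H\<lparr>carrier := K\<rparr>)
       (A\<lparr>carrier := galois_restriction H A \<rho> K\<rparr>) \<delta> \<rho>"

section \<open>Function algebras and twisted group algebras\<close>

definition delta :: "'g \<Rightarrow> 'g \<Rightarrow> 'k::field" where
  "delta g = (\<lambda>h. if h = g then 1 else 0)"

text \<open>Functions on a group are extended by zero outside its carrier.\<close>

definition function_hopf :: "('g, 'x) monoid_scheme \<Rightarrow> ('k::field, 'g \<Rightarrow> 'k) hopf" where
  "function_hopf G = (let V = \<lparr>
       carrier = {f. \<forall>g. g \<notin> carrier G \<longrightarrow> f g = 0},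
       mult = (\<lambda>f f' g. f g * f' g),
       one = (\<lambda>g. if g \<in> carrier G then 1 else 0),
       scl = fun_scl\<rparr>
     in kalg.extend V \<lparr>
       comul = (\<lambda>f. \<Sum>g\<in>carrier G. \<Sum>h\<in>carrier G.
                  fun_scl (f (g \<otimes>\<^bsub>G\<^esub> h)) (tens V V (delta g) (delta h))),
       counit = (\<lambda>f. f \<one>\<^bsub>G\<^esub>),
       antipode = (\<lambda>f g. if g \<in> carrier G then f (inv\<^bsub>G\<^esub> g) else 0)\<rparr>)"

text \<open>The image of the functions on \<open>G'\<close> in the functions on \<open>G\<close> under pullback along \<open>\<pi>\<close>.\<close>

definition pullback_functions ::
  "('g, 'x) monoid_scheme \<Rightarrow> ('h, 'y) monoid_scheme \<Rightarrow> ('g \<Rightarrow> 'h) \<Rightarrow> ('g \<Rightarrow> 'k::field) set" where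
  "pullback_functions G G' \<pi> =
     (\<lambda>f g. if g \<in> carrier G then f (\<pi> g) else 0) ` carrier (function_hopf G')"

definition cocycle2 ::
  "('g, 'x) monoid_scheme \<Rightarrow> 'g set \<Rightarrow> ('g \<Rightarrow> 'g \<Rightarrow> 'k::field) \<Rightarrow> bool" where
  "cocycle2 G S \<alpha> \<longleftrightarrow>
     (\<forall>s\<in>S. \<forall>t\<in>S. \<alpha> s t \<noteq> 0) \<and>
     (\<forall>s\<in>S. \<forall>t\<in>S. \<forall>u\<in>S. \<alpha> s t * \<alpha> (s \<otimes>\<^bsub>G\<^esub> t) u = \<alpha> t u * \<alpha> s (t \<otimes>\<^bsub>G\<^esub> u))"

definition centralizer :: "('g, 'x) monoid_scheme \<Rightarrow> 'g \<Rightarrow> 'g set" where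
  "centralizer G s = {g \<in> carrier G. g \<otimes>\<^bsub>G\<^esub> s = s \<otimes>\<^bsub>G\<^esub> g}"

text \<open>For \<open>s \<in> S\<close>: regularity relative to \<open>F\<close>. As \<open>\<alpha>\<close> lives on \<open>S\<close>, the centralizer is taken in \<open>S\<close>.\<close>

definition regular_rel ::
  "('g, 'x) monoid_scheme \<Rightarrow> 'g set \<Rightarrow> ('g \<Rightarrow> 'g \<Rightarrow> 'k::field) \<Rightarrow> 'g set \<Rightarrow> 'g \<Rightarrow> bool" where
  "regular_rel G S \<alpha> F s \<longleftrightarrow> (\<forall>t \<in> S \<inter> centralizer G s \<inter> F. \<alpha> s t = \<alpha> t s)"

definition regular ::
  "('g, 'x) monoid_scheme \<Rightarrow> 'g set \<Rightarrow> ('g \<Rightarrow> 'g \<Rightarrow> 'k::field) \<Rightarrow> 'g \<Rightarrow> bool" where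
  "regular G S \<alpha> s \<longleftrightarrow> (\<forall>t \<in> S \<inter> centralizer G s. \<alpha> s t = \<alpha> t s)"

definition nondegenerate ::
  "('g, 'x) monoid_scheme \<Rightarrow> 'g set \<Rightarrow> ('g \<Rightarrow> 'g \<Rightarrow> 'k::field) \<Rightarrow> bool" where
  "nondegenerate G S \<alpha> \<longleftrightarrow> (\<forall>s\<in>S. regular G S \<alpha> s \<longleftrightarrow> s = \<one>\<^bsub>G\<^esub>)"

text \<open>
  The basis vector \<open>x\<^sub>s\<close> is \<open>delta s\<close>. The cocycle is not assumed to be normalized, whence the
  scalar in the unit.
\<close>

definition twisted_group_algebra ::
  "('g, 'x) monoid_scheme \<Rightarrow> 'g set \<Rightarrow> ('g \<Rightarrow> 'g \<Rightarrow> 'k::field) \<Rightarrow> ('k, 'g \<Rightarrow> 'k) kalg" where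
  "twisted_group_algebra G S \<alpha> = \<lparr>
     carrier = {v. \<forall>s. s \<notin> S \<longrightarrow> v s = 0},
     mult = (\<lambda>v w. \<Sum>s\<in>S. \<Sum>t\<in>S. fun_scl (v s * w t * \<alpha> s t) (delta (s \<otimes>\<^bsub>G\<^esub> t))),
     one = fun_scl (inverse (\<alpha> \<one>\<^bsub>G\<^esub> \<one>\<^bsub>G\<^esub>)) (delta \<one>\<^bsub>G\<^esub>),
     scl = fun_scl\<rparr>"

definition conj_action ::
  "('g, 'x) monoid_scheme \<Rightarrow> 'g set \<Rightarrow> ('g \<Rightarrow> 'g \<Rightarrow> 'k::field) \<Rightarrow> 'g \<Rightarrow> ('g \<Rightarrow> 'k) \<Rightarrow> 'g \<Rightarrow> 'k" where
  "conj_action G S \<alpha> s v = (let T = twisted_group_algebra G S \<alpha> in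
     delta s \<otimes>\<^bsub>T\<^esub> v \<otimes>\<^bsub>T\<^esub> inv\<^bsub>T\<^esub> (delta s))"

definition galois_alg ::
  "('g, 'x) monoid_scheme \<Rightarrow> 'g set \<Rightarrow> ('g \<Rightarrow> 'g \<Rightarrow> 'k::field) \<Rightarrow> ('k, 'g \<Rightarrow> 'g \<Rightarrow> 'k) kalg" where
  "galois_alg G S \<alpha> = (let T = twisted_group_algebra G S \<alpha> in \<lparr>
     carrier = {f. (\<forall>g\<in>carrier G. f g \<in> carrier T) \<and> (\<forall>g. g \<notin> carrier G \<longrightarrow> f g = 0) \<and>
                   (\<forall>s\<in>S. \<forall>g\<in>carrier G. f (s \<otimes>\<^bsub>G\<^esub> g) = conj_action G S \<alpha> s (f g))},
     mult = (\<lambda>f f' g. if g \<in> carrier G then f g \<otimes>\<^bsub>T\<^esub> f' g else 0),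
     one = (\<lambda>g. if g \<in> carrier G then \<one>\<^bsub>T\<^esub> else 0),
     scl = (\<lambda>c f g. scl T c (f g))\<rparr>)"

definition translate :: "('g, 'x) monoid_scheme \<Rightarrow> 'g \<Rightarrow> ('g \<Rightarrow> 'v::zero) \<Rightarrow> 'g \<Rightarrow> 'v" where
  "translate G g f = (\<lambda>h. if h \<in> carrier G then f (h \<otimes>\<^bsub>G\<^esub> g) else 0)"

definition galois_coaction ::
  "('g, 'x) monoid_scheme \<Rightarrow> 'g set \<Rightarrow> ('g \<Rightarrow> 'g \<Rightarrow> 'k::field)
    \<Rightarrow> ('g \<Rightarrow> 'g \<Rightarrow> 'k) \<Rightarrow> ('k, 'g \<Rightarrow> 'g \<Rightarrow> 'k, 'g \<Rightarrow> 'k) tensor" where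
  "galois_coaction G S \<alpha> f = (\<Sum>g\<in>carrier G.
     tens (galois_alg G S \<alpha>) (function_hopf G) (translate G g f) (delta g))"

end

theory Submission
  imports Defs
begin

text \<open>
  Let \<open>A'\<close> be the algebra of \<open>F\<close>-invariants of \<open>A\<close>. The canonical map identifies \<open>L\<close> with the
  \<open>G\<close>-invariants of \<open>A \<otimes> A\<^sup>o\<^sup>p\<close> and \<open>L'\<close> with those lying in \<open>A' \<otimes> A'\<^sup>o\<^sup>p\<close>. An invariant Casimir element
  \<open>e\<close> of \<open>A'\<close> with product \<open>1\<close> corresponds to an idempotent integral \<open>\<Lambda>\<close> of \<open>L'\<close>. The elements
  \<open>w\<close> of \<open>L'\<close> are characterised by \<open>w\<^sub>1 \<otimes> w\<^sub>2 \<Lambda> = w \<otimes> \<Lambda>\<close>, a condition that is stable under the adjoint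
  action if \<open>\<Lambda>\<close> is central; conversely, normality gives \<open>\<Lambda> l \<Lambda> = l \<Lambda>\<close> for all \<open>l\<close>.

  Since \<open>\<alpha>\<close> is non-degenerate, \<open>k\<^sub>\<alpha>S\<close> is a matrix algebra, and a tensor \<open>\<Sum> a \<otimes> b\<close> is determined by the
  operators \<open>x \<mapsto> \<Sum> a(g) x b(h)\<close> on \<open>k\<^sub>\<alpha>S\<close>. The operators of \<open>e\<close> restrict functions on \<open>S\<close> to cosets of
  \<open>F\<close>. For \<open>g \<in> F\<close> and \<open>h = 1\<close>, those of an invariant tensor commute with the conjugation by \<open>x\<^sub>v\<close> whenever
  \<open>v\<close> centralizes \<open>F\<close>. If this holds for all \<open>(\<alpha>, F)\<close>-regular \<open>v\<close>, then \<open>\<Lambda>\<close> is central because restriction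
  to \<open>F\<close> is an average of such conjugations. Conversely, \<open>\<Lambda> l \<Lambda> = l \<Lambda>\<close> for suitable \<open>l\<close> forces the
  regular elements to centralize \<open>F\<close>, by a double centralizer argument in \<open>k\<^sub>\<alpha>S\<close>.
\<close>

section \<open>Linear maps out of tensor products\<close>

text \<open>\<open>L\<close> is known only through its coaction on \<open>A\<close>; there is no
  basis of \<open>L\<close> and no formula for its antipode. Statements involving the
  comultiplication or the antipode are therefore checked on the coefficients of the coaction in a
  basis of \<open>A\<close>, which span \<open>L\<close> because the canonical map is onto.
  Statements involving only products are moved to \<open>A \<otimes> A\<^sup>o\<^sup>p\<close>.
  Invariants appear there because the right coaction amounts to an action of \<open>G\<close> that
  commutes with the left coaction and has only scalar invariants.

  Normality allows either adjoint action. One version gives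
  \<open>\<Lambda> l \<Lambda> = l \<Lambda>\<close>, the other
  \<open>\<Lambda> l \<Lambda> = \<Lambda> l\<close>; exchanging the tensor factors reconciles them.

  Non-degeneracy enters through one identity: the sum of all conjugates of \<open>y\<close> by the
  \<open>x\<^sub>v\<close> is the scalar \<open>tr y\<close>. It makes
  \<open>\<Sum> x\<^sub>v \<otimes> x\<^sub>v\<^sup>-\<^sup>1\<close> behave like the Casimir
  element of a matrix algebra. The tensor \<open>e\<close> is this element spread over the cosets of
  \<open>S\<close>, summed over \<open>F\<close> in both factors and over \<open>G\<close>;
  \<open>\<kappa>\<close> normalizes its product to \<open>1\<close>.\<close>

declare plus_fun_apply [simp del] zero_fun_apply [simp del]

lemma vector_space_fun_scl: "vector_space (fun_scl :: 'k::field \<Rightarrow> ('a \<Rightarrow> 'k) \<Rightarrow> 'a \<Rightarrow> 'k)"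
  by unfold_locales (auto simp: fun_scl_def fun_eq_iff algebra_simps plus_fun_apply)

lemma vector_space_mult: "vector_space ((*) :: 'k::field \<Rightarrow> 'k \<Rightarrow> 'k)"
  by unfold_locales (auto simp: algebra_simps)

interpretation fs: vector_space "fun_scl :: 'k::field \<Rightarrow> ('a \<Rightarrow> 'k) \<Rightarrow> 'a \<Rightarrow> 'k"
  by (rule vector_space_fun_scl)

lemma linear_functional_separates:
  fixes s :: "'k::field \<Rightarrow> 'v::ab_group_add \<Rightarrow> 'v"
  assumes "vector_space s" and "v \<noteq> 0"
  obtains \<phi> where "Vector_Spaces.linear s (*) \<phi>" and "\<phi> v = (1::'k)"
proof -
  interpret p: vector_space_pair s "(*) :: 'k \<Rightarrow> 'k \<Rightarrow> 'k"
    using assms(1) vector_space_mult by (simp add: vector_space_pair_def)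
  have "p.vs1.independent {v}"
    using assms(2) by simp
  from p.linear_independent_extend[OF this, of "\<lambda>_. 1"] show ?thesis
    using that by auto
qed

lemma zero_if_linear_functionals_zero:
  fixes s :: "'k::field \<Rightarrow> 'v::ab_group_add \<Rightarrow> 'v"
  assumes "vector_space s" and "\<And>\<phi>. Vector_Spaces.linear s ((*) :: 'k \<Rightarrow> _) \<phi> \<Longrightarrow> \<phi> v = 0"
  shows "v = 0"
  using linear_functional_separates[OF assms(1)] assms(2) by (metis zero_neq_one)

lemma linear_sum':
  assumes "Vector_Spaces.linear s t f"
  shows "f (sum g I) = (\<Sum>i\<in>I. f (g i))"
  using assms by (rule module_hom.sum[OF Vector_Spaces.linear.axioms(3)])

text \<open>The vector space part of \<open>k_algebra\<close>, isolated so that the lemmas on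
  tensors also cover restricted carriers and iterated tensor products before any multiplication on
  them is considered.\<close>

locale lspace =
  fixes V :: "('k::field, 'v::ab_group_add, 'x) kalg_scheme"
  assumes lspace_ambient: "vector_space (scl V)"
    and lspace_subspace: "module.subspace (scl V) (carrier V)"
begin

sublocale vs: vector_space "scl V"
  by (rule lspace_ambient)

lemma zero_in: "0 \<in> carrier V"
  and add_in: "v \<in> carrier V \<Longrightarrow> w \<in> carrier V \<Longrightarrow> v + w \<in> carrier V"
  and scl_in: "v \<in> carrier V \<Longrightarrow> scl V c v \<in> carrier V"
  and sum_in: "(\<And>i. i \<in> I \<Longrightarrow> f i \<in> carrier V) \<Longrightarrow> sum f I \<in> carrier V"
  using vs.subspace_0 vs.subspace_add vs.subspace_scale vs.subspace_sum lspace_subspace by blast+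

lemma projection:
  obtains p where "Vector_Spaces.linear (scl V) (scl V) p" "\<And>v. p v \<in> carrier V"
    "\<And>v. v \<in> carrier V \<Longrightarrow> p v = v"
proof -
  interpret p: vector_space_pair "scl V" "scl V"
    by (simp add: vector_space_pair_def lspace_ambient)
  have "Vector_Spaces.linear (scl V) (scl V) id"
    by (simp add: Vector_Spaces.linear_iff lspace_ambient)
  from p.linear_exists_left_inverse_on[OF this lspace_subspace] that show ?thesis
    by auto
qed

lemma lspace_restrict:
  "module.subspace (scl V) K \<Longrightarrow> lspace (V\<lparr>carrier := K\<rparr>)"
  by (simp add: lspace_def lspace_ambient)

end

sublocale k_algebra \<subseteq> lspace A
  by (simp add: lspace_def ambient subspace)

text \<open>Bilinearity is asked only on the carriers, since the products and coactions to be lifted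
  are unconstrained elsewhere; \<open>bilinear_form\<close>, in contrast, concerns the whole ambient
  spaces.\<close>

definition bilinear_on ::
  "('k::field, 'v::ab_group_add, 'x) kalg_scheme \<Rightarrow> ('k, 'w::ab_group_add, 'y) kalg_scheme
    \<Rightarrow> ('k \<Rightarrow> 'u::ab_group_add \<Rightarrow> 'u) \<Rightarrow> ('v \<Rightarrow> 'w \<Rightarrow> 'u) \<Rightarrow> bool" where
  "bilinear_on V W s b \<longleftrightarrow> vector_space s \<and>
     (\<forall>v\<in>carrier V. \<forall>v'\<in>carrier V. \<forall>w\<in>carrier W. b (v + v') w = b v w + b v' w) \<and>
     (\<forall>c. \<forall>v\<in>carrier V. \<forall>w\<in>carrier W. b (scl V c v) w = s c (b v w)) \<and>
     (\<forall>v\<in>carrier V. \<forall>w\<in>carrier W. \<forall>w'\<in>carrier W. b v (w + w') = b v w + b v w') \<and>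
     (\<forall>c. \<forall>v\<in>carrier V. \<forall>w\<in>carrier W. b v (scl W c w) = s c (b v w))"

lemma bilinear_onI:
  assumes "vector_space s"
    "\<And>v v' w. v \<in> carrier V \<Longrightarrow> v' \<in> carrier V \<Longrightarrow> w \<in> carrier W \<Longrightarrow> b (v + v') w = b v w + b v' w"
    "\<And>c v w. v \<in> carrier V \<Longrightarrow> w \<in> carrier W \<Longrightarrow> b (scl V c v) w = s c (b v w)"
    "\<And>v w w'. v \<in> carrier V \<Longrightarrow> w \<in> carrier W \<Longrightarrow> w' \<in> carrier W \<Longrightarrow> b v (w + w') = b v w + b v w'"
    "\<And>c v w. v \<in> carrier V \<Longrightarrow> w \<in> carrier W \<Longrightarrow> b v (scl W c w) = s c (b v w)"
  shows "bilinear_on V W s b"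
  using assms unfolding bilinear_on_def by blast

lemma bilinear_onD:
  assumes "bilinear_on V W s b"
  shows "vector_space s"
    "\<And>v v' w. v \<in> carrier V \<Longrightarrow> v' \<in> carrier V \<Longrightarrow> w \<in> carrier W \<Longrightarrow> b (v + v') w = b v w + b v' w"
    "\<And>c v w. v \<in> carrier V \<Longrightarrow> w \<in> carrier W \<Longrightarrow> b (scl V c v) w = s c (b v w)"
    "\<And>v w w'. v \<in> carrier V \<Longrightarrow> w \<in> carrier W \<Longrightarrow> w' \<in> carrier W \<Longrightarrow> b v (w + w') = b v w + b v w'"
    "\<And>c v w. v \<in> carrier V \<Longrightarrow> w \<in> carrier W \<Longrightarrow> b v (scl W c w) = s c (b v w)"
  using assms unfolding bilinear_on_def by blast+

text \<open>No carrier hypotheses appear: \<open>tens\<close> evaluates only at forms that are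
  bilinear on the whole ambient spaces.\<close>

lemma tens_add_left: "tens V W (v + v') w = tens V W v w + tens V W v' w"
  and tens_add_right: "tens V W v (w + w') = tens V W v w + tens V W v w'"
  and tens_scl_left: "tens V W (scl V c v) w = fun_scl c (tens V W v w)"
  and tens_scl_right: "tens V W v (scl W c w) = fun_scl c (tens V W v w)"
  by (auto simp: tens_def bilinear_form_def Vector_Spaces.linear_iff fun_eq_iff fun_scl_def plus_fun_apply)

lemma tens_zero_left: "tens V W 0 w = 0"
  using tens_add_left[of V W 0 0 w] by simp

lemma tens_zero_right: "tens V W v 0 = 0"
  using tens_add_right[of V W v 0 0] by simp

lemma tens_sum_left: "tens V W (sum f I) w = (\<Sum>i\<in>I. tens V W (f i) w)"
  by (induction I rule: infinite_finite_induct) (auto simp: tens_zero_left tens_add_left)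

lemma tens_sum_right: "tens V W v (sum f I) = (\<Sum>i\<in>I. tens V W v (f i))"
  by (induction I rule: infinite_finite_induct) (auto simp: tens_zero_right tens_add_right)

text \<open>\<open>tens\<close> reads only the scalar multiplications, so a tensor over subspaces is
  literally a tensor over the larger spaces.\<close>

lemma tens_carrier_update: "tens (V\<lparr>carrier := K\<rparr>) (W\<lparr>carrier := M\<rparr>) = tens V W"
  "tens (V\<lparr>carrier := K\<rparr>) W = tens V W" "tens V (W\<lparr>carrier := M\<rparr>) = tens V W"
  by (simp_all add: tens_def fun_eq_iff)

lemma tens_in: "v \<in> carrier V \<Longrightarrow> w \<in> carrier W \<Longrightarrow> tens V W v w \<in> tensor_carrier V W"
  unfolding tensor_carrier_def by (intro fs.span_base) blast

lemma tensor_zero_in: "0 \<in> tensor_carrier V W"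
  and tensor_add_in: "t \<in> tensor_carrier V W \<Longrightarrow> u \<in> tensor_carrier V W \<Longrightarrow> t + u \<in> tensor_carrier V W"
  and tensor_scl_in: "t \<in> tensor_carrier V W \<Longrightarrow> fun_scl c t \<in> tensor_carrier V W"
  and tensor_sum_in: "(\<And>i. i \<in> I \<Longrightarrow> f i \<in> tensor_carrier V W) \<Longrightarrow> sum f I \<in> tensor_carrier V W"
  unfolding tensor_carrier_def
  by (auto intro: fs.span_zero fs.span_add fs.span_scale fs.span_sum)

lemma tensor_carrier_mono:
  assumes "carrier V' \<subseteq> carrier V" "carrier W' \<subseteq> carrier W" "scl V' = scl V" "scl W' = scl W"
  shows "tensor_carrier V' W' \<subseteq> tensor_carrier V W"
  unfolding tensor_carrier_def tens_def assms(3,4)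
  by (rule fs.span_mono) (use assms(1,2) in blast)


text \<open>A scalar can be absorbed into the left factor, so every tensor is a sum of pure ones and
  no case for scaling is left.\<close>

lemma tensor_induct [consumes 3, case_names tens add]:
  assumes "lspace V" and "lspace W" and "t \<in> tensor_carrier V W"
    and tens: "\<And>v w. v \<in> carrier V \<Longrightarrow> w \<in> carrier W \<Longrightarrow> P (tens V W v w)"
    and add: "\<And>t u. t \<in> tensor_carrier V W \<Longrightarrow> u \<in> tensor_carrier V W \<Longrightarrow> P t \<Longrightarrow> P u \<Longrightarrow> P (t + u)"
  shows "P t"
proof -
  have "t \<in> tensor_carrier V W \<and> P t"
    using assms(3)[unfolded tensor_carrier_def]
  proof (induction rule: fs.span_induct_alt)
    case base
    then show ?case
      using tens[OF lspace.zero_in[OF assms(1)] lspace.zero_in[OF assms(2)]] tensor_zero_in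
      by (simp add: tens_zero_left)
  next
    case (step c x y)
    then obtain v w where x: "x = tens V W v w" "v \<in> carrier V" "w \<in> carrier W"
      by blast
    have "scl V c v \<in> carrier V"
      using lspace.scl_in[OF assms(1)] x by blast
    then show ?case
      unfolding x tens_scl_left[symmetric] using step x
      by (blast intro: add tens tensor_add_in tens_in)
  qed
  then show ?thesis ..
qed

lemma tensor_list:
  assumes "lspace V" and "lspace W" and "t \<in> tensor_carrier V W"
  obtains ps where "set ps \<subseteq> carrier V \<times> carrier W" "t = (\<Sum>(v, w)\<leftarrow>ps. tens V W v w)"
proof -
  have "\<exists>ps. set ps \<subseteq> carrier V \<times> carrier W \<and> t = (\<Sum>(v, w)\<leftarrow>ps. tens V W v w)"
    using assms
  proof (induction rule: tensor_induct)
    case (tens v w)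
    then show ?case by (intro exI[of _ "[(v, w)]"]) auto
  next
    case (add t u)
    then obtain ps qs where "set ps \<subseteq> carrier V \<times> carrier W" "t = (\<Sum>(v, w)\<leftarrow>ps. tens V W v w)"
      "set qs \<subseteq> carrier V \<times> carrier W" "u = (\<Sum>(v, w)\<leftarrow>qs. tens V W v w)" by blast
    then show ?case by (intro exI[of _ "ps @ qs"]) auto
  qed
  then show ?thesis using that by blast
qed

text \<open>A form that is bilinear on the carriers extends to the ambient spaces along linear projections
  onto the carriers, so that tensors can be evaluated at it.\<close>

lemma bilinear_list_unique:
  assumes V: "lspace V" and W: "lspace W" and b: "bilinear_on V W s b"
    and ps: "set ps \<subseteq> carrier V \<times> carrier W" and qs: "set qs \<subseteq> carrier V \<times> carrier W"
    and eq: "(\<Sum>(v, w)\<leftarrow>ps. tens V W v w) = (\<Sum>(v, w)\<leftarrow>qs. tens V W v w)"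
  shows "(\<Sum>(v, w)\<leftarrow>ps. b v w) = (\<Sum>(v, w)\<leftarrow>qs. b v w)"
proof -
  note bD = bilinear_onD[OF b]
  obtain p where p: "Vector_Spaces.linear (scl V) (scl V) p" "\<And>v. p v \<in> carrier V"
    "\<And>v. v \<in> carrier V \<Longrightarrow> p v = v" using lspace.projection[OF V] by blast
  obtain q where q: "Vector_Spaces.linear (scl W) (scl W) q" "\<And>v. q v \<in> carrier W"
    "\<And>v. v \<in> carrier W \<Longrightarrow> q v = v" using lspace.projection[OF W] by blast
  have "(\<Sum>(v, w)\<leftarrow>ps. b v w) - (\<Sum>(v, w)\<leftarrow>qs. b v w) = 0"
  proof (rule zero_if_linear_functionals_zero[OF bD(1)])
    fix \<phi> assume \<phi>: "Vector_Spaces.linear s (*) \<phi>"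
    define B where "B = (\<lambda>v w. \<phi> (b (p v) (q w)))"
    have B: "bilinear_form (scl V) (scl W) B"
      unfolding bilinear_form_def B_def
      using p q \<phi> bD V W by (auto simp: Vector_Spaces.linear_iff)
    have ev: "(\<Sum>(v, w)\<leftarrow>rs. tens V W v w) B = \<phi> (\<Sum>(v, w)\<leftarrow>rs. b v w)"
      if "set rs \<subseteq> carrier V \<times> carrier W" for rs
      using that
    proof (induction rs)
      case Nil
      then show ?case using linear_sum'[OF \<phi>, of _ "{}"] by (simp add: zero_fun_apply)
    next
      case (Cons r rs)
      then show ?case using \<phi> B p q
        by (cases r) (auto simp: tens_def B_def Vector_Spaces.linear_iff plus_fun_apply)
    qed
    have "\<phi> (\<Sum>(v, w)\<leftarrow>ps. b v w) = \<phi> (\<Sum>(v, w)\<leftarrow>qs. b v w)"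
      using ev[OF ps] ev[OF qs] eq by simp
    then show "\<phi> ((\<Sum>(v, w)\<leftarrow>ps. b v w) - (\<Sum>(v, w)\<leftarrow>qs. b v w)) = 0"
      by (simp add: module_hom.diff[OF Vector_Spaces.linear.axioms(3)[OF \<phi>]])
  qed
  then show ?thesis by simp
qed

text \<open>Independence of the representation turns the definite description in
  \<open>tlift\<close> into a computation.\<close>

lemma tlift_list:
  assumes "lspace V" and "lspace W" and "bilinear_on V W s b"
    and "set ps \<subseteq> carrier V \<times> carrier W"
  shows "tlift V W b (\<Sum>(v, w)\<leftarrow>ps. tens V W v w) = (\<Sum>(v, w)\<leftarrow>ps. b v w)"
  unfolding tlift_def
proof (rule the_equality)
  show "\<exists>qs. set qs \<subseteq> carrier V \<times> carrier W \<and>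
    (\<Sum>(v, w)\<leftarrow>ps. tens V W v w) = (\<Sum>(v, w)\<leftarrow>qs. tens V W v w) \<and> (\<Sum>(v, w)\<leftarrow>ps. b v w) = (\<Sum>(v, w)\<leftarrow>qs. b v w)"
    using assms(4) by blast
next
  fix u
  assume "\<exists>qs. set qs \<subseteq> carrier V \<times> carrier W \<and>
    (\<Sum>(v, w)\<leftarrow>ps. tens V W v w) = (\<Sum>(v, w)\<leftarrow>qs. tens V W v w) \<and> u = (\<Sum>(v, w)\<leftarrow>qs. b v w)"
  then show "u = (\<Sum>(v, w)\<leftarrow>ps. b v w)"
    using bilinear_list_unique[OF assms(1-4)] by metis
qed

lemma tlift_tens:
  assumes "lspace V" "lspace W" "bilinear_on V W s b" "v \<in> carrier V" "w \<in> carrier W"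
  shows "tlift V W b (tens V W v w) = b v w"
  using tlift_list[OF assms(1-3), of "[(v, w)]"] assms(4,5) by simp

lemma tlift_add:
  assumes "lspace V" "lspace W" "bilinear_on V W s b" "t \<in> tensor_carrier V W" "u \<in> tensor_carrier V W"
  shows "tlift V W b (t + u) = tlift V W b t + tlift V W b u"
proof -
  obtain ps where ps: "set ps \<subseteq> carrier V \<times> carrier W" "t = (\<Sum>(v, w)\<leftarrow>ps. tens V W v w)"
    using tensor_list[OF assms(1,2,4)] .
  obtain qs where qs: "set qs \<subseteq> carrier V \<times> carrier W" "u = (\<Sum>(v, w)\<leftarrow>qs. tens V W v w)"
    using tensor_list[OF assms(1,2,5)] .
  show ?thesis
    using tlift_list[OF assms(1-3) ps(1)] tlift_list[OF assms(1-3) qs(1)]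
      tlift_list[OF assms(1-3), of "ps @ qs"] ps qs by simp
qed

lemma tlift_scl:
  assumes "lspace V" "lspace W" "bilinear_on V W s b" "t \<in> tensor_carrier V W"
  shows "tlift V W b (fun_scl c t) = s c (tlift V W b t)"
  using assms(1,2,4)
proof (induction rule: tensor_induct)
  case (tens v w)
  then show ?case
    using assms tlift_tens[OF assms(1-3)] lspace.scl_in[OF assms(1)]
    by (simp add: tens_scl_left[symmetric] bilinear_onD(3)[OF assms(3)])
next
  case (add t u)
  have "module s" using bilinear_onD(1)[OF assms(3)] by (simp add: module_iff_vector_space)
  with add show ?case
    using tlift_add[OF assms(1-3)] tensor_scl_in[of _ V W]
    by (simp add: fs.scale_right_distrib module.scale_right_distrib)
qed

lemma tlift_zero:
  assumes "lspace V" "lspace W" "bilinear_on V W s b"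
  shows "tlift V W b 0 = 0"
  using tlift_add[OF assms tensor_zero_in tensor_zero_in] by simp

lemma tlift_sum:
  assumes "lspace V" "lspace W" "bilinear_on V W s b" "\<And>i. i \<in> I \<Longrightarrow> f i \<in> tensor_carrier V W"
  shows "tlift V W b (sum f I) = (\<Sum>i\<in>I. tlift V W b (f i))"
  using assms(4)
  by (induction I rule: infinite_finite_induct)
    (auto simp: tlift_zero[OF assms(1-3)] tlift_add[OF assms(1-3)] tensor_sum_in)

text \<open>A representation of \<open>t\<close> over the small carriers is also one over the large
  carriers, and both lifts evaluate it to the same sum.\<close>

lemma tlift_restrict:
  assumes "lspace V" "lspace W" "bilinear_on V W s b"
    "module.subspace (scl V) K" "module.subspace (scl W) M" "K \<subseteq> carrier V" "M \<subseteq> carrier W"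
    "t \<in> tensor_carrier (V\<lparr>carrier := K\<rparr>) (W\<lparr>carrier := M\<rparr>)"
  shows "tlift (V\<lparr>carrier := K\<rparr>) (W\<lparr>carrier := M\<rparr>) b t = tlift V W b t"
proof -
  let ?V = "V\<lparr>carrier := K\<rparr>" and ?W = "W\<lparr>carrier := M\<rparr>"
  have V: "lspace ?V" and W: "lspace ?W"
    using assms by (auto intro: lspace.lspace_restrict)
  have b: "bilinear_on ?V ?W s b"
    using assms(3,6,7) unfolding bilinear_on_def by (simp add: subset_iff) 
  obtain ps where ps: "set ps \<subseteq> carrier ?V \<times> carrier ?W" "t = (\<Sum>(v, w)\<leftarrow>ps. tens ?V ?W v w)"
    using tensor_list[OF V W assms(8)] .
  have "set ps \<subseteq> carrier V \<times> carrier W" using ps assms(6,7) by auto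
  then show ?thesis
    using tlift_list[OF V W b ps(1)] tlift_list[OF assms(1-3)]
    by (simp add: ps(2) tens_carrier_update)
qed

lemma tlift_in:
  assumes "lspace V" "lspace W" "bilinear_on V W s b" "t \<in> tensor_carrier V W"
    and "module.subspace s U" "\<And>v w. v \<in> carrier V \<Longrightarrow> w \<in> carrier W \<Longrightarrow> b v w \<in> U"
  shows "tlift V W b t \<in> U"
  using assms(1,2,4)
proof (induction rule: tensor_induct)
  case (tens v w)
  then show ?case using assms(6) by (simp add: tlift_tens[OF assms(1-3)])
next
  case (add t u)
  have "module s" using bilinear_onD(1)[OF assms(3)] by (simp add: module_iff_vector_space)
  with add show ?case
    using module.subspace_add[OF _ assms(5)] by (simp add: tlift_add[OF assms(1-3)])
qed

lemma tensor_eqI: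
  assumes "lspace V" "lspace W" "t \<in> tensor_carrier V W"
    and "\<And>t u. t \<in> tensor_carrier V W \<Longrightarrow> u \<in> tensor_carrier V W \<Longrightarrow> f (t + u) = f t + f u"
    and "\<And>t u. t \<in> tensor_carrier V W \<Longrightarrow> u \<in> tensor_carrier V W \<Longrightarrow> g (t + u) = g t + g u"
    and "\<And>v w. v \<in> carrier V \<Longrightarrow> w \<in> carrier W \<Longrightarrow> f (tens V W v w) = g (tens V W v w)"
  shows "f t = (g t :: 'u::plus)"
  using assms(1-3) by (induction rule: tensor_induct) (simp_all add: assms(4-6))

text \<open>A representation of \<open>t\<close> by pure tensors does not involve the parameters, so
  the lift is a fixed finite sum of maps bilinear in \<open>x\<close> and \<open>y\<close>. This
  handles the nested lifts in the product of \<open>tensor A B\<close>.\<close>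

lemma bilinear_on_tlift_param:
  assumes VW: "lspace V" "lspace W" "t \<in> tensor_carrier V W"
    and b: "\<And>x y. x \<in> carrier X \<Longrightarrow> y \<in> carrier Y \<Longrightarrow> bilinear_on V W s (b x y)"
    and c: "\<And>v w. v \<in> carrier V \<Longrightarrow> w \<in> carrier W \<Longrightarrow> bilinear_on X Y s (\<lambda>x y. b x y v w)"
    and XY: "lspace X" "lspace Y" "vector_space s"
  shows "bilinear_on X Y s (\<lambda>x y. tlift V W (b x y) t)"
proof -
  obtain ps where ps: "set ps \<subseteq> carrier V \<times> carrier W" "t = (\<Sum>(v, w)\<leftarrow>ps. tens V W v w)"
    using tensor_list[OF VW] .
  have eq: "tlift V W (b x y) t = (\<Sum>(v, w)\<leftarrow>ps. b x y v w)"
    if "x \<in> carrier X" "y \<in> carrier Y" for x y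
    using tlift_list[OF VW(1,2) b[OF that] ps(1)] ps(2) by simp
  interpret s: vector_space s by (rule XY(3))
  have sum: "bilinear_on X Y s (\<lambda>x y. \<Sum>(v, w)\<leftarrow>qs. b x y v w)"
    if "set qs \<subseteq> carrier V \<times> carrier W" for qs
    using that
  proof (induction qs)
    case Nil
    then show ?case by (auto intro!: bilinear_onI XY)
  next
    case (Cons q qs)
    obtain v w where q: "q = (v, w)" by force
    have "v \<in> carrier V" "w \<in> carrier W" using Cons.prems by (auto simp: q)
    note D = bilinear_onD[OF c[OF this]] and E = bilinear_onD[OF Cons.IH]
    show ?case using Cons.prems
      by (auto intro!: bilinear_onI XY simp: q D E s.scale_right_distrib)
  qed
  show ?thesis
    using bilinear_onD[OF sum[OF ps(1)]] XY
    by (auto intro!: bilinear_onI simp: eq lspace.add_in lspace.scl_in)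
qed

section \<open>Tensor products of algebras\<close>

context k_algebra
begin

lemma mult_add_right: "\<lbrakk>x \<in> carrier A; y \<in> carrier A; z \<in> carrier A\<rbrakk> \<Longrightarrow> x \<otimes> (y + z) = x \<otimes> y + x \<otimes> z"
  and mult_scl_right: "\<lbrakk>x \<in> carrier A; y \<in> carrier A\<rbrakk> \<Longrightarrow> x \<otimes> scl A c y = scl A c (x \<otimes> y)"
  using linear_mult_left[of x] by (auto simp: linear_map_def)

lemma mult_add_left: "\<lbrakk>x \<in> carrier A; y \<in> carrier A; z \<in> carrier A\<rbrakk> \<Longrightarrow> (y + z) \<otimes> x = y \<otimes> x + z \<otimes> x"
  and mult_scl_left: "\<lbrakk>x \<in> carrier A; y \<in> carrier A\<rbrakk> \<Longrightarrow> scl A c y \<otimes> x = scl A c (y \<otimes> x)"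
  using linear_mult_right[of x] by (auto simp: linear_map_def)

lemma mult_zero_right: "x \<in> carrier A \<Longrightarrow> x \<otimes> 0 = 0"
  using mult_add_right[of x 0 0] zero_in by simp

lemma mult_zero_left: "x \<in> carrier A \<Longrightarrow> 0 \<otimes> x = 0"
  using mult_add_left[of x 0 0] zero_in by simp

lemma mult_sum_right:
  "\<lbrakk>x \<in> carrier A; \<And>i. i \<in> I \<Longrightarrow> f i \<in> carrier A\<rbrakk> \<Longrightarrow> x \<otimes> sum f I = (\<Sum>i\<in>I. x \<otimes> f i)"
  by (induction I rule: infinite_finite_induct) (auto simp: mult_zero_right mult_add_right sum_in)

lemma mult_sum_left:
  "\<lbrakk>x \<in> carrier A; \<And>i. i \<in> I \<Longrightarrow> f i \<in> carrier A\<rbrakk> \<Longrightarrow> sum f I \<otimes> x = (\<Sum>i\<in>I. f i \<otimes> x)"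
  by (induction I rule: infinite_finite_induct) (auto simp: mult_zero_left mult_add_left sum_in)

lemma bilinear_on_mult: "bilinear_on A A (scl A) (\<otimes>)"
  by (rule bilinear_onI)
    (auto simp: ambient mult_add_left mult_add_right mult_scl_left mult_scl_right)

end

lemma k_algebraI:
  assumes "monoid A" "lspace A"
    and "\<And>x y z. x \<in> carrier A \<Longrightarrow> y \<in> carrier A \<Longrightarrow> z \<in> carrier A \<Longrightarrow> x \<otimes>\<^bsub>A\<^esub> (y + z) = x \<otimes>\<^bsub>A\<^esub> y + x \<otimes>\<^bsub>A\<^esub> z"
    and "\<And>x y z. x \<in> carrier A \<Longrightarrow> y \<in> carrier A \<Longrightarrow> z \<in> carrier A \<Longrightarrow> (y + z) \<otimes>\<^bsub>A\<^esub> x = y \<otimes>\<^bsub>A\<^esub> x + z \<otimes>\<^bsub>A\<^esub> x"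
    and "\<And>c x y. x \<in> carrier A \<Longrightarrow> y \<in> carrier A \<Longrightarrow> x \<otimes>\<^bsub>A\<^esub> scl A c y = scl A c (x \<otimes>\<^bsub>A\<^esub> y)"
    and "\<And>c x y. x \<in> carrier A \<Longrightarrow> y \<in> carrier A \<Longrightarrow> scl A c y \<otimes>\<^bsub>A\<^esub> x = scl A c (y \<otimes>\<^bsub>A\<^esub> x)"
  shows "k_algebra A"
  using assms monoid.m_closed[OF assms(1)]
  by (auto simp: k_algebra_def k_algebra_axioms_def lspace_def linear_map_def)

lemma tensor_simps [simp]:
  "carrier (tensor A B) = tensor_carrier A B" "scl (tensor A B) = fun_scl"
  "\<one>\<^bsub>tensor A B\<^esub> = tens A B \<one>\<^bsub>A\<^esub> \<one>\<^bsub>B\<^esub>"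
  by (simp_all add: tensor_def)

lemma lspace_tensor: "lspace (tensor A B)"
  by (simp add: lspace_def vector_space_fun_scl tensor_carrier_def)

locale algebra_pair = A: k_algebra A + B: k_algebra B
  for A :: "('k::field, 'v::ab_group_add, 'x) kalg_scheme"
    and B :: "('k, 'w::ab_group_add, 'y) kalg_scheme"
begin

lemma mult_inner_bilinear:
  assumes "a \<in> carrier A" "b \<in> carrier B"
  shows "bilinear_on A B fun_scl (\<lambda>a' b'. tens A B (a \<otimes>\<^bsub>A\<^esub> a') (b \<otimes>\<^bsub>B\<^esub> b'))"
  by (rule bilinear_onI)
    (auto simp: assms vector_space_fun_scl tens_add_left tens_add_right tens_scl_left tens_scl_right
        A.mult_add_right A.mult_scl_right B.mult_add_right B.mult_scl_right)

lemma mult_inner_bilinear':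
  assumes "a' \<in> carrier A" "b' \<in> carrier B"
  shows "bilinear_on A B fun_scl (\<lambda>a b. tens A B (a \<otimes>\<^bsub>A\<^esub> a') (b \<otimes>\<^bsub>B\<^esub> b'))"
  by (rule bilinear_onI)
    (auto simp: assms vector_space_fun_scl tens_add_left tens_add_right tens_scl_left tens_scl_right
        A.mult_add_left A.mult_scl_left B.mult_add_left B.mult_scl_left)

lemma mult_outer_bilinear:
  assumes "u \<in> tensor_carrier A B"
  shows "bilinear_on A B fun_scl
    (\<lambda>a b. tlift A B (\<lambda>a' b'. tens A B (a \<otimes>\<^bsub>A\<^esub> a') (b \<otimes>\<^bsub>B\<^esub> b')) u)"
  by (rule bilinear_on_tlift_param[OF A.lspace_axioms B.lspace_axioms assms
        mult_inner_bilinear mult_inner_bilinear' A.lspace_axioms B.lspace_axioms vector_space_fun_scl])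

lemmas inner_tlift = mult_inner_bilinear[THEN tlift_tens[OF A.lspace_axioms B.lspace_axioms]]
  mult_inner_bilinear[THEN tlift_add[OF A.lspace_axioms B.lspace_axioms]]
  mult_inner_bilinear[THEN tlift_scl[OF A.lspace_axioms B.lspace_axioms]]

lemmas outer_tlift = mult_outer_bilinear[THEN tlift_tens[OF A.lspace_axioms B.lspace_axioms]]
  mult_outer_bilinear[THEN tlift_add[OF A.lspace_axioms B.lspace_axioms]]
  mult_outer_bilinear[THEN tlift_scl[OF A.lspace_axioms B.lspace_axioms]]

lemma tensor_mult_tens:
  "\<lbrakk>a \<in> carrier A; a' \<in> carrier A; b \<in> carrier B; b' \<in> carrier B\<rbrakk> \<Longrightarrow>
    tens A B a b \<otimes>\<^bsub>tensor A B\<^esub> tens A B a' b' = tens A B (a \<otimes>\<^bsub>A\<^esub> a') (b \<otimes>\<^bsub>B\<^esub> b')"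
  by (simp add: tensor_def outer_tlift inner_tlift tens_in)

lemma tensor_mult_add_left:
  "\<lbrakk>t \<in> tensor_carrier A B; t' \<in> tensor_carrier A B; u \<in> tensor_carrier A B\<rbrakk> \<Longrightarrow>
    (t + t') \<otimes>\<^bsub>tensor A B\<^esub> u = t \<otimes>\<^bsub>tensor A B\<^esub> u + t' \<otimes>\<^bsub>tensor A B\<^esub> u"
  by (simp add: tensor_def outer_tlift)

lemma tensor_mult_scl_left:
  "\<lbrakk>t \<in> tensor_carrier A B; u \<in> tensor_carrier A B\<rbrakk> \<Longrightarrow>
    fun_scl c t \<otimes>\<^bsub>tensor A B\<^esub> u = fun_scl c (t \<otimes>\<^bsub>tensor A B\<^esub> u)"
  by (simp add: tensor_def outer_tlift)

lemma tensor_mult_add_right: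
  assumes "t \<in> tensor_carrier A B" "u \<in> tensor_carrier A B" "u' \<in> tensor_carrier A B"
  shows "t \<otimes>\<^bsub>tensor A B\<^esub> (u + u') = t \<otimes>\<^bsub>tensor A B\<^esub> u + t \<otimes>\<^bsub>tensor A B\<^esub> u'"
  by (rule tensor_eqI[OF A.lspace_axioms B.lspace_axioms assms(1)])
    (use assms in \<open>auto simp: tensor_mult_add_left tensor_add_in tensor_def outer_tlift inner_tlift\<close>)

lemma tensor_mult_scl_right:
  assumes "t \<in> tensor_carrier A B" "u \<in> tensor_carrier A B"
  shows "t \<otimes>\<^bsub>tensor A B\<^esub> fun_scl c u = fun_scl c (t \<otimes>\<^bsub>tensor A B\<^esub> u)"
  by (rule tensor_eqI[OF A.lspace_axioms B.lspace_axioms assms(1)])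
    (use assms in \<open>auto simp: tensor_mult_add_left tensor_scl_in tensor_def outer_tlift inner_tlift
        fs.scale_right_distrib\<close>)

lemma tensor_mult_in:
  assumes "t \<in> tensor_carrier A B" "u \<in> tensor_carrier A B"
  shows "t \<otimes>\<^bsub>tensor A B\<^esub> u \<in> tensor_carrier A B"
  using A.lspace_axioms B.lspace_axioms assms(1)
proof (induction rule: tensor_induct)
  case (tens a b)
  show ?case using A.lspace_axioms B.lspace_axioms assms(2)
  proof (induction rule: tensor_induct)
    case (tens a' b')
    with \<open>a \<in> carrier A\<close> \<open>b \<in> carrier B\<close> show ?case by (simp add: tensor_mult_tens tens_in)
  next
    case (add t u)
    with tens show ?case by (simp add: tensor_mult_add_right tens_in tensor_add_in)
  qed
next
  case (add t u)
  then show ?case using assms(2) by (simp add: tensor_mult_add_left tensor_add_in)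
qed

text \<open>Both sides are additive in each factor, so the three factors are replaced by pure
  tensors one after the other.\<close>

lemma tensor_mult_assoc:
  assumes "t \<in> tensor_carrier A B" "u \<in> tensor_carrier A B" "v \<in> tensor_carrier A B"
  shows "t \<otimes>\<^bsub>tensor A B\<^esub> u \<otimes>\<^bsub>tensor A B\<^esub> v = t \<otimes>\<^bsub>tensor A B\<^esub> (u \<otimes>\<^bsub>tensor A B\<^esub> v)"
proof (rule tensor_eqI[OF A.lspace_axioms B.lspace_axioms assms(1)])
  fix a b assume ab: "a \<in> carrier A" "b \<in> carrier B"
  show "tens A B a b \<otimes>\<^bsub>tensor A B\<^esub> u \<otimes>\<^bsub>tensor A B\<^esub> v = tens A B a b \<otimes>\<^bsub>tensor A B\<^esub> (u \<otimes>\<^bsub>tensor A B\<^esub> v)"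
  proof (rule tensor_eqI[OF A.lspace_axioms B.lspace_axioms assms(2)])
    fix a' b' assume ab': "a' \<in> carrier A" "b' \<in> carrier B"
    show "tens A B a b \<otimes>\<^bsub>tensor A B\<^esub> tens A B a' b' \<otimes>\<^bsub>tensor A B\<^esub> v
      = tens A B a b \<otimes>\<^bsub>tensor A B\<^esub> (tens A B a' b' \<otimes>\<^bsub>tensor A B\<^esub> v)"
      by (rule tensor_eqI[OF A.lspace_axioms B.lspace_axioms assms(3)])
        (use ab ab' in \<open>auto simp: tensor_mult_add_right tensor_mult_in tens_in tensor_mult_tens
           A.m_assoc B.m_assoc\<close>)
  qed (use ab assms in \<open>auto simp: tensor_mult_add_right tensor_mult_add_left tensor_mult_in tens_in\<close>)
qed (use assms in \<open>auto simp: tensor_mult_add_right tensor_mult_add_left tensor_mult_in tens_in\<close>)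

sublocale T: k_algebra "tensor A B"
proof (rule k_algebraI)
  show "monoid (tensor A B)"
  proof (rule monoidI)
    fix t assume "t \<in> carrier (tensor A B)"
    then have t: "t \<in> tensor_carrier A B" by simp
    show "\<one>\<^bsub>tensor A B\<^esub> \<otimes>\<^bsub>tensor A B\<^esub> t = t" "t \<otimes>\<^bsub>tensor A B\<^esub> \<one>\<^bsub>tensor A B\<^esub> = t"
      by (rule tensor_eqI[OF A.lspace_axioms B.lspace_axioms t];
        auto simp: tensor_mult_add_right tensor_mult_add_left tensor_mult_tens tens_in)+
  qed (auto simp: tensor_mult_in tensor_mult_assoc tens_in)
qed (auto simp: lspace_tensor tensor_mult_add_right tensor_mult_add_left
    tensor_mult_scl_right tensor_mult_scl_left)

end

definition op_alg :: "('k::field, 'v::ab_group_add, 'x) kalg_scheme \<Rightarrow> ('k, 'v, 'x) kalg_scheme" where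
  "op_alg A = A\<lparr>mult := (\<lambda>x y. y \<otimes>\<^bsub>A\<^esub> x)\<rparr>"

lemma op_alg_simps [simp]:
  "carrier (op_alg A) = carrier A" "scl (op_alg A) = scl A" "\<one>\<^bsub>op_alg A\<^esub> = \<one>\<^bsub>A\<^esub>"
  "x \<otimes>\<^bsub>op_alg A\<^esub> y = y \<otimes>\<^bsub>A\<^esub> x"
  by (simp_all add: op_alg_def)

lemma (in k_algebra) k_algebra_op: "k_algebra (op_alg A)"
proof (rule k_algebraI)
  show "monoid (op_alg A)"
    by (rule monoidI) (auto simp: m_assoc)
qed (auto simp: lspace_def ambient subspace mult_add_left mult_add_right mult_scl_left mult_scl_right)

text \<open>Passing to the opposite algebra changes only the product. Hence
  \<open>A \<otimes> A\<^sup>o\<^sup>p\<close> and \<open>A \<otimes> A\<close> have the same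
  elements, and maps defined on one can be used on the other.\<close>

lemma tens_op_alg [simp]: "tens A (op_alg B) = tens A B"
  by (simp add: tens_def fun_eq_iff)

lemma tensor_carrier_op_alg [simp]: "tensor_carrier A (op_alg B) = tensor_carrier A B"
  by (simp add: tensor_carrier_def)

lemma tlift_cong:
  assumes "\<And>v w. v \<in> carrier V \<Longrightarrow> w \<in> carrier W \<Longrightarrow> b v w = b' v w"
  shows "tlift V W b t = tlift V W b' t"
proof -
  have "(\<Sum>(v, w)\<leftarrow>ps. b v w) = (\<Sum>(v, w)\<leftarrow>ps. b' v w)" if "set ps \<subseteq> carrier V \<times> carrier W" for ps
    using that assms by (intro arg_cong[where f = sum_list] map_cong) auto
  then have "(\<exists>ps. set ps \<subseteq> carrier V \<times> carrier W \<and> t = (\<Sum>(v, w)\<leftarrow>ps. tens V W v w) \<and> u = (\<Sum>(v, w)\<leftarrow>ps. b v w))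
    = (\<exists>ps. set ps \<subseteq> carrier V \<times> carrier W \<and> t = (\<Sum>(v, w)\<leftarrow>ps. tens V W v w) \<and> u = (\<Sum>(v, w)\<leftarrow>ps. b' v w))" for u
    by metis
  then show ?thesis unfolding tlift_def by simp
qed

section \<open>Linear maps between carriers\<close>

lemma linear_mapD:
  assumes "linear_map V W f"
  shows "v \<in> carrier V \<Longrightarrow> f v \<in> carrier W"
    "u \<in> carrier V \<Longrightarrow> v \<in> carrier V \<Longrightarrow> f (u + v) = f u + f v"
    "v \<in> carrier V \<Longrightarrow> f (scl V c v) = scl W c (f v)"
  using assms by (auto simp: linear_map_def)

lemma linear_map_zero: "linear_map V W f \<Longrightarrow> lspace V \<Longrightarrow> f 0 = 0"
  using linear_mapD(2)[of V W f 0 0] lspace.zero_in[of V] by simp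

lemma linear_map_sum:
  assumes "linear_map V W f" "lspace V" "\<And>i. i \<in> I \<Longrightarrow> g i \<in> carrier V"
  shows "f (sum g I) = (\<Sum>i\<in>I. f (g i))"
  using assms(3)
  by (induction I rule: infinite_finite_induct)
    (auto simp: linear_map_zero[OF assms(1,2)] linear_mapD(2)[OF assms(1)] lspace.sum_in[OF assms(2)])

lemma linear_map_id: "linear_map V V id"
  by (simp add: linear_map_def)

lemma linear_map_tlift:
  assumes "lspace V" "lspace W" "bilinear_on V W (scl U) b" "lspace U"
    "\<And>v w. v \<in> carrier V \<Longrightarrow> w \<in> carrier W \<Longrightarrow> b v w \<in> carrier U"
  shows "linear_map (tensor V W) U (tlift V W b)"
  using assms tlift_in[OF assms(1-3)] lspace.lspace_subspace[OF assms(4)]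
  by (auto simp: linear_map_def tlift_add[OF assms(1-3)] tlift_scl[OF assms(1-3)])

lemma tmap_bilinear:
  assumes "linear_map V V' f" "linear_map W W' g"
  shows "bilinear_on V W fun_scl (\<lambda>v w. tens V' W' (f v) (g w))"
  using assms
  by (auto intro!: bilinear_onI simp: vector_space_fun_scl linear_mapD tens_add_left tens_add_right
      tens_scl_left tens_scl_right)

lemma linear_map_tmap:
  assumes "lspace V" "lspace W" "linear_map V V' f" "linear_map W W' g"
  shows "linear_map (tensor V W) (tensor V' W') (tmap V W V' W' f g)"
  unfolding tmap_def using assms tmap_bilinear[OF assms(3,4)]
  by (intro linear_map_tlift) (auto simp: lspace_tensor intro: tens_in linear_mapD)

lemma tmap_tens:
  assumes "lspace V" "lspace W" "linear_map V V' f" "linear_map W W' g" "v \<in> carrier V" "w \<in> carrier W"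
  shows "tmap V W V' W' f g (tens V W v w) = tens V' W' (f v) (g w)"
  unfolding tmap_def by (rule tlift_tens[OF assms(1,2) tmap_bilinear[OF assms(3,4)] assms(5,6)])

lemma linear_map_eqI:
  assumes "lspace V" "lspace W" "linear_map (tensor V W) U f" "linear_map (tensor V W) U' g"
    "t \<in> tensor_carrier V W"
    "\<And>v w. v \<in> carrier V \<Longrightarrow> w \<in> carrier W \<Longrightarrow> f (tens V W v w) = g (tens V W v w)"
  shows "f t = g t"
  by (rule tensor_eqI[OF assms(1,2,5), where f = f and g = g])
    (use assms(6) linear_mapD(2)[OF assms(3)] linear_mapD(2)[OF assms(4)] in simp_all)

lemma linear_map_comp: "linear_map U V f \<Longrightarrow> linear_map V W g \<Longrightarrow> linear_map U W (\<lambda>x. g (f x))"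
  by (auto simp: linear_map_def Pi_def)

lemma linear_map_tens_left: "w \<in> carrier W \<Longrightarrow> linear_map V (tensor V W) (\<lambda>v. tens V W v w)"
  and linear_map_tens_right: "v \<in> carrier V \<Longrightarrow> linear_map W (tensor V W) (tens V W v)"
  by (auto simp: linear_map_def tens_in tens_add_left tens_add_right tens_scl_left tens_scl_right)

lemma linear_map_cong:
  "linear_map V W f \<Longrightarrow> lspace V \<Longrightarrow> (\<And>v. v \<in> carrier V \<Longrightarrow> f v = g v) \<Longrightarrow> linear_map V W g"
  by (auto simp: linear_map_def lspace.add_in lspace.scl_in Pi_iff)

lemma linear_map_lincomb:
  assumes "lspace W" "lspace V" "\<And>i. i \<in> I \<Longrightarrow> linear_map V W (f i)"
  shows "linear_map V W (\<lambda>v. \<Sum>i\<in>I. f i v)"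
proof -
  interpret W: lspace W by fact
  show ?thesis using assms(3) W.zero_in
    by (auto simp: linear_map_def sum.distrib W.vs.scale_sum_right Pi_def intro!: W.sum_in)
qed

section \<open>The associativity isomorphism\<close>

lemma tassoc_bilinear:
  assumes "lspace U" "lspace V" "lspace W"
  shows "bilinear_on (tensor U V) W fun_scl
    (\<lambda>t w. tlift U V (\<lambda>u v. tens U (tensor V W) u (tens V W v w)) t)"
proof -
  have b: "bilinear_on U V fun_scl (\<lambda>u v. tens U (tensor V W) u (tens V W v w))" for w
    by (rule bilinear_onI)
      (auto simp: vector_space_fun_scl tens_add_left tens_add_right tens_scl_left tens_scl_right
        tens_scl_right[of U "tensor V W", simplified])
  note T = tlift_tens[OF assms(1,2) b] tlift_add[OF assms(1,2) b] tlift_scl[OF assms(1,2) b]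
  show ?thesis
  proof (rule bilinear_onI)
    let ?m = "\<lambda>w. tlift U V (\<lambda>u v. tens U (tensor V W) u (tens V W v w))"
    fix t w w' assume t: "t \<in> carrier (tensor U V)" and w: "w \<in> carrier W" "w' \<in> carrier W"
    show "?m (w + w') t = ?m w t + ?m w' t"
      by (rule tensor_eqI[OF assms(1,2), where f = "?m (w + w')" and g = "\<lambda>t. ?m w t + ?m w' t"])
        (use t in \<open>auto simp: T add_ac\<close>, simp add: tens_add_right add_ac)
  next
    let ?m = "\<lambda>w. tlift U V (\<lambda>u v. tens U (tensor V W) u (tens V W v w))"
    fix c t w assume t: "t \<in> carrier (tensor U V)" and w: "w \<in> carrier W"
    show "?m (scl W c w) t = fun_scl c (?m w t)"
      by (rule tensor_eqI[OF assms(1,2), where f = "?m (scl W c w)" and g = "\<lambda>t. fun_scl c (?m w t)"])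
        (use t in \<open>auto simp: T fs.scale_right_distrib\<close>, simp add: tens_scl_right tens_scl_right[of U "tensor V W", simplified])
  qed (auto simp: vector_space_fun_scl T)
qed

lemma linear_map_tassoc:
  assumes "lspace U" "lspace V" "lspace W"
  shows "linear_map (tensor (tensor U V) W) (tensor U (tensor V W)) (tassoc U V W)"
proof -
  have b: "bilinear_on U V fun_scl (\<lambda>u v. tens U (tensor V W) u (tens V W v w))" for w
    by (rule bilinear_onI)
      (auto simp: vector_space_fun_scl tens_add_left tens_add_right tens_scl_left tens_scl_right
        tens_scl_right[of U "tensor V W", simplified])
  show ?thesis
    unfolding tassoc_def
  proof (rule linear_map_tlift)
    fix t w assume "t \<in> carrier (tensor U V)" "w \<in> carrier W"
    then show "tlift U V (\<lambda>u v. tens U (tensor V W) u (tens V W v w)) t \<in> carrier (tensor U (tensor V W))"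
      by (intro tlift_in[OF assms(1,2) b])
        (auto intro!: tens_in lspace.lspace_subspace[OF lspace_tensor, simplified] simp del: tensor_simps
          simp: tensor_simps(1)[of U V] tensor_simps(1)[of U "tensor V W"] tensor_simps(1)[of V W])
  qed (auto simp: assms lspace_tensor tassoc_bilinear)
qed

lemma tassoc_tens:
  assumes "lspace U" "lspace V" "lspace W" "u \<in> carrier U" "v \<in> carrier V" "w \<in> carrier W"
  shows "tassoc U V W (tens (tensor U V) W (tens U V u v) w) = tens U (tensor V W) u (tens V W v w)"
proof -
  have b: "bilinear_on U V fun_scl (\<lambda>u v. tens U (tensor V W) u (tens V W v w))" for w
    by (rule bilinear_onI)
      (auto simp: vector_space_fun_scl tens_add_left tens_add_right tens_scl_left tens_scl_right
        tens_scl_right[of U "tensor V W", simplified])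
  show ?thesis
    unfolding tassoc_def
    using tlift_tens[OF lspace_tensor assms(3) tassoc_bilinear[OF assms(1-3)], of "tens U V u v" w]
      tlift_tens[OF assms(1,2) b] assms by (simp add: tens_in)
qed

lemma base_field_simps [simp]: "carrier base_field = UNIV" "scl base_field = (*)"
  "x \<otimes>\<^bsub>base_field\<^esub> y = x * y" "\<one>\<^bsub>base_field\<^esub> = 1"
  by (simp_all add: base_field_def)

section \<open>The canonical map of a left comodule algebra\<close>

context left_comodule_algebra
begin

sublocale LA: algebra_pair L A
  by (simp add: algebra_pair_def A.k_algebra_axioms L.k_algebra_axioms)

sublocale AA: algebra_pair A "op_alg A"
  by (simp add: algebra_pair_def A.k_algebra_axioms A.k_algebra_op)

sublocale LL: algebra_pair L L
  by (simp add: algebra_pair_def L.k_algebra_axioms)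

text \<open>The opposite product in the second factor is forced by the canonical map:
  \<open>x \<otimes> y\<close> goes to \<open>\<delta> x\<close> times \<open>1 \<otimes> y\<close>,
  so a further factor \<open>\<delta> x'\<close> has to be inserted between
  \<open>\<delta> x\<close> and the right coefficient.\<close>

abbreviation "E \<equiv> tensor A (op_alg A)"

abbreviation E_times (infixl "\<star>" 70) where
  "t \<star> u \<equiv> t \<otimes>\<^bsub>E\<^esub> u"

abbreviation "AA \<equiv> tensor_carrier A A"
abbreviation "LA \<equiv> tensor_carrier L A"

lemmas AA_eqI = linear_map_eqI[OF A.lspace_axioms A.lspace_axioms]
lemmas LA_eqI = linear_map_eqI[OF L.lspace_axioms A.lspace_axioms]

lemma coaction_linear: "linear_map A (tensor L A) \<delta>"
  using coaction_hom by (simp add: algebra_hom_def)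

lemma coaction_in: "a \<in> carrier A \<Longrightarrow> \<delta> a \<in> LA"
  using linear_mapD(1)[OF coaction_linear] by simp

lemma coaction_mult:
  "\<lbrakk>x \<in> carrier A; y \<in> carrier A\<rbrakk> \<Longrightarrow> \<delta> (x \<otimes>\<^bsub>A\<^esub> y) = \<delta> x \<otimes>\<^bsub>tensor L A\<^esub> \<delta> y"
  using coaction_hom by (auto simp: algebra_hom_def hom_def)

text \<open>The canonical map of the Galois condition, written as a product in
  \<open>tensor L A\<close> so that multiplicativity of \<open>\<delta>\<close> applies directly;
  \<open>canon_eq\<close> identifies the two forms.\<close>

definition canon :: "('k, 'a, 'a) tensor \<Rightarrow> ('k, 'v, 'a) tensor" where
  "canon = tlift A A (\<lambda>x y. \<delta> x \<otimes>\<^bsub>tensor L A\<^esub> tens L A \<one>\<^bsub>L\<^esub> y)"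

lemma canon_bilinear: "bilinear_on A A fun_scl (\<lambda>x y. \<delta> x \<otimes>\<^bsub>tensor L A\<^esub> tens L A \<one>\<^bsub>L\<^esub> y)"
  by (rule bilinear_onI)
    (auto simp: vector_space_fun_scl linear_mapD[OF coaction_linear, simplified] tens_in
      LA.tensor_mult_add_left LA.tensor_mult_add_right LA.tensor_mult_scl_left LA.tensor_mult_scl_right
      tens_add_right tens_scl_right)

lemma linear_map_canon: "linear_map (tensor A A) (tensor L A) canon"
  unfolding canon_def
  by (rule linear_map_tlift)
    (auto simp: A.lspace_axioms lspace_tensor canon_bilinear intro!: LA.tensor_mult_in coaction_in tens_in)

lemma canon_tens: "\<lbrakk>x \<in> carrier A; y \<in> carrier A\<rbrakk> \<Longrightarrow>
    canon (tens A A x y) = \<delta> x \<otimes>\<^bsub>tensor L A\<^esub> tens L A \<one>\<^bsub>L\<^esub> y"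
  unfolding canon_def by (rule tlift_tens[OF A.lspace_axioms A.lspace_axioms canon_bilinear])

lemma mult_right_bilinear:
  "y \<in> carrier A \<Longrightarrow> bilinear_on L A fun_scl (\<lambda>x1 x0. tens L A x1 (x0 \<otimes>\<^bsub>A\<^esub> y))"
  by (rule bilinear_onI)
    (auto simp: vector_space_fun_scl tens_add_left tens_add_right tens_scl_left tens_scl_right
      A.mult_add_left A.mult_scl_left)

lemma tlift_mult_right:
  assumes "t \<in> LA" "y \<in> carrier A"
  shows "tlift L A (\<lambda>x1 x0. tens L A x1 (x0 \<otimes>\<^bsub>A\<^esub> y)) t = t \<otimes>\<^bsub>tensor L A\<^esub> tens L A \<one>\<^bsub>L\<^esub> y"
  by (rule LA_eqI[OF linear_map_tlift[where U = "tensor L A"]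
        LA.T.linear_mult_right assms(1)])
    (use assms mult_right_bilinear in \<open>auto simp: L.lspace_axioms A.lspace_axioms lspace_tensor
       tlift_tens[OF L.lspace_axioms A.lspace_axioms mult_right_bilinear] LA.tensor_mult_tens tens_in\<close>)

lemma canon_eq:
  "tlift A A (\<lambda>x y. tlift L A (\<lambda>x1 x0. tens L A x1 (x0 \<otimes>\<^bsub>A\<^esub> y)) (\<delta> x)) t = canon t"
  unfolding canon_def
  by (rule tlift_cong) (simp add: tlift_mult_right coaction_in)

lemma E_mult_tens:
  "\<lbrakk>x \<in> carrier A; y \<in> carrier A; x' \<in> carrier A; y' \<in> carrier A\<rbrakk> \<Longrightarrow>
    tens A A x y \<star> tens A A x' y' = tens A A (x \<otimes>\<^bsub>A\<^esub> x') (y' \<otimes>\<^bsub>A\<^esub> y)"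
  using AA.tensor_mult_tens[of x x' y y'] by simp

lemma E_mult_in: "\<lbrakk>t \<in> AA; u \<in> AA\<rbrakk> \<Longrightarrow> t \<star> u \<in> AA"
  using AA.tensor_mult_in by simp

lemma E_assoc: "\<lbrakk>t \<in> AA; u \<in> AA; v \<in> AA\<rbrakk> \<Longrightarrow>
    t \<star> u \<star> v = t \<star> (u \<star> v)"
  using AA.tensor_mult_assoc by simp

lemma linear_map_E_left: "t \<in> AA \<Longrightarrow> linear_map (tensor A A) (tensor A A) (\<lambda>u. t \<star> u)"
  and linear_map_E_right: "t \<in> AA \<Longrightarrow> linear_map (tensor A A) (tensor A A) (\<lambda>u. u \<star> t)"
  using AA.T.linear_mult_left[of t] AA.T.linear_mult_right[of t] by (simp_all add: linear_map_def)

text \<open>Here the order of factors is that of \<open>A \<otimes> A\<^sup>o\<^sup>p\<close>: right coefficients multiply from outside.\<close>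

lemma canon_mult:
  assumes t: "t \<in> AA" and u: "u \<in> AA" and l: "l \<in> carrier L"
    and eq: "canon u = tens L A l \<one>\<^bsub>A\<^esub>"
  shows "canon (t \<star> u) = canon t \<otimes>\<^bsub>tensor L A\<^esub> tens L A l \<one>\<^bsub>A\<^esub>"
proof -
  note cl = LA.tensor_mult_in coaction_in tens_in
  \<comment> \<open>Multiplying \<open>u\<close> by a pure tensor from the left encloses
    \<open>canon u\<close> between \<open>\<delta> x\<close> and
    \<open>1 \<otimes> y\<close>.\<close>
  have pure: "canon (tens A A x y \<star> u) = \<delta> x \<otimes>\<^bsub>tensor L A\<^esub> canon u \<otimes>\<^bsub>tensor L A\<^esub> tens L A \<one>\<^bsub>L\<^esub> y"
    if xy: "x \<in> carrier A" "y \<in> carrier A" for x y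
  proof (rule AA_eqI[OF linear_map_comp[OF linear_map_E_left linear_map_canon] _ u])
    show "linear_map (tensor A A) (tensor L A)
      (\<lambda>u. \<delta> x \<otimes>\<^bsub>tensor L A\<^esub> canon u \<otimes>\<^bsub>tensor L A\<^esub> tens L A \<one>\<^bsub>L\<^esub> y)"
      by (rule linear_map_comp[OF linear_map_comp[OF linear_map_canon LA.T.linear_mult_left] LA.T.linear_mult_right])
        (use xy in \<open>auto intro: cl\<close>)
    fix x' y' assume xy': "x' \<in> carrier A" "y' \<in> carrier A"
    have "canon (tens A A x y \<star> tens A A x' y') = canon (tens A A (x \<otimes>\<^bsub>A\<^esub> x') (y' \<otimes>\<^bsub>A\<^esub> y))"
      using xy xy' by (simp add: E_mult_tens)
    also have "\<dots> = \<delta> x \<otimes>\<^bsub>tensor L A\<^esub> \<delta> x' \<otimes>\<^bsub>tensor L A\<^esub> (tens L A \<one>\<^bsub>L\<^esub> y' \<otimes>\<^bsub>tensor L A\<^esub> tens L A \<one>\<^bsub>L\<^esub> y)"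
      using xy xy' by (simp add: canon_tens coaction_mult LA.tensor_mult_tens)
    also have "\<dots> = \<delta> x \<otimes>\<^bsub>tensor L A\<^esub> canon (tens A A x' y') \<otimes>\<^bsub>tensor L A\<^esub> tens L A \<one>\<^bsub>L\<^esub> y"
      using xy xy' by (simp add: canon_tens LA.tensor_mult_assoc cl)
    finally show "canon (tens A A x y \<star> tens A A x' y') =
      \<delta> x \<otimes>\<^bsub>tensor L A\<^esub> canon (tens A A x' y') \<otimes>\<^bsub>tensor L A\<^esub> tens L A \<one>\<^bsub>L\<^esub> y" .
  qed (use xy in \<open>auto intro: tens_in\<close>)
  show ?thesis
  proof (rule AA_eqI[OF linear_map_comp[OF linear_map_E_right[OF u] linear_map_canon]
        linear_map_comp[OF linear_map_canon LA.T.linear_mult_right] t])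
    fix x y assume xy: "x \<in> carrier A" "y \<in> carrier A"
    \<comment> \<open>\<open>l \<otimes> 1\<close> commutes with \<open>1 \<otimes> y\<close>, so
      the contribution of \<open>u\<close> moves to the far right.\<close>
    show "canon (tens A A x y \<star> u) = canon (tens A A x y) \<otimes>\<^bsub>tensor L A\<^esub> tens L A l \<one>\<^bsub>A\<^esub>"
      using xy l by (simp add: pure eq canon_tens LA.tensor_mult_assoc cl LA.tensor_mult_tens)
  qed (use l in \<open>auto intro: tens_in\<close>)
qed

section \<open>The counit, the multiplication map and functionals on the leg in
  \<open>L\<close>\<close>

lemma counit_linear: "linear_map L base_field (counit L)"
  using L.counit_hom by (simp add: algebra_hom_def)

lemma counit_add: "x \<in> carrier L \<Longrightarrow> y \<in> carrier L \<Longrightarrow> counit L (x + y) = counit L x + counit L y"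
  and counit_scl: "x \<in> carrier L \<Longrightarrow> counit L (scl L c x) = c * counit L x"
  using linear_mapD[OF counit_linear] by simp_all

lemma counit_mult: "x \<in> carrier L \<Longrightarrow> y \<in> carrier L \<Longrightarrow> counit L (x \<otimes>\<^bsub>L\<^esub> y) = counit L x * counit L y"
  and counit_one: "counit L \<one>\<^bsub>L\<^esub> = 1"
  using L.counit_hom by (auto simp: algebra_hom_def hom_def)

definition multiply :: "('k, 'a, 'a) tensor \<Rightarrow> 'a" where
  "multiply = tlift A A (\<lambda>x y. x \<otimes>\<^bsub>A\<^esub> y)"

lemma linear_map_multiply: "linear_map (tensor A A) A multiply"
  unfolding multiply_def
  by (rule linear_map_tlift) (auto simp: A.lspace_axioms A.bilinear_on_mult)

lemma multiply_tens: "\<lbrakk>x \<in> carrier A; y \<in> carrier A\<rbrakk> \<Longrightarrow> multiply (tens A A x y) = x \<otimes>\<^bsub>A\<^esub> y"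
  unfolding multiply_def by (rule tlift_tens[OF A.lspace_axioms A.lspace_axioms A.bilinear_on_mult])

text \<open>Functionals on \<open>L\<close> turn identities in \<open>L \<otimes> A\<close> into
  identities in \<open>A\<close>; for the counit, the leg of \<open>\<delta> a\<close> is
  \<open>a\<close> itself.\<close>

definition leg :: "('v \<Rightarrow> 'k) \<Rightarrow> ('k, 'v, 'a) tensor \<Rightarrow> 'a" where
  "leg \<psi> = tlift L A (\<lambda>h x. scl A (\<psi> h) x)"

context
  fixes \<psi> :: "'v \<Rightarrow> 'k"
  assumes \<psi>: "linear_map L base_field \<psi>"
begin

lemma leg_bilinear: "bilinear_on L A (scl A) (\<lambda>h x. scl A (\<psi> h) x)"
  using linear_mapD[OF \<psi>]
  by (intro bilinear_onI)
    (auto simp: A.ambient A.vs.scale_left_distrib A.vs.scale_right_distrib mult.commute)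

lemma linear_map_leg: "linear_map (tensor L A) A (leg \<psi>)"
  unfolding leg_def
  by (rule linear_map_tlift) (auto simp: A.lspace_axioms L.lspace_axioms leg_bilinear A.scl_in)

lemma leg_tens: "\<lbrakk>h \<in> carrier L; x \<in> carrier A\<rbrakk> \<Longrightarrow> leg \<psi> (tens L A h x) = scl A (\<psi> h) x"
  unfolding leg_def by (rule tlift_tens[OF L.lspace_axioms A.lspace_axioms leg_bilinear])

lemma leg_in: "t \<in> LA \<Longrightarrow> leg \<psi> t \<in> carrier A"
  using linear_mapD(1)[OF linear_map_leg] by simp

lemma leg_mult_right:
  assumes "t \<in> LA" "y \<in> carrier A"
  shows "leg \<psi> (t \<otimes>\<^bsub>tensor L A\<^esub> tens L A \<one>\<^bsub>L\<^esub> y) = leg \<psi> t \<otimes>\<^bsub>A\<^esub> y"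
  by (rule LA_eqI[where f = "\<lambda>t. leg \<psi> (t \<otimes>\<^bsub>tensor L A\<^esub> tens L A \<one>\<^bsub>L\<^esub> y)", OF linear_map_comp[OF LA.T.linear_mult_right linear_map_leg]
          linear_map_comp[OF linear_map_leg A.linear_mult_right]])
    (use assms in \<open>auto simp: LA.tensor_mult_tens leg_tens A.mult_scl_left tens_in\<close>)

lemma linear_map_leg_coaction: "linear_map A A (\<lambda>x. leg \<psi> (\<delta> x))"
  by (rule linear_map_comp[OF coaction_linear linear_map_leg])

text \<open>The second factor of \<open>t\<close> is multiplied in from the right and passes the
  functional untouched; \<open>\<psi>\<close> only meets the coaction of the first factor.\<close>

lemma leg_canon:
  assumes "t \<in> AA"
  shows "leg \<psi> (canon t) = multiply (tmap A A A A (\<lambda>x. leg \<psi> (\<delta> x)) id t)"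
  by (rule AA_eqI[where f = "\<lambda>t. leg \<psi> (canon t)", OF linear_map_comp[OF linear_map_canon linear_map_leg]
          linear_map_comp[OF linear_map_tmap[OF A.lspace_axioms A.lspace_axioms linear_map_leg_coaction
            linear_map_id] linear_map_multiply] assms])
    (auto simp: canon_tens leg_mult_right coaction_in leg_in multiply_tens
      tmap_tens[OF A.lspace_axioms A.lspace_axioms linear_map_leg_coaction linear_map_id])

end

lemma leg_counit: "a \<in> carrier A \<Longrightarrow> leg (counit L) (\<delta> a) = a"
  unfolding leg_def by (rule coaction_counit)

text \<open>Links the counit of \<open>L\<close> with products in \<open>A\<close>: if
  \<open>canon t\<close> is \<open>l \<otimes> 1\<close>, the factors of \<open>t\<close> multiply
  to the counit of \<open>l\<close>.\<close>

lemma counit_canon: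
  assumes "t \<in> AA"
  shows "leg (counit L) (canon t) = multiply t"
  by (rule AA_eqI[where f = "\<lambda>t. leg (counit L) (canon t)", OF linear_map_comp[OF linear_map_canon linear_map_leg[OF counit_linear]]
          linear_map_multiply assms])
    (auto simp: canon_tens leg_mult_right[OF counit_linear] coaction_in multiply_tens leg_counit)

end

section \<open>Matrix coefficients of a Galois object\<close>

context left_galois_object
begin

lemma canon_bij: "bij_betw canon (AA) (LA)"
  using canonical_bij by (simp add: canon_eq[abs_def] cong: bij_betw_cong)

lemma canon_in: "t \<in> AA \<Longrightarrow> canon t \<in> LA"
  using linear_mapD(1)[OF linear_map_canon] by simp

lemma canon_inj: "\<lbrakk>canon t = canon u; t \<in> AA; u \<in> AA\<rbrakk> \<Longrightarrow> t = u"
  using canon_bij by (auto simp: bij_betw_def inj_on_def)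

lemma canon_surj:
  assumes "t \<in> LA"
  obtains u where "u \<in> AA" "canon u = t"
  using assms canon_bij by (force simp: bij_betw_def)

end

section \<open>Coordinates in a finite basis\<close>

locale finite_left_galois = left_galois_object L A \<delta>
  for L :: "('k::field, 'v::ab_group_add, 'x) hopf_scheme"
    and A :: "('k, 'a::ab_group_add, 'y) kalg_scheme"
    and \<delta> :: "'a \<Rightarrow> ('k, 'v, 'a) tensor" +
  fixes Bs :: "'a set" and crd :: "'a \<Rightarrow> 'a \<Rightarrow> 'k"
  assumes finite_Bs: "finite Bs" and Bs_in: "Bs \<subseteq> carrier A"
    and crd_linear: "b \<in> Bs \<Longrightarrow> linear_map A base_field (crd b)"
    and expand: "x \<in> carrier A \<Longrightarrow> x = (\<Sum>b\<in>Bs. scl A (crd b x) b)"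
    and crd_basis: "\<lbrakk>b \<in> Bs; b' \<in> Bs\<rbrakk> \<Longrightarrow> crd b b' = (if b = b' then 1 else 0)"
begin

lemmas Bs_carrier [simp] = subsetD[OF Bs_in]

lemma crd_add: "\<lbrakk>b \<in> Bs; x \<in> carrier A; y \<in> carrier A\<rbrakk> \<Longrightarrow> crd b (x + y) = crd b x + crd b y"
  and crd_scl: "\<lbrakk>b \<in> Bs; x \<in> carrier A\<rbrakk> \<Longrightarrow> crd b (scl A c x) = c * crd b x"
  using linear_mapD[OF crd_linear] by simp_all

definition slice :: "'a \<Rightarrow> ('k, 'v, 'a) tensor \<Rightarrow> 'v" where
  "slice b = tlift L A (\<lambda>h x. scl L (crd b x) h)"

lemma slice_bilinear: "b \<in> Bs \<Longrightarrow> bilinear_on L A (scl L) (\<lambda>h x. scl L (crd b x) h)"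
  by (rule bilinear_onI)
    (auto simp: L.ambient crd_add crd_scl L.vs.scale_left_distrib L.vs.scale_right_distrib
      L.vs.scale_left_commute mult.commute)

lemma linear_map_slice: "b \<in> Bs \<Longrightarrow> linear_map (tensor L A) L (slice b)"
  unfolding slice_def
  by (rule linear_map_tlift) (auto simp: A.lspace_axioms L.lspace_axioms slice_bilinear L.scl_in)

lemma slice_tens: "\<lbrakk>b \<in> Bs; h \<in> carrier L; x \<in> carrier A\<rbrakk> \<Longrightarrow> slice b (tens L A h x) = scl L (crd b x) h"
  unfolding slice_def by (rule tlift_tens[OF L.lspace_axioms A.lspace_axioms slice_bilinear])

lemma slice_in: "\<lbrakk>b \<in> Bs; t \<in> LA\<rbrakk> \<Longrightarrow> slice b t \<in> carrier L"
  using linear_mapD(1)[OF linear_map_slice] by simp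

lemma tensor_expand:
  assumes "t \<in> LA"
  shows "t = (\<Sum>b\<in>Bs. tens L A (slice b t) b)"
proof (rule LA_eqI[where f = "\<lambda>t. t" and U = "tensor L A" and U' = "tensor L A", OF _ _ assms])
  show "linear_map (tensor L A) (tensor L A) (\<lambda>t. \<Sum>b\<in>Bs. tens L A (slice b t) b)"
    by (intro linear_map_lincomb lspace_tensor linear_map_comp[OF linear_map_slice linear_map_tens_left]) auto
  fix h x assume hx: "h \<in> carrier L" "x \<in> carrier A"
  have "tens L A h x = tens L A h (\<Sum>b\<in>Bs. scl A (crd b x) b)"
    using expand[OF hx(2)] by simp
  also have "\<dots> = (\<Sum>b\<in>Bs. tens L A (slice b (tens L A h x)) b)"
    using hx by (simp add: tens_sum_right slice_tens tens_scl_left tens_scl_right cong: sum.cong)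
  finally show "tens L A h x = (\<Sum>b\<in>Bs. tens L A (slice b (tens L A h x)) b)" .
qed (auto simp: linear_map_def)

lemma tensor_slice_eqI:
  assumes "t \<in> LA" "u \<in> LA" "\<And>b. b \<in> Bs \<Longrightarrow> slice b t = slice b u"
  shows "t = u"
  using tensor_expand[OF assms(1)] tensor_expand[OF assms(2)] assms(3) by (simp cong: sum.cong)

lemma unit_coordinate:
  obtains b where "b \<in> Bs" "crd b \<one>\<^bsub>A\<^esub> \<noteq> 0"
proof -
  have "\<one>\<^bsub>A\<^esub> = 0" if "\<And>b. b \<in> Bs \<Longrightarrow> crd b \<one>\<^bsub>A\<^esub> = 0"
    using expand[of "\<one>\<^bsub>A\<^esub>"] that by simp
  then show ?thesis using that nonzero by blast
qed

text \<open>As the unit of \<open>A\<close> is non-zero, one of its coordinates is; the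
  corresponding slice of \<open>l \<otimes> 1\<close> is a non-zero multiple of
  \<open>l\<close>.\<close>

lemma tens_one_mem:
  assumes "l \<in> carrier L" "module.subspace (scl L) K" "\<And>b. b \<in> Bs \<Longrightarrow> slice b (tens L A l \<one>\<^bsub>A\<^esub>) \<in> K"
  shows "l \<in> K"
proof -
  obtain b where b: "b \<in> Bs" "crd b \<one>\<^bsub>A\<^esub> \<noteq> 0" by (rule unit_coordinate)
  then have "scl L (crd b \<one>\<^bsub>A\<^esub>) l \<in> K" using assms by (simp add: slice_tens)
  from L.vs.subspace_scale[OF assms(2) this, of "inverse (crd b \<one>\<^bsub>A\<^esub>)"] b show ?thesis by simp
qed

lemma tens_one_inj:
  assumes "tens L A l \<one>\<^bsub>A\<^esub> = tens L A l' \<one>\<^bsub>A\<^esub>" "l \<in> carrier L" "l' \<in> carrier L"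
  shows "l = l'"
proof -
  obtain b where b: "b \<in> Bs" "crd b \<one>\<^bsub>A\<^esub> \<noteq> 0" by (rule unit_coordinate)
  then have "scl L (crd b \<one>\<^bsub>A\<^esub>) l = scl L (crd b \<one>\<^bsub>A\<^esub>) l'"
    using assms by (metis slice_tens A.one_closed)
  with b show ?thesis by simp
qed

text \<open>The matrix of the coaction, with the basis itself as index set. Sweedler sums for the
  element \<open>cf i k\<close> become matrix products of coefficients.\<close>

definition cf :: "'a \<Rightarrow> 'a \<Rightarrow> 'v" where
  "cf i j = slice j (\<delta> i)"

lemma cf_in [simp]: "\<lbrakk>i \<in> Bs; j \<in> Bs\<rbrakk> \<Longrightarrow> cf i j \<in> carrier L"
  by (simp add: cf_def slice_in coaction_in)

lemma coaction_expand: "i \<in> Bs \<Longrightarrow> \<delta> i = (\<Sum>j\<in>Bs. tens L A (cf i j) j)"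
  unfolding cf_def by (rule tensor_expand) (simp add: coaction_in)

lemma comul_linear: "linear_map L (tensor L L) (comul L)"
  using L.comul_hom by (simp add: algebra_hom_def)

lemma comul_in: "l \<in> carrier L \<Longrightarrow> comul L l \<in> tensor_carrier L L"
  using linear_mapD(1)[OF comul_linear] by simp

lemma comul_mult:
  "\<lbrakk>x \<in> carrier L; y \<in> carrier L\<rbrakk> \<Longrightarrow> comul L (x \<otimes>\<^bsub>L\<^esub> y) = comul L x \<otimes>\<^bsub>tensor L L\<^esub> comul L y"
  and comul_one: "comul L \<one>\<^bsub>L\<^esub> = tens L L \<one>\<^bsub>L\<^esub> \<one>\<^bsub>L\<^esub>"
  using L.comul_hom by (auto simp: algebra_hom_def hom_def)

text \<open>Coassociativity of the coaction at \<open>i\<close>, compared at the coordinate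
  \<open>k\<close>.\<close>

lemma comul_cf:
  assumes i: "i \<in> Bs" and k: "k \<in> Bs"
  shows "comul L (cf i k) = (\<Sum>m\<in>Bs. tens L L (cf i m) (cf m k))"
proof -
  let ?LA = "tensor L A" and ?LL = "tensor L L"
  have lin: "linear_map L ?LL (comul L)" "linear_map A ?LA \<delta>" "linear_map L L id" "linear_map A A id"
    by (simp_all add: comul_linear coaction_linear linear_map_id)
  note LA = L.lspace_axioms A.lspace_axioms
  \<comment> \<open>\<open>K\<close> extracts the coordinate \<open>k\<close> of the last tensor
    factor; both sides of coassociativity are pushed through it.\<close>
  define K where "K = tmap L ?LA L L id (slice k)"
  have K: "linear_map (tensor L ?LA) ?LL K"
    unfolding K_def using k by (intro linear_map_tmap) (auto simp: LA lspace_tensor linear_map_id linear_map_slice)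
  have K_tens: "K (tens L ?LA h t) = tens L L h (slice k t)" if "h \<in> carrier L" "t \<in> LA" for h t
    using that k unfolding K_def
    by (subst tmap_tens) (auto simp: LA lspace_tensor linear_map_id linear_map_slice)
  have "K (tmap L A L ?LA id \<delta> (\<delta> i)) = (\<Sum>m\<in>Bs. tens L L (cf i m) (cf m k))"
  proof -
    have 1: "tmap L A L ?LA id \<delta> (\<delta> i) = (\<Sum>m\<in>Bs. tens L ?LA (cf i m) (\<delta> m))"
      unfolding coaction_expand[OF i]
      by (subst linear_map_sum[OF linear_map_tmap[OF LA lin(3,2)]])
        (auto simp: lspace_tensor tens_in i tmap_tens[OF LA lin(3,2)] intro!: sum.cong)
    have 2: "K (\<Sum>m\<in>Bs. tens L ?LA (cf i m) (\<delta> m)) = (\<Sum>m\<in>Bs. tens L L (cf i m) (cf m k))"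
      by (subst linear_map_sum[OF K lspace_tensor])
        (auto simp: K_tens tens_in i coaction_in cf_def[of _ k] intro!: sum.cong)
    show ?thesis unfolding 1 2 ..
  qed
  moreover have "K (tassoc L L A (tmap L A ?LL A (comul L) id (\<delta> i))) = comul L (cf i k)"
  proof -
    have a: "K (tassoc L L A (tens ?LL A s x)) = fun_scl (crd k x) s"
      if "s \<in> tensor_carrier L L" "x \<in> carrier A" for s x
      by (rule linear_map_eqI[where f = "\<lambda>s. K (tassoc L L A (tens ?LL A s x))" and U = ?LL and U' = ?LL,
            OF L.lspace_axioms L.lspace_axioms linear_map_comp[OF linear_map_comp[OF linear_map_tens_left[OF that(2)]
                linear_map_tassoc] K] _ that(1)])
        (use that k in \<open>auto simp: LA linear_map_def tensor_scl_in fs.scale_right_distrib tassoc_tens K_tens tens_in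
           slice_tens tens_scl_right mult.commute\<close>)
    have 1: "tmap L A ?LL A (comul L) id (\<delta> i) = (\<Sum>m\<in>Bs. tens ?LL A (comul L (cf i m)) m)"
      unfolding coaction_expand[OF i]
      by (subst linear_map_sum[OF linear_map_tmap[OF LA lin(1,4)]])
        (auto simp: lspace_tensor tens_in i tmap_tens[OF LA lin(1,4)] intro!: sum.cong)
    have 2: "tassoc L L A (\<Sum>m\<in>Bs. tens ?LL A (comul L (cf i m)) m) = (\<Sum>m\<in>Bs. tassoc L L A (tens ?LL A (comul L (cf i m)) m))"
      by (subst linear_map_sum[OF linear_map_tassoc[OF LA(1,1,2)] lspace_tensor])
        (auto simp: tens_in i comul_in)
    have "K (\<Sum>m\<in>Bs. tassoc L L A (tens ?LL A (comul L (cf i m)) m)) = (\<Sum>m\<in>Bs. K (tassoc L L A (tens ?LL A (comul L (cf i m)) m)))"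
      by (subst linear_map_sum[OF K lspace_tensor])
        (auto simp: tens_in i comul_in intro!: linear_mapD(1)[OF linear_map_tassoc[OF LA(1,1,2)], simplified])
    also have "\<dots> = (\<Sum>m\<in>Bs. if k = m then comul L (cf i m) else 0)"
      by (rule sum.cong) (auto simp: a comul_in i k crd_basis)
    also have "\<dots> = comul L (cf i k)" using k finite_Bs by simp
    finally show ?thesis unfolding 1 2 .
  qed
  ultimately show ?thesis
    using coaction_assoc[of i] i by simp
qed

lemma counit_cf:
  assumes i: "i \<in> Bs" and k: "k \<in> Bs"
  shows "counit L (cf i k) = (if i = k then 1 else 0)"
proof -
  have "i = leg (counit L) (\<delta> i)"
    using i by (simp add: leg_counit)
  also have "\<dots> = (\<Sum>j\<in>Bs. scl A (counit L (cf i j)) j)"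
    unfolding coaction_expand[OF i]
    by (subst linear_map_sum[OF linear_map_leg[OF counit_linear] lspace_tensor])
      (auto simp: tens_in leg_tens[OF counit_linear] i)
  finally have "crd k i = crd k (\<Sum>j\<in>Bs. scl A (counit L (cf i j)) j)" by simp
  also have "\<dots> = (\<Sum>j\<in>Bs. counit L (cf i j) * crd k j)"
    using k by (subst linear_map_sum[OF crd_linear A.lspace_axioms]) (auto simp: crd_scl A.scl_in)
  also have "\<dots> = (\<Sum>j\<in>Bs. if k = j then counit L (cf i j) else 0)"
    using k by (intro sum.cong) (auto simp: crd_basis)
  also have "\<dots> = counit L (cf i k)" using k finite_Bs by simp
  finally show ?thesis using i k by (simp add: crd_basis eq_commute)
qed

lemma tlift_comul_cf:
  assumes "bilinear_on L L s b" "i \<in> Bs" "k \<in> Bs"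
  shows "tlift L L b (comul L (cf i k)) = (\<Sum>m\<in>Bs. b (cf i m) (cf m k))"
  unfolding comul_cf[OF assms(2,3)]
  by (subst tlift_sum[OF L.lspace_axioms L.lspace_axioms assms(1)])
    (auto simp: tens_in assms(2,3) tlift_tens[OF L.lspace_axioms L.lspace_axioms assms(1)])

lemma antipode_in [simp]: "l \<in> carrier L \<Longrightarrow> antipode L l \<in> carrier L"
  using linear_mapD(1)[OF L.antipode_linear] .

lemma antipode_bilinear:
  "bilinear_on L L (scl L) (\<lambda>x y. antipode L x \<otimes>\<^bsub>L\<^esub> y)"
  "bilinear_on L L (scl L) (\<lambda>x y. x \<otimes>\<^bsub>L\<^esub> antipode L y)"
  "r \<in> carrier L \<Longrightarrow> bilinear_on L L (scl L) (\<lambda>x y. x \<otimes>\<^bsub>L\<^esub> r \<otimes>\<^bsub>L\<^esub> antipode L y)"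
  "r \<in> carrier L \<Longrightarrow> bilinear_on L L (scl L) (\<lambda>x y. antipode L x \<otimes>\<^bsub>L\<^esub> r \<otimes>\<^bsub>L\<^esub> y)"
  by (rule bilinear_onI; auto simp: L.ambient linear_mapD[OF L.antipode_linear] L.mult_add_left
      L.mult_add_right L.mult_scl_left L.mult_scl_right)+

text \<open>The antipode relations say that the antipodes of the coefficients form the two-sided
  inverse of the coefficient matrix.\<close>

lemma antipode_cf:
  assumes "i \<in> Bs" "k \<in> Bs"
  shows "(\<Sum>m\<in>Bs. antipode L (cf i m) \<otimes>\<^bsub>L\<^esub> cf m k) = (if i = k then \<one>\<^bsub>L\<^esub> else 0)"
    "(\<Sum>m\<in>Bs. cf i m \<otimes>\<^bsub>L\<^esub> antipode L (cf m k)) = (if i = k then \<one>\<^bsub>L\<^esub> else 0)"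
  using L.antipode_left[of "cf i k"] L.antipode_right[of "cf i k"] assms
  by (auto simp: tlift_comul_cf[OF antipode_bilinear(1)] tlift_comul_cf[OF antipode_bilinear(2)] counit_cf)

lemma left_adjoint_cf: "\<lbrakk>r \<in> carrier L; i \<in> Bs; k \<in> Bs\<rbrakk> \<Longrightarrow>
    left_adjoint L (cf i k) r = (\<Sum>m\<in>Bs. cf i m \<otimes>\<^bsub>L\<^esub> r \<otimes>\<^bsub>L\<^esub> antipode L (cf m k))"
  and right_adjoint_cf: "\<lbrakk>r \<in> carrier L; i \<in> Bs; k \<in> Bs\<rbrakk> \<Longrightarrow>
    right_adjoint L (cf i k) r = (\<Sum>m\<in>Bs. antipode L (cf i m) \<otimes>\<^bsub>L\<^esub> r \<otimes>\<^bsub>L\<^esub> cf m k)"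
  unfolding left_adjoint_def right_adjoint_def
  by (auto simp: tlift_comul_cf[OF antipode_bilinear(3)] tlift_comul_cf[OF antipode_bilinear(4)])

lemma linear_map_left_adjoint:
  "r \<in> carrier L \<Longrightarrow> linear_map L L (\<lambda>h. left_adjoint L h r)"
  unfolding left_adjoint_def
  by (rule linear_map_comp[OF comul_linear linear_map_tlift[OF L.lspace_axioms L.lspace_axioms antipode_bilinear(3)]])
    (auto simp: L.lspace_axioms)

lemma tensor_basis_expand:
  assumes "t \<in> AA"
  obtains w where "t = (\<Sum>j\<in>Bs. \<Sum>k\<in>Bs. fun_scl (w j k) (tens A A j k))"
proof -
  have "\<exists>w. t = (\<Sum>j\<in>Bs. \<Sum>k\<in>Bs. fun_scl (w j k) (tens A A j k))"
    using A.lspace_axioms A.lspace_axioms assms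
  proof (induction rule: tensor_induct)
    case (tens x y)
    have "tens A A x y = tens A A (\<Sum>j\<in>Bs. scl A (crd j x) j) (\<Sum>k\<in>Bs. scl A (crd k y) k)"
      using expand tens by metis
    also have "\<dots> = (\<Sum>j\<in>Bs. \<Sum>k\<in>Bs. fun_scl (crd j x * crd k y) (tens A A j k))"
      by (simp only: tens_sum_left)
        (simp add: tens_sum_right tens_scl_left tens_scl_right fs.scale_sum_right mult.commute)
    finally show ?case by (intro exI[of _ "\<lambda>j k. crd j x * crd k y"])
  next
    case (add t u)
    then obtain w w' where "t = (\<Sum>j\<in>Bs. \<Sum>k\<in>Bs. fun_scl (w j k) (tens A A j k))"
      "u = (\<Sum>j\<in>Bs. \<Sum>k\<in>Bs. fun_scl (w' j k) (tens A A j k))" by blast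
    then have "t + u = (\<Sum>j\<in>Bs. \<Sum>k\<in>Bs. fun_scl (w j k + w' j k) (tens A A j k))"
      by (simp add: fs.scale_left_distrib sum.distrib)
    then show ?case by (rule exI[where x = "\<lambda>j k. w j k + w' j k"])
  qed
  then show ?thesis using that by blast
qed

lemma canon_basis:
  assumes "j \<in> Bs" "y \<in> carrier A"
  shows "canon (tens A A j y) = (\<Sum>m\<in>Bs. tens L A (cf j m) (m \<otimes>\<^bsub>A\<^esub> y))"
proof -
  have "canon (tens A A j y) = (\<Sum>m\<in>Bs. tens L A (cf j m) m) \<otimes>\<^bsub>tensor L A\<^esub> tens L A \<one>\<^bsub>L\<^esub> y"
    using assms by (simp add: canon_tens coaction_expand)
  also have "\<dots> = (\<Sum>m\<in>Bs. tens L A (cf j m) (m \<otimes>\<^bsub>A\<^esub> y))"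
    using assms by (subst LA.T.mult_sum_left) (auto simp: tens_in LA.tensor_mult_tens intro!: sum.cong)
  finally show ?thesis .
qed

text \<open>By surjectivity of the canonical map, \<open>l \<otimes> 1\<close> is a combination of
  images of basis tensors, and the slices of those are combinations of coefficients. Linear
  statements about \<open>L\<close> hence need only be checked on the \<open>cf i j\<close>.\<close>

lemma span_cf:
  assumes "l \<in> carrier L"
  shows "l \<in> module.span (scl L) {cf i j | i j. i \<in> Bs \<and> j \<in> Bs}" (is "l \<in> ?S")
proof (rule tens_one_mem[OF assms L.vs.subspace_span])
  fix b assume b: "b \<in> Bs"
  have "tens L A l \<one>\<^bsub>A\<^esub> \<in> LA" using assms by (simp add: tens_in)
  then obtain t where t: "t \<in> AA" "canon t = tens L A l \<one>\<^bsub>A\<^esub>" by (rule canon_surj)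
  obtain w where w: "t = (\<Sum>j\<in>Bs. \<Sum>k\<in>Bs. fun_scl (w j k) (tens A A j k))"
    using t(1) by (rule tensor_basis_expand)
  let ?f = "\<lambda>t. slice b (canon t)"
  have f: "linear_map (tensor A A) L ?f"
    by (rule linear_map_comp[OF linear_map_canon linear_map_slice[OF b]])
  have "?f (tens A A j k) \<in> ?S" if "j \<in> Bs" "k \<in> Bs" for j k
  proof -
    have "?f (tens A A j k) = (\<Sum>m\<in>Bs. scl L (crd b (m \<otimes>\<^bsub>A\<^esub> k)) (cf j m))"
      using that b by (subst canon_basis)
        (auto simp: linear_map_sum[OF linear_map_slice[OF b] lspace_tensor] tens_in slice_tens intro!: sum.cong)
    also have "\<dots> \<in> ?S"
      using that by (intro L.vs.span_sum L.vs.span_scale L.vs.span_base) auto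
    finally show ?thesis .
  qed
  moreover have "?f t = (\<Sum>j\<in>Bs. \<Sum>k\<in>Bs. scl L (w j k) (?f (tens A A j k)))"
    unfolding w
    by (subst linear_map_sum[OF f lspace_tensor]) (auto simp: tensor_sum_in tensor_scl_in tens_in
        linear_map_sum[OF f lspace_tensor] linear_mapD(3)[OF f, simplified] intro!: sum.cong)
  ultimately show "slice b (tens L A l \<one>\<^bsub>A\<^esub>) \<in> ?S"
    unfolding t(2)[symmetric] by (auto intro!: L.vs.span_sum L.vs.span_scale)
qed

lemma linear_map_cf_in:
  assumes f: "linear_map L V f" and V: "lspace V" and K: "module.subspace (scl V) K"
    and cf: "\<And>i j. \<lbrakk>i \<in> Bs; j \<in> Bs\<rbrakk> \<Longrightarrow> f (cf i j) \<in> K" and l: "l \<in> carrier L"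
  shows "f l \<in> K"
proof -
  interpret V: lspace V by fact
  have "l \<in> carrier L \<and> f l \<in> K"
    using span_cf[OF l]
  proof (induction rule: L.vs.span_induct_alt)
    case base
    then show ?case
      using linear_map_zero[OF f L.lspace_axioms] V.vs.subspace_0[OF K] L.zero_in by simp
  next
    case (step c x y)
    then have "x \<in> carrier L" "f x \<in> K" using cf by auto
    with step show ?case
      using linear_mapD[OF f] V.vs.subspace_add[OF K] V.vs.subspace_scale[OF K]
      by (auto simp: L.add_in L.scl_in)
  qed
  then show ?thesis ..
qed

lemma linear_map_cf_eq:
  assumes "linear_map L V f" "linear_map L V g" "lspace V"
    "\<And>i j. \<lbrakk>i \<in> Bs; j \<in> Bs\<rbrakk> \<Longrightarrow> f (cf i j) = g (cf i j)" "l \<in> carrier L"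
  shows "f l = g l"
proof -
  interpret V: lspace V by fact
  have "linear_map L V (\<lambda>l. f l - g l)"
    using assms(1,2) V.vs.subspace_diff[OF V.lspace_subspace]
    by (auto simp: linear_map_def V.vs.scale_right_diff_distrib Pi_iff)
  from linear_map_cf_in[OF this assms(3) V.vs.subspace_single_0 _ assms(5)] assms(4) show ?thesis by simp
qed

end

section \<open>Group actions and the Hopf algebra as invariants\<close>

context left_comodule_algebra
begin

definition flip :: "('k, 'a, 'a) tensor \<Rightarrow> ('k, 'a, 'a) tensor" where
  "flip = tlift A A (\<lambda>x y. tens A A y x)"

lemma flip_bilinear: "bilinear_on A A fun_scl (\<lambda>x y. tens A A y x)"
  by (rule bilinear_onI)
    (auto simp: vector_space_fun_scl tens_add_left tens_add_right tens_scl_left tens_scl_right)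

lemma linear_map_flip: "linear_map (tensor A A) (tensor A A) flip"
  unfolding flip_def
  by (rule linear_map_tlift) (auto simp: A.lspace_axioms lspace_tensor flip_bilinear tens_in)

lemma flip_tens: "\<lbrakk>x \<in> carrier A; y \<in> carrier A\<rbrakk> \<Longrightarrow> flip (tens A A x y) = tens A A y x"
  unfolding flip_def by (rule tlift_tens[OF A.lspace_axioms A.lspace_axioms flip_bilinear])

lemma flip_in: "t \<in> AA \<Longrightarrow> flip t \<in> AA"
  using linear_mapD(1)[OF linear_map_flip] by simp

lemma flip_flip:
  assumes "t \<in> AA"
  shows "flip (flip t) = t"
  by (rule AA_eqI[where g = "\<lambda>t. t" and U' = "tensor A A", OF
        linear_map_comp[OF linear_map_flip linear_map_flip] _ assms])
    (auto simp: flip_tens linear_map_def)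

lemma flip_mult:
  assumes t: "t \<in> AA" and u: "u \<in> AA"
  shows "flip (t \<star> u) = flip u \<star> flip t"
proof (rule AA_eqI[where f = "\<lambda>t. flip (t \<star> u)", OF
      linear_map_comp[OF linear_map_E_right[OF u] linear_map_flip]
      linear_map_comp[OF linear_map_flip linear_map_E_left[OF flip_in[OF u]]] t])
  fix x y assume xy: "x \<in> carrier A" "y \<in> carrier A"
  then have "tens A A x y \<in> AA" "flip (tens A A x y) \<in> AA"
    by (simp_all add: tens_in flip_in)
  from AA_eqI[where f = "\<lambda>u. flip (tens A A x y \<star> u)", OF
      linear_map_comp[OF linear_map_E_left[OF this(1)] linear_map_flip]
      linear_map_comp[OF linear_map_flip linear_map_E_right[OF this(2)]] u]
  show "flip (tens A A x y \<star> u) = flip u \<star> flip (tens A A x y)"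
    using xy by (simp add: E_mult_tens flip_tens)
qed

text \<open>Multiplying \<open>x \<otimes> y\<close> by \<open>u\<close> places the product of the
  factors of \<open>u\<close> between \<open>x\<close> and \<open>y\<close>.\<close>

lemma multiply_mult_unit:
  assumes t: "t \<in> AA" and u: "u \<in> AA" and one: "multiply u = \<one>\<^bsub>A\<^esub>"
  shows "multiply (t \<star> u) = multiply t"
proof (rule AA_eqI[where f = "\<lambda>t. multiply (t \<star> u)", OF
      linear_map_comp[OF linear_map_E_right[OF u] linear_map_multiply] linear_map_multiply t])
  fix x y assume xy: "x \<in> carrier A" "y \<in> carrier A"
  then have t: "tens A A x y \<in> AA" by (simp add: tens_in)
  have "multiply (tens A A x y \<star> u) = x \<otimes>\<^bsub>A\<^esub> multiply u \<otimes>\<^bsub>A\<^esub> y"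
    by (rule AA_eqI[where f = "\<lambda>u. multiply (tens A A x y \<star> u)", OF
      linear_map_comp[OF linear_map_E_left[OF t] linear_map_multiply]
      linear_map_comp[OF linear_map_comp[OF linear_map_multiply A.linear_mult_left] A.linear_mult_right] u])
      (use xy in \<open>auto simp: E_mult_tens multiply_tens A.m_assoc\<close>)
  then show "multiply (tens A A x y \<star> u) = multiply (tens A A x y)"
    using xy by (simp add: one multiply_tens)
qed

lemma tmap_E_mult:
  assumes f: "linear_map A A f" "\<And>x y. \<lbrakk>x \<in> carrier A; y \<in> carrier A\<rbrakk> \<Longrightarrow> f (x \<otimes>\<^bsub>A\<^esub> y) = f x \<otimes>\<^bsub>A\<^esub> f y"
    and g: "linear_map A A g" "\<And>x y. \<lbrakk>x \<in> carrier A; y \<in> carrier A\<rbrakk> \<Longrightarrow> g (x \<otimes>\<^bsub>A\<^esub> y) = g x \<otimes>\<^bsub>A\<^esub> g y"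
    and t: "t \<in> AA" and u: "u \<in> AA"
  shows "tmap A A A A f g (t \<star> u) = tmap A A A A f g t \<star> tmap A A A A f g u"
proof -
  let ?T = "tmap A A A A f g"
  note T = linear_map_tmap[OF A.lspace_axioms A.lspace_axioms f(1) g(1)]
  note Tt = tmap_tens[OF A.lspace_axioms A.lspace_axioms f(1) g(1)]
  have Tin: "?T t \<in> AA" if "t \<in> AA" for t
    using linear_mapD(1)[OF T] that by simp
  show ?thesis
  proof (rule AA_eqI[where f = "\<lambda>t. ?T (t \<star> u)", OF
        linear_map_comp[OF linear_map_E_right[OF u] T]
        linear_map_comp[OF T linear_map_E_right[OF Tin[OF u]]] t])
    fix x y assume xy: "x \<in> carrier A" "y \<in> carrier A"
    then have t: "tens A A x y \<in> AA" by (simp add: tens_in)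
    from AA_eqI[where f = "\<lambda>u. ?T (tens A A x y \<star> u)", OF
        linear_map_comp[OF linear_map_E_left[OF t] T]
        linear_map_comp[OF T linear_map_E_left[OF Tin[OF t]]] u]
    show "?T (tens A A x y \<star> u) = ?T (tens A A x y) \<star> ?T u"
      using xy f g linear_mapD(1)[OF f(1)] linear_mapD(1)[OF g(1)] by (simp add: E_mult_tens Tt)
  qed
qed

end

text \<open>What is kept of the right Galois structure over the function algebra: an action of
  \<open>G\<close> by algebra automorphisms that commutes with the left coaction (the bicomodule
  identity) and has only scalar invariants (triviality of the coinvariants).\<close>

locale galois_action = finite_left_galois L A \<delta> Bs crd + G: group G
  for L :: "('k::field_char_0, 'v::ab_group_add, 'x) hopf_scheme"
    and A :: "('k, 'a::ab_group_add, 'y) kalg_scheme"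
    and \<delta> :: "'a \<Rightarrow> ('k, 'v, 'a) tensor"
    and Bs :: "'a set" and crd :: "'a \<Rightarrow> 'a \<Rightarrow> 'k"
    and G :: "('g, 'z) monoid_scheme" +
  fixes act :: "'g \<Rightarrow> 'a \<Rightarrow> 'a"
  assumes finite_G: "finite (carrier G)"
    and act_linear: "g \<in> carrier G \<Longrightarrow> linear_map A A (act g)"
    and act_mult: "\<lbrakk>g \<in> carrier G; x \<in> carrier A; y \<in> carrier A\<rbrakk> \<Longrightarrow>
      act g (x \<otimes>\<^bsub>A\<^esub> y) = act g x \<otimes>\<^bsub>A\<^esub> act g y"
    and act_one: "g \<in> carrier G \<Longrightarrow> act g \<one>\<^bsub>A\<^esub> = \<one>\<^bsub>A\<^esub>"
    and act_act: "\<lbrakk>g \<in> carrier G; h \<in> carrier G; x \<in> carrier A\<rbrakk> \<Longrightarrow> act g (act h x) = act (g \<otimes>\<^bsub>G\<^esub> h) x"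
    and act_coaction: "\<lbrakk>g \<in> carrier G; x \<in> carrier A\<rbrakk> \<Longrightarrow> \<delta> (act g x) = tmap L A L A id (act g) (\<delta> x)"
    and act_invariant: "\<lbrakk>x \<in> carrier A; \<And>g. g \<in> carrier G \<Longrightarrow> act g x = x\<rbrakk> \<Longrightarrow> x \<in> range (\<lambda>c. scl A c \<one>\<^bsub>A\<^esub>)"
begin

abbreviation act2 :: "'g \<Rightarrow> 'g \<Rightarrow> ('k, 'a, 'a) tensor \<Rightarrow> ('k, 'a, 'a) tensor" where
  "act2 g h \<equiv> tmap A A A A (act g) (act h)"

definition inv_tensor :: "('k, 'a, 'a) tensor \<Rightarrow> bool" where
  "inv_tensor t \<longleftrightarrow> t \<in> AA \<and> (\<forall>g\<in>carrier G. act2 g g t = t)"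

lemma act_in [simp]: "\<lbrakk>g \<in> carrier G; x \<in> carrier A\<rbrakk> \<Longrightarrow> act g x \<in> carrier A"
  using linear_mapD(1)[OF act_linear] .

lemma linear_map_act2: "\<lbrakk>g \<in> carrier G; h \<in> carrier G\<rbrakk> \<Longrightarrow> linear_map (tensor A A) (tensor A A) (act2 g h)"
  by (intro linear_map_tmap act_linear A.lspace_axioms)

lemma act2_tens: "\<lbrakk>g \<in> carrier G; h \<in> carrier G; x \<in> carrier A; y \<in> carrier A\<rbrakk> \<Longrightarrow>
    act2 g h (tens A A x y) = tens A A (act g x) (act h y)"
  by (intro tmap_tens act_linear A.lspace_axioms)

lemma act2_in: "\<lbrakk>g \<in> carrier G; h \<in> carrier G; t \<in> AA\<rbrakk> \<Longrightarrow> act2 g h t \<in> AA"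
  using linear_mapD(1)[OF linear_map_act2] by simp

lemma act2_act2:
  assumes "g \<in> carrier G" "h \<in> carrier G" "g' \<in> carrier G" "h' \<in> carrier G" "t \<in> AA"
  shows "act2 g h (act2 g' h' t) = act2 (g \<otimes>\<^bsub>G\<^esub> g') (h \<otimes>\<^bsub>G\<^esub> h') t"
  by (rule AA_eqI[where f = "\<lambda>t. act2 g h (act2 g' h' t)", OF
        linear_map_comp[OF linear_map_act2 linear_map_act2] linear_map_act2 assms(5)])
    (use assms in \<open>auto simp: act2_tens act_act\<close>)

lemma act2_flip:
  assumes "g \<in> carrier G" "t \<in> AA"
  shows "act2 g g (flip t) = flip (act2 g g t)"
  by (rule AA_eqI[where f = "\<lambda>t. act2 g g (flip t)", OF
        linear_map_comp[OF linear_map_flip linear_map_act2] linear_map_comp[OF linear_map_act2 linear_map_flip] assms(2)])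
    (use assms in \<open>auto simp: act2_tens flip_tens\<close>)

lemma inv_tensor_flip: "inv_tensor t \<Longrightarrow> inv_tensor (flip t)"
  by (simp add: inv_tensor_def flip_in act2_flip)

lemma multiply_act2:
  assumes "g \<in> carrier G" "t \<in> AA"
  shows "multiply (act2 g g t) = act g (multiply t)"
  by (rule AA_eqI[where f = "\<lambda>t. multiply (act2 g g t)", OF
        linear_map_comp[OF linear_map_act2 linear_map_multiply] linear_map_comp[OF linear_map_multiply act_linear] assms(2)])
    (use assms in \<open>auto simp: act2_tens multiply_tens act_mult\<close>)

lemma multiply_in: "t \<in> AA \<Longrightarrow> multiply t \<in> carrier A"
  using linear_mapD(1)[OF linear_map_multiply] by simp

lemma multiply_inv_tensor:
  assumes "inv_tensor t"
  obtains c where "multiply t = scl A c \<one>\<^bsub>A\<^esub>"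
  using act_invariant[of "multiply t"] assms multiply_act2[of _ t]
  by (auto simp: inv_tensor_def multiply_in)

lemma sum_act_subgroup:
  assumes "subgroup F G" "h \<in> F" "x \<in> carrier A"
  shows "act h (\<Sum>n\<in>F. act n x) = (\<Sum>n\<in>F. act n x)"
proof -
  have F: "F \<subseteq> carrier G" "h \<in> carrier G" using subgroup.subset[OF assms(1)] assms(2) by auto
  have "act h (\<Sum>n\<in>F. act n x) = (\<Sum>n\<in>F. act (h \<otimes>\<^bsub>G\<^esub> n) x)"
    using F assms(3) by (subst linear_map_sum[OF act_linear A.lspace_axioms]) (auto simp: act_act subset_iff intro!: sum.cong)
  also have "\<dots> = (\<Sum>n\<in>F. act n x)"
  proof (rule sum.reindex_bij_betw)
    show "bij_betw (\<lambda>n. h \<otimes>\<^bsub>G\<^esub> n) F F"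
    proof (rule bij_betwI[where g = "\<lambda>n. inv\<^bsub>G\<^esub> h \<otimes>\<^bsub>G\<^esub> n"])
      show "(\<otimes>\<^bsub>G\<^esub>) h \<in> F \<rightarrow> F" "(\<otimes>\<^bsub>G\<^esub>) (inv\<^bsub>G\<^esub> h) \<in> F \<rightarrow> F"
        using assms(1,2) by (auto intro: subgroup.m_closed subgroup.m_inv_closed)
    qed (use F in \<open>auto simp: G.m_assoc[symmetric] subset_iff\<close>)
  qed
  finally show ?thesis .
qed

definition idact :: "'g \<Rightarrow> ('k, 'v, 'a) tensor \<Rightarrow> ('k, 'v, 'a) tensor" where
  "idact g = tmap L A L A id (act g)"

lemmas act_coaction' = act_coaction[folded idact_def]

lemma linear_map_idact: "g \<in> carrier G \<Longrightarrow> linear_map (tensor L A) (tensor L A) (idact g)"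
  unfolding idact_def by (intro linear_map_tmap act_linear linear_map_id L.lspace_axioms A.lspace_axioms)

lemma idact_tens: "\<lbrakk>g \<in> carrier G; h \<in> carrier L; x \<in> carrier A\<rbrakk> \<Longrightarrow>
    idact g (tens L A h x) = tens L A h (act g x)"
  unfolding idact_def by (subst tmap_tens) (auto intro: act_linear linear_map_id L.lspace_axioms A.lspace_axioms)

lemma idact_mult_right:
  assumes "g \<in> carrier G" "t \<in> LA" "y \<in> carrier A"
  shows "idact g (t \<otimes>\<^bsub>tensor L A\<^esub> tens L A \<one>\<^bsub>L\<^esub> y) = idact g t \<otimes>\<^bsub>tensor L A\<^esub> tens L A \<one>\<^bsub>L\<^esub> (act g y)"
  by (rule LA_eqI[where f = "\<lambda>t. idact g (t \<otimes>\<^bsub>tensor L A\<^esub> tens L A \<one>\<^bsub>L\<^esub> y)", OF linear_map_comp[OF LA.T.linear_mult_right linear_map_idact]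
          linear_map_comp[OF linear_map_idact LA.T.linear_mult_right]])
    (use assms in \<open>auto simp: LA.tensor_mult_tens idact_tens act_mult tens_in\<close>)

text \<open>Equivariance of \<open>\<delta>\<close> leaves the leg in \<open>L\<close> alone, so the
  diagonal action becomes the action on the right leg.\<close>

lemma canon_act2:
  assumes "g \<in> carrier G" "t \<in> AA"
  shows "canon (act2 g g t) = idact g (canon t)"
  by (rule AA_eqI[where f = "\<lambda>t. canon (act2 g g t)", OF linear_map_comp[OF linear_map_act2 linear_map_canon]
          linear_map_comp[OF linear_map_canon linear_map_idact] assms(2)])
    (use assms in \<open>auto simp: act2_tens canon_tens act_coaction' idact_mult_right coaction_in\<close>)

text \<open>The identification of \<open>L\<close> with the invariant tensors, kept as a relation so
  that no inverse of the canonical map has to be chosen; the following lemmas show that it is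
  bijective and multiplicative.\<close>

definition corr :: "('k, 'a, 'a) tensor \<Rightarrow> 'v \<Rightarrow> bool" where
  "corr t l \<longleftrightarrow> t \<in> AA \<and> l \<in> carrier L \<and> canon t = tens L A l \<one>\<^bsub>A\<^esub>"

lemma corr_mult: "\<lbrakk>corr t l; corr t' l'\<rbrakk> \<Longrightarrow> corr (t \<star> t') (l \<otimes>\<^bsub>L\<^esub> l')"
  unfolding corr_def
  by (simp add: E_mult_in canon_mult[of t t' l'] LA.tensor_mult_tens)

lemma corr_scl: "corr t l \<Longrightarrow> corr (fun_scl c t) (scl L c l)"
  unfolding corr_def
  using linear_mapD(3)[OF linear_map_canon] by (simp add: tensor_scl_in L.scl_in tens_scl_left)

lemma corr_unique_right: "\<lbrakk>corr t l; corr t l'\<rbrakk> \<Longrightarrow> l = l'"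
  unfolding corr_def by (auto intro: tens_one_inj)

lemma corr_unique_left: "\<lbrakk>corr t l; corr t' l\<rbrakk> \<Longrightarrow> t = t'"
  unfolding corr_def by (auto intro: canon_inj)

lemma corr_exists:
  assumes "l \<in> carrier L"
  obtains t where "corr t l"
proof -
  have "tens L A l \<one>\<^bsub>A\<^esub> \<in> LA" using assms by (simp add: tens_in)
  then obtain t where "t \<in> AA" "canon t = tens L A l \<one>\<^bsub>A\<^esub>" by (rule canon_surj)
  then show ?thesis using assms that by (simp add: corr_def)
qed

lemma corr_counit: "corr t l \<Longrightarrow> multiply t = scl A (counit L l) \<one>\<^bsub>A\<^esub>"
  using counit_canon[of t] leg_tens[OF counit_linear, of l "\<one>\<^bsub>A\<^esub>"] by (auto simp: corr_def)

text \<open>\<open>l \<otimes> 1\<close> is fixed by the action on the right leg, and the canonical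
  map is injective.\<close>

lemma corr_inv: 
  assumes "corr t l"
  shows "inv_tensor t"
  unfolding inv_tensor_def
proof (intro conjI ballI)
  fix g assume g: "g \<in> carrier G"
  have "corr (act2 g g t) l"
    using assms g by (simp add: corr_def act2_in canon_act2 idact_tens act_one)
  then show "act2 g g t = t" using assms by (rule corr_unique_left)
qed (use assms in \<open>simp add: corr_def\<close>)

text \<open>For invariant \<open>t\<close> the tensor \<open>canon t\<close> is fixed by the action
  on the right leg, so it equals its average over \<open>G\<close>, and averaging turns the right
  leg into a scalar. Dividing by the order of \<open>G\<close> uses characteristic zero.\<close>

lemma inv_corr:
  assumes "inv_tensor t"
  obtains l where "corr t l"
proof -
  have t: "t \<in> AA" "\<And>g. g \<in> carrier G \<Longrightarrow> act2 g g t = t"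
    using assms by (auto simp: inv_tensor_def)
  let ?N = "of_nat (card (carrier G)) :: 'k"
  have N: "?N \<noteq> 0" using finite_G G.one_closed by auto
  have sum: "\<exists>l\<in>carrier L. (\<Sum>g\<in>carrier G. idact g u) = tens L A l \<one>\<^bsub>A\<^esub>" if "u \<in> LA" for u
    using L.lspace_axioms A.lspace_axioms that
  proof (induction rule: tensor_induct)
    case (tens h x)
    have "(\<Sum>g\<in>carrier G. act g x) \<in> range (\<lambda>c. scl A c \<one>\<^bsub>A\<^esub>)"
      using tens by (intro act_invariant sum_act_subgroup G.subgroup_self A.sum_in) auto
    then obtain c where "(\<Sum>g\<in>carrier G. act g x) = scl A c \<one>\<^bsub>A\<^esub>" by blast
    then have "(\<Sum>g\<in>carrier G. idact g (tens L A h x)) = tens L A (scl L c h) \<one>\<^bsub>A\<^esub>"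
      using tens by (simp add: idact_tens tens_sum_right[symmetric] tens_scl_left tens_scl_right)
    then show ?case using tens L.scl_in by blast
  next
    case (add t u)
    then obtain l l' where "l \<in> carrier L" "(\<Sum>g\<in>carrier G. idact g t) = tens L A l \<one>\<^bsub>A\<^esub>"
      "l' \<in> carrier L" "(\<Sum>g\<in>carrier G. idact g u) = tens L A l' \<one>\<^bsub>A\<^esub>" by blast
    then show ?case using add
      by (intro bexI[of _ "l + l'"])
        (auto simp: linear_mapD(2)[OF linear_map_idact] sum.distrib tens_add_left L.add_in)
  qed
  then obtain l where l: "l \<in> carrier L" "(\<Sum>g\<in>carrier G. idact g (canon t)) = tens L A l \<one>\<^bsub>A\<^esub>"
    using canon_in[OF t(1)] by blast
  have "(\<Sum>g\<in>carrier G. idact g (canon t)) = (\<Sum>g\<in>carrier G. canon t)"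
    using t by (intro sum.cong) (simp_all flip: canon_act2)
  also have "\<dots> = fun_scl ?N (canon t)"
    by (rule fs.sum_constant_scale)
  finally have "canon t = fun_scl (inverse ?N) (tens L A l \<one>\<^bsub>A\<^esub>)"
    using l(2) N by (metis fs.scale_scale fs.scale_one left_inverse)
  then have "corr t (scl L (inverse ?N) l)"
    using t(1) l(1) by (simp add: corr_def L.scl_in tens_scl_left)
  then show ?thesis by (rule that)
qed

end

section \<open>The integral of the Hopf subalgebra\<close>

context galois_action
begin

definition fixed :: "'g set \<Rightarrow> 'a set" where
  "fixed F = {x \<in> carrier A. \<forall>n\<in>F. act n x = x}"

lemma fixed_subset: "fixed F \<subseteq> carrier A"
  by (auto simp: fixed_def)

lemma subspace_fixed: "F \<subseteq> carrier G \<Longrightarrow> module.subspace (scl A) (fixed F)"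
  unfolding fixed_def
  by (rule A.vs.subspaceI)
    (auto simp: A.zero_in A.add_in A.scl_in subset_iff linear_mapD[OF act_linear]
      intro: linear_map_zero[OF act_linear A.lspace_axioms])

lemma one_fixed: "F \<subseteq> carrier G \<Longrightarrow> \<one>\<^bsub>A\<^esub> \<in> fixed F"
  by (auto simp: fixed_def act_one)

end

text \<open>The element \<open>e\<close> corresponds to an idempotent integral of the Hopf subalgebra \<open>M\<close>.\<close>

locale galois_integral = galois_action L A \<delta> Bs crd G act
  for L :: "('k::field_char_0, 'v::ab_group_add, 'x) hopf_scheme"
    and A :: "('k, 'a::ab_group_add, 'y) kalg_scheme"
    and \<delta> :: "'a \<Rightarrow> ('k, 'v, 'a) tensor"
    and Bs :: "'a set" and crd :: "'a \<Rightarrow> 'a \<Rightarrow> 'k"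
    and G :: "('g, 'z) monoid_scheme" and act :: "'g \<Rightarrow> 'a \<Rightarrow> 'a" +
  fixes F :: "'g set" and M :: "'v set" and e :: "('k, 'a, 'a) tensor"
  assumes F_subgroup: "subgroup F G"
    and M: "hopf_subalgebra L M"
    and sub: "left_galois_object (L\<lparr>carrier := M\<rparr>) (A\<lparr>carrier := fixed F\<rparr>) \<delta>"
    and e_in: "e \<in> tensor_carrier (A\<lparr>carrier := fixed F\<rparr>) (A\<lparr>carrier := fixed F\<rparr>)"
    and e_casimir: "x \<in> fixed F \<Longrightarrow> tens A A x \<one>\<^bsub>A\<^esub> \<star> e = tens A A \<one>\<^bsub>A\<^esub> x \<star> e"
    and e_one: "multiply e = \<one>\<^bsub>A\<^esub>"
    and e_flip: "flip e = e"
    and e_inv: "inv_tensor e"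
begin

abbreviation "A' \<equiv> A\<lparr>carrier := fixed F\<rparr>"
abbreviation "L' \<equiv> L\<lparr>carrier := M\<rparr>"

lemma F_carrier: "F \<subseteq> carrier G"
  using F_subgroup by (rule subgroup.subset)

lemma F_in [simp]: "n \<in> F \<Longrightarrow> n \<in> carrier G"
  using F_carrier by blast

lemma M_subspace: "module.subspace (scl L) M" and M_submonoid: "submonoid M L"
  and M_comul: "r \<in> M \<Longrightarrow> comul L r \<in> tensor_carrier L' L'"
  using M by (auto simp: hopf_subalgebra_def)

lemma M_subset: "M \<subseteq> carrier L"
  using M_submonoid by (rule submonoid.subset)

lemma M_in [simp]: "r \<in> M \<Longrightarrow> r \<in> carrier L"
  using M_subset by blast

lemma lspace_sub: "lspace A'" "lspace L'"
  using A.lspace_restrict[OF subspace_fixed[OF F_carrier]] L.lspace_restrict[OF M_subspace] by simp_all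

lemma tensor_sub: "t \<in> tensor_carrier A' A' \<Longrightarrow> t \<in> AA"
  "u \<in> tensor_carrier L' A' \<Longrightarrow> u \<in> LA"
  "v \<in> tensor_carrier L' L' \<Longrightarrow> v \<in> tensor_carrier L L"
  using tensor_carrier_mono[of A' A A' A] tensor_carrier_mono[of L' L A' A] tensor_carrier_mono[of L' L L' L]
    fixed_subset M_subset by auto

text \<open>The canonical map of the sub-object is the restriction of \<open>canon\<close>, because
  lifts over the small carriers evaluate to the same sums.\<close>

lemma canon_sub: "bij_betw canon (tensor_carrier A' A') (tensor_carrier L' A')"
proof -
  interpret sub: left_galois_object L' A' \<delta> by (rule sub)
  have "tlift A' A' (\<lambda>x y. tlift L' A' (\<lambda>x1 x0. tens L' A' x1 (x0 \<otimes>\<^bsub>A'\<^esub> y)) (\<delta> x)) t = canon t"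
    if t: "t \<in> tensor_carrier A' A'" for t
  proof -
    have "tlift L' A' (\<lambda>x1 x0. tens L' A' x1 (x0 \<otimes>\<^bsub>A'\<^esub> y)) (\<delta> x) = \<delta> x \<otimes>\<^bsub>tensor L A\<^esub> tens L A \<one>\<^bsub>L\<^esub> y"
      if "x \<in> carrier A'" "y \<in> carrier A'" for x y
    proof -
      have xy: "x \<in> carrier A" "y \<in> carrier A" using that fixed_subset by auto
      have "tlift L' A' (\<lambda>x1 x0. tens L A x1 (x0 \<otimes>\<^bsub>A\<^esub> y)) (\<delta> x) = tlift L A (\<lambda>x1 x0. tens L A x1 (x0 \<otimes>\<^bsub>A\<^esub> y)) (\<delta> x)"
        by (rule tlift_restrict[OF L.lspace_axioms A.lspace_axioms mult_right_bilinear[OF xy(2)]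
              M_subspace subspace_fixed[OF F_carrier] M_subset fixed_subset sub.coaction_in[OF that(1)]])
      then show ?thesis using xy by (simp add: tens_carrier_update tlift_mult_right coaction_in)
    qed
    then have "tlift A' A' (\<lambda>x y. tlift L' A' (\<lambda>x1 x0. tens L' A' x1 (x0 \<otimes>\<^bsub>A'\<^esub> y)) (\<delta> x)) t
      = tlift A' A' (\<lambda>x y. \<delta> x \<otimes>\<^bsub>tensor L A\<^esub> tens L A \<one>\<^bsub>L\<^esub> y) t"
      by (rule tlift_cong)
    also have "\<dots> = canon t"
      unfolding canon_def
      by (rule tlift_restrict[OF A.lspace_axioms A.lspace_axioms canon_bilinear
            subspace_fixed[OF F_carrier] subspace_fixed[OF F_carrier] fixed_subset fixed_subset t])
    finally show ?thesis .
  qed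
  then show ?thesis using sub.canonical_bij by (simp cong: bij_betw_cong)
qed

text \<open>Tensors over \<open>A'\<close> are sent into \<open>M \<otimes> A'\<close>, all of whose
  slices lie in \<open>M\<close>.\<close>

lemma corr_sub:
  assumes "corr t l" "t \<in> tensor_carrier A' A'"
  shows "l \<in> M"
proof -
  have "slice b u \<in> M" if "u \<in> tensor_carrier L' A'" "b \<in> Bs" for b u
    using lspace_sub(2) lspace_sub(1) that(1)
  proof (induction rule: tensor_induct)
    case (tens h x)
    then have "h \<in> M" "h \<in> carrier L" "x \<in> carrier A" using fixed_subset by auto
    then show ?case
      using that(2) L.vs.subspace_scale[OF M_subspace] by (simp add: tens_carrier_update slice_tens)
  next
    case (add t u)
    then show ?case
      using L.vs.subspace_add[OF M_subspace] that(2)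
      by (simp add: linear_mapD(2)[OF linear_map_slice] tensor_sub)
  qed
  moreover have "tens L A l \<one>\<^bsub>A\<^esub> \<in> tensor_carrier L' A'"
    using bij_betwE[OF canon_sub] assms by (auto simp: corr_def)
  ultimately have "\<And>b. b \<in> Bs \<Longrightarrow> slice b (tens L A l \<one>\<^bsub>A\<^esub>) \<in> M"
    by blast
  moreover have "l \<in> carrier L" using assms(1) by (simp add: corr_def)
  ultimately show ?thesis by (rule tens_one_mem[OF _ M_subspace, rotated])
qed

lemma corr_sub_exists:
  assumes "l \<in> M"
  obtains t where "t \<in> tensor_carrier A' A'" "corr t l"
proof -
  have "tens L A l \<one>\<^bsub>A\<^esub> \<in> tensor_carrier L' A'"
    using tens_in[of l L' "\<one>\<^bsub>A\<^esub>" A'] assms one_fixed[OF F_carrier] by (simp add: tens_carrier_update)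
  then obtain t where "t \<in> tensor_carrier A' A'" "canon t = tens L A l \<one>\<^bsub>A\<^esub>"
    using canon_sub by (force simp: bij_betw_def)
  then show ?thesis using that assms by (simp add: corr_def tensor_sub)
qed

lemma e_tensor: "e \<in> AA"
  using e_in by (rule tensor_sub)

definition \<Lambda> :: 'v where
  "\<Lambda> = (SOME l. corr e l)"

lemma corr_\<Lambda>: "corr e \<Lambda>"
  unfolding \<Lambda>_def using inv_corr[OF e_inv] by (metis someI)

lemma \<Lambda>_in_M: "\<Lambda> \<in> M"
  using corr_\<Lambda> e_in by (rule corr_sub)

lemma \<Lambda>_in [simp]: "\<Lambda> \<in> carrier L"
  using \<Lambda>_in_M by simp

lemma counit_\<Lambda>: "counit L \<Lambda> = 1"
proof -
  have "\<one>\<^bsub>A\<^esub> = scl A (counit L \<Lambda>) \<one>\<^bsub>A\<^esub>"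
    using corr_counit[OF corr_\<Lambda>] e_one by simp
  then show ?thesis using nonzero A.vs.scale_right_imp_eq[of "\<one>\<^bsub>A\<^esub>" 1 "counit L \<Lambda>"] by simp
qed

text \<open>The Casimir property carries the left factor of \<open>t\<close> to the other side of
  \<open>e\<close>, where it meets the right factor.\<close>

lemma e_absorb:
  assumes "t \<in> tensor_carrier A' A'"
  shows "t \<star> e = tens A A \<one>\<^bsub>A\<^esub> (multiply t) \<star> e"
  using lspace_sub(1) lspace_sub(1) assms
proof (induction rule: tensor_induct)
  case (tens x y)
  then have xy: "x \<in> carrier A" "y \<in> carrier A" "x \<in> fixed F" using fixed_subset by auto
  have "tens A A x y \<star> e = tens A A \<one>\<^bsub>A\<^esub> y \<star> (tens A A x \<one>\<^bsub>A\<^esub> \<star> e)"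
    using xy e_tensor by (simp add: E_assoc[symmetric] tens_in E_mult_tens)
  also have "\<dots> = tens A A \<one>\<^bsub>A\<^esub> (x \<otimes>\<^bsub>A\<^esub> y) \<star> e"
    using xy e_tensor by (simp add: e_casimir E_assoc[symmetric] tens_in E_mult_tens)
  finally show ?case using xy by (simp add: tens_carrier_update multiply_tens)
next
  case (add t u)
  then show ?case
    using e_tensor
    by (simp add: linear_mapD(2)[OF linear_map_E_right] linear_mapD(2)[OF linear_map_multiply]
        tensor_sub multiply_in tens_in tens_add_right)
qed

lemma flip_sub:
  assumes "t \<in> tensor_carrier A' A'"
  shows "flip t \<in> tensor_carrier A' A'"
  using lspace_sub(1) lspace_sub(1) assms
proof (induction rule: tensor_induct)
  case (tens x y)
  then have "x \<in> carrier A" "y \<in> carrier A" using fixed_subset by auto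
  then show ?case
    using tens_in[OF tens(2) tens(1)] by (simp add: tens_carrier_update flip_tens)
next
  case (add t u)
  then show ?case by (simp add: linear_mapD(2)[OF linear_map_flip] tensor_sub tensor_add_in)
qed

lemma e_absorb_scalar:
  assumes "t \<in> tensor_carrier A' A'" "multiply t = scl A c \<one>\<^bsub>A\<^esub>"
  shows "t \<star> e = fun_scl c e"
  using e_absorb[OF assms(1)] e_tensor AA.T.l_one[of e]
  by (simp add: assms(2) tens_scl_right tens_in linear_mapD(3)[OF linear_map_E_right, simplified])

lemma \<Lambda>_left: 
  assumes "r \<in> M"
  shows "r \<otimes>\<^bsub>L\<^esub> \<Lambda> = scl L (counit L r) \<Lambda>"
proof -
  obtain t where t: "t \<in> tensor_carrier A' A'" "corr t r" using assms by (rule corr_sub_exists)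
  have "t \<star> e = fun_scl (counit L r) e"
    using t by (intro e_absorb_scalar corr_counit)
  then show ?thesis
    using corr_mult[OF t(2) corr_\<Lambda>] corr_scl[OF corr_\<Lambda>] by (auto intro: corr_unique_right)
qed

text \<open>The flip reverses products and fixes \<open>e\<close>, so left absorption of
  \<open>flip t\<close> becomes right absorption of \<open>t\<close>. The scalar that arises is the
  product of the factors of \<open>flip t\<close>; applying the counit identifies it with the counit
  of \<open>r\<close>, since \<open>\<Lambda>\<close> has counit \<open>1\<close>.\<close>

lemma \<Lambda>_right:
  assumes "r \<in> M"
  shows "\<Lambda> \<otimes>\<^bsub>L\<^esub> r = scl L (counit L r) \<Lambda>"
proof -
  obtain t where t: "t \<in> tensor_carrier A' A'" "corr t r" using assms by (rule corr_sub_exists)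
  obtain c where c: "multiply (flip t) = scl A c \<one>\<^bsub>A\<^esub>"
    using inv_tensor_flip[OF corr_inv[OF t(2)]] by (rule multiply_inv_tensor)
  have "flip t \<star> e = fun_scl c e"
    using flip_sub[OF t(1)] c by (rule e_absorb_scalar)
  then have "flip (flip t \<star> e) = fun_scl c e"
    using e_tensor by (simp add: linear_mapD(3)[OF linear_map_flip, simplified] e_flip)
  then have "e \<star> t = fun_scl c e"
    using t e_tensor by (simp add: flip_mult flip_in tensor_sub e_flip flip_flip)
  then have eq: "\<Lambda> \<otimes>\<^bsub>L\<^esub> r = scl L c \<Lambda>"
    using corr_mult[OF corr_\<Lambda> t(2)] corr_scl[OF corr_\<Lambda>] by (auto intro: corr_unique_right)
  from arg_cong[OF this, of "counit L"] have "counit L r = c"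
    using assms by (simp add: counit_mult counit_scl counit_\<Lambda>)
  with eq show ?thesis by simp
qed

section \<open>Absorption by the integral from stability under an adjoint action\<close>

lemma counit_sum: "(\<And>i. i \<in> I \<Longrightarrow> f i \<in> carrier L) \<Longrightarrow> counit L (sum f I) = (\<Sum>i\<in>I. counit L (f i))"
  by (rule linear_map_sum[OF counit_linear L.lspace_axioms])

text \<open>The counit is multiplicative; apply it to the antipode relation between the
  coefficients.\<close>

lemma counit_antipode_cf:
  assumes "i \<in> Bs" "k \<in> Bs"
  shows "counit L (antipode L (cf i k)) = (if i = k then 1 else 0)"
proof -
  have "counit L (\<Sum>m\<in>Bs. antipode L (cf i m) \<otimes>\<^bsub>L\<^esub> cf m k)
    = (\<Sum>m\<in>Bs. if m = k then counit L (antipode L (cf i m)) else 0)"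
    using assms by (subst counit_sum) (auto simp: counit_mult counit_cf intro!: sum.cong)
  also have "\<dots> = counit L (antipode L (cf i k))"
    using assms finite_Bs by simp
  finally show ?thesis
    using antipode_cf(1)[OF assms] assms linear_map_zero[OF counit_linear L.lspace_axioms]
    by (simp add: counit_one split: if_splits)
qed

lemma left_adjoint_in: "\<lbrakk>r \<in> carrier L; h \<in> carrier L\<rbrakk> \<Longrightarrow> left_adjoint L h r \<in> carrier L"
  using linear_mapD(1)[OF linear_map_left_adjoint] .

lemma right_adjoint_cf_in: "\<lbrakk>r \<in> carrier L; i \<in> Bs; k \<in> Bs\<rbrakk> \<Longrightarrow> right_adjoint L (cf i k) r \<in> carrier L"
  by (simp add: right_adjoint_cf L.sum_in)

lemma counit_adjoint_cf:
  assumes "i \<in> Bs" "k \<in> Bs"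
  shows "counit L (left_adjoint L (cf i k) \<Lambda>) = (if i = k then 1 else 0)"
    "counit L (right_adjoint L (cf i k) \<Lambda>) = (if i = k then 1 else 0)"
proof -
  have "counit L (left_adjoint L (cf i k) \<Lambda>) = (\<Sum>m\<in>Bs. if i = m then counit L (antipode L (cf m k)) else 0)"
    using assms by (simp add: left_adjoint_cf)
      (subst counit_sum, auto simp: counit_mult counit_cf counit_\<Lambda> intro!: sum.cong)
  then show "counit L (left_adjoint L (cf i k) \<Lambda>) = (if i = k then 1 else 0)"
    using assms finite_Bs by (simp add: counit_antipode_cf)
  have "counit L (right_adjoint L (cf i k) \<Lambda>) = (\<Sum>m\<in>Bs. if m = k then counit L (antipode L (cf i m)) else 0)"
    using assms by (simp add: right_adjoint_cf)
      (subst counit_sum, auto simp: counit_mult counit_cf counit_\<Lambda> intro!: sum.cong)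
  then show "counit L (right_adjoint L (cf i k) \<Lambda>) = (if i = k then 1 else 0)"
    using assms finite_Bs by (simp add: counit_antipode_cf)
qed

text \<open>The identity \<open>h r = (h\<^sub>1 r S(h\<^sub>2)) h\<^sub>3\<close> and its mirror image.\<close>

lemma left_adjoint_swap:
  assumes "r \<in> carrier L" "i \<in> Bs" "j \<in> Bs"
  shows "cf i j \<otimes>\<^bsub>L\<^esub> r = (\<Sum>k\<in>Bs. left_adjoint L (cf i k) r \<otimes>\<^bsub>L\<^esub> cf k j)"
proof -
  have "(\<Sum>k\<in>Bs. left_adjoint L (cf i k) r \<otimes>\<^bsub>L\<^esub> cf k j)
    = (\<Sum>k\<in>Bs. \<Sum>m\<in>Bs. cf i m \<otimes>\<^bsub>L\<^esub> r \<otimes>\<^bsub>L\<^esub> (antipode L (cf m k) \<otimes>\<^bsub>L\<^esub> cf k j))"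
    using assms by (intro sum.cong) (auto simp: left_adjoint_cf L.mult_sum_left L.m_assoc)
  also have "\<dots> = (\<Sum>m\<in>Bs. cf i m \<otimes>\<^bsub>L\<^esub> r \<otimes>\<^bsub>L\<^esub> (\<Sum>k\<in>Bs. antipode L (cf m k) \<otimes>\<^bsub>L\<^esub> cf k j))"
    using assms by (subst sum.swap) (simp add: L.mult_sum_right cong: sum.cong)
  also have "\<dots> = (\<Sum>m\<in>Bs. if m = j then cf i m \<otimes>\<^bsub>L\<^esub> r else 0)"
    using assms by (intro sum.cong) (auto simp: antipode_cf L.mult_zero_right)
  also have "\<dots> = cf i j \<otimes>\<^bsub>L\<^esub> r"
    using assms finite_Bs by simp
  finally show ?thesis ..
qed

lemma right_adjoint_swap:
  assumes "r \<in> carrier L" "i \<in> Bs" "j \<in> Bs"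
  shows "r \<otimes>\<^bsub>L\<^esub> cf i j = (\<Sum>k\<in>Bs. cf i k \<otimes>\<^bsub>L\<^esub> right_adjoint L (cf k j) r)"
proof -
  have "(\<Sum>k\<in>Bs. cf i k \<otimes>\<^bsub>L\<^esub> right_adjoint L (cf k j) r)
    = (\<Sum>k\<in>Bs. \<Sum>m\<in>Bs. cf i k \<otimes>\<^bsub>L\<^esub> antipode L (cf k m) \<otimes>\<^bsub>L\<^esub> (r \<otimes>\<^bsub>L\<^esub> cf m j))"
    using assms by (intro sum.cong) (auto simp: right_adjoint_cf L.mult_sum_right L.m_assoc)
  also have "\<dots> = (\<Sum>m\<in>Bs. (\<Sum>k\<in>Bs. cf i k \<otimes>\<^bsub>L\<^esub> antipode L (cf k m)) \<otimes>\<^bsub>L\<^esub> (r \<otimes>\<^bsub>L\<^esub> cf m j))"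
    using assms by (subst sum.swap) (simp add: L.mult_sum_left cong: sum.cong)
  also have "\<dots> = (\<Sum>m\<in>Bs. if i = m then r \<otimes>\<^bsub>L\<^esub> cf m j else 0)"
    using assms by (intro sum.cong) (auto simp: antipode_cf L.mult_zero_left)
  also have "\<dots> = r \<otimes>\<^bsub>L\<^esub> cf i j"
    using assms finite_Bs by simp
  finally show ?thesis ..
qed

text \<open>Write \<open>\<Lambda> h \<Lambda>\<close> as
  \<open>\<Lambda> ad(h\<^sub>1)(\<Lambda>) h\<^sub>2\<close>. By stability the middle factor lies
  in \<open>M\<close>, so the \<open>\<Lambda>\<close> on its left absorbs it through its counit,
  which is that of \<open>h\<^sub>1\<close>.\<close>

lemma left_stable_absorb:
  assumes "\<forall>h\<in>carrier L. \<forall>x\<in>M. left_adjoint L h x \<in> M" "l \<in> carrier L"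
  shows "\<Lambda> \<otimes>\<^bsub>L\<^esub> l \<otimes>\<^bsub>L\<^esub> \<Lambda> = \<Lambda> \<otimes>\<^bsub>L\<^esub> l"
proof (rule linear_map_cf_eq[OF linear_map_comp[OF L.linear_mult_left L.linear_mult_right]
      L.linear_mult_left L.lspace_axioms _ assms(2)])
  fix i j assume ij: "i \<in> Bs" "j \<in> Bs"
  have "\<Lambda> \<otimes>\<^bsub>L\<^esub> cf i j \<otimes>\<^bsub>L\<^esub> \<Lambda> = (\<Sum>k\<in>Bs. \<Lambda> \<otimes>\<^bsub>L\<^esub> left_adjoint L (cf i k) \<Lambda> \<otimes>\<^bsub>L\<^esub> cf k j)"
    using ij by (simp add: L.m_assoc left_adjoint_swap L.mult_sum_right left_adjoint_in)
  also have "\<dots> = (\<Sum>k\<in>Bs. if i = k then \<Lambda> \<otimes>\<^bsub>L\<^esub> cf k j else 0)"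
    using ij assms(1) \<Lambda>_in_M
    by (intro sum.cong) (auto simp: \<Lambda>_right counit_adjoint_cf L.mult_zero_left)
  also have "\<dots> = \<Lambda> \<otimes>\<^bsub>L\<^esub> cf i j" using ij finite_Bs by simp
  finally show "\<Lambda> \<otimes>\<^bsub>L\<^esub> cf i j \<otimes>\<^bsub>L\<^esub> \<Lambda> = \<Lambda> \<otimes>\<^bsub>L\<^esub> cf i j" .
qed simp_all

text \<open>The mirror image: \<open>\<Lambda> h\<close> becomes
  \<open>h\<^sub>1 ad(h\<^sub>2)(\<Lambda>)\<close>, and the \<open>\<Lambda>\<close> on the right
  absorbs the factor in \<open>M\<close>.\<close>

lemma right_stable_absorb:
  assumes "\<forall>h\<in>carrier L. \<forall>x\<in>M. right_adjoint L h x \<in> M" "l \<in> carrier L"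
  shows "\<Lambda> \<otimes>\<^bsub>L\<^esub> l \<otimes>\<^bsub>L\<^esub> \<Lambda> = l \<otimes>\<^bsub>L\<^esub> \<Lambda>"
proof (rule linear_map_cf_eq[OF linear_map_comp[OF L.linear_mult_left L.linear_mult_right]
      L.linear_mult_right L.lspace_axioms _ assms(2)])
  fix i j assume ij: "i \<in> Bs" "j \<in> Bs"
  have "\<Lambda> \<otimes>\<^bsub>L\<^esub> cf i j \<otimes>\<^bsub>L\<^esub> \<Lambda> = (\<Sum>k\<in>Bs. cf i k \<otimes>\<^bsub>L\<^esub> (right_adjoint L (cf k j) \<Lambda> \<otimes>\<^bsub>L\<^esub> \<Lambda>))"
    using ij by (simp add: right_adjoint_swap L.mult_sum_left right_adjoint_cf_in L.m_assoc)
  also have "\<dots> = (\<Sum>k\<in>Bs. if k = j then cf i k \<otimes>\<^bsub>L\<^esub> \<Lambda> else 0)"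
    using ij assms(1) \<Lambda>_in_M
    by (intro sum.cong) (auto simp: \<Lambda>_left counit_adjoint_cf L.mult_zero_right)
  also have "\<dots> = cf i j \<otimes>\<^bsub>L\<^esub> \<Lambda>" using ij finite_Bs by simp
  finally show "\<Lambda> \<otimes>\<^bsub>L\<^esub> cf i j \<otimes>\<^bsub>L\<^esub> \<Lambda> = cf i j \<otimes>\<^bsub>L\<^esub> \<Lambda>" .
qed simp_all

text \<open>The flip is an anti-automorphism of \<open>A \<otimes> A\<^sup>o\<^sup>p\<close> fixing \<open>e\<close>; it turns the absorption on one
  side, coming from stability under one of the adjoint actions, into absorption on the other side.\<close>

theorem normal_imp_absorb:
  assumes "normal_hopf_subalgebra L M" and t: "inv_tensor t"
  shows "e \<star> t \<star> e = t \<star> e"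
proof -
  have stable: "(\<forall>h\<in>carrier L. \<forall>x\<in>M. left_adjoint L h x \<in> M) \<or>
      (\<forall>h\<in>carrier L. \<forall>x\<in>M. right_adjoint L h x \<in> M)"
    using assms(1) by (simp add: normal_hopf_subalgebra_def)
  then show ?thesis
  proof
    assume left: "\<forall>h\<in>carrier L. \<forall>x\<in>M. left_adjoint L h x \<in> M"
    let ?u = "flip t"
    have u: "?u \<in> AA" and tt: "t \<in> AA"
      using t by (simp_all add: inv_tensor_def flip_in)
    obtain l where l: "corr ?u l" using inv_tensor_flip[OF t] by (rule inv_corr)
    then have "l \<in> carrier L" by (simp add: corr_def)
    with left_stable_absorb[OF left] have "\<Lambda> \<otimes>\<^bsub>L\<^esub> l \<otimes>\<^bsub>L\<^esub> \<Lambda> = \<Lambda> \<otimes>\<^bsub>L\<^esub> l" by blast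
    with corr_mult[OF corr_mult[OF corr_\<Lambda> l] corr_\<Lambda>] corr_mult[OF corr_\<Lambda> l]
    have "e \<star> ?u \<star> e = e \<star> ?u" by (auto intro: corr_unique_left)
    from arg_cong[OF this, of flip] show ?thesis
      using u tt e_tensor by (simp add: flip_mult E_mult_in e_flip flip_flip E_assoc)
  next
    assume right: "\<forall>h\<in>carrier L. \<forall>x\<in>M. right_adjoint L h x \<in> M"
    obtain l where l: "corr t l" using t by (rule inv_corr)
    then have "l \<in> carrier L" by (simp add: corr_def)
    with right_stable_absorb[OF right] have "\<Lambda> \<otimes>\<^bsub>L\<^esub> l \<otimes>\<^bsub>L\<^esub> \<Lambda> = l \<otimes>\<^bsub>L\<^esub> \<Lambda>" by blast
    with corr_mult[OF corr_mult[OF corr_\<Lambda> l] corr_\<Lambda>] corr_mult[OF l corr_\<Lambda>]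
    show ?thesis by (auto intro: corr_unique_left)
  qed
qed

end

section \<open>Functionals on \<open>L\<close> and the left coaction\<close>

context finite_left_galois
begin

lemma linear_map_Bs_eq:
  assumes f: "linear_map A V f" and g: "linear_map A V g" and x: "x \<in> carrier A"
    and eq: "\<And>b. b \<in> Bs \<Longrightarrow> f b = g b"
  shows "f x = g x"
proof -
  have "h x = (\<Sum>b\<in>Bs. scl V (crd b x) (h b))" if h: "linear_map A V h" for h
  proof -
    have "h x = h (\<Sum>b\<in>Bs. scl A (crd b x) b)"
      using expand[OF x] by simp
    also have "\<dots> = (\<Sum>b\<in>Bs. scl V (crd b x) (h b))"
      by (subst linear_map_sum[OF h A.lspace_axioms])
        (auto simp: A.scl_in linear_mapD(3)[OF h] intro!: sum.cong)
    finally show ?thesis .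
  qed
  from this[OF f] this[OF g] show ?thesis using eq by (simp cong: sum.cong)
qed

text \<open>Composed with \<open>comul L\<close> this is the map
  \<open>l \<mapsto> \<psi>(l\<^sub>1) l\<^sub>2\<close>.\<close>

definition leg2 :: "('v \<Rightarrow> 'k) \<Rightarrow> ('k, 'v, 'v) tensor \<Rightarrow> 'v" where
  "leg2 \<psi> = tlift L L (\<lambda>x y. scl L (\<psi> x) y)"

context
  fixes \<psi> :: "'v \<Rightarrow> 'k"
  assumes \<psi>: "linear_map L base_field \<psi>"
begin

lemma leg2_bilinear: "bilinear_on L L (scl L) (\<lambda>x y. scl L (\<psi> x) y)"
  using linear_mapD[OF \<psi>]
  by (intro bilinear_onI)
    (auto simp: L.ambient L.vs.scale_left_distrib L.vs.scale_right_distrib mult.commute)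

lemma linear_map_leg2: "linear_map (tensor L L) L (leg2 \<psi>)"
  unfolding leg2_def
  by (rule linear_map_tlift) (auto simp: L.lspace_axioms leg2_bilinear L.scl_in)

lemma leg2_tens: "\<lbrakk>x \<in> carrier L; y \<in> carrier L\<rbrakk> \<Longrightarrow> leg2 \<psi> (tens L L x y) = scl L (\<psi> x) y"
  unfolding leg2_def by (rule tlift_tens[OF L.lspace_axioms L.lspace_axioms leg2_bilinear])

lemma leg2_mult_right:
  assumes "t \<in> tensor_carrier L L" "y \<in> carrier L"
  shows "leg2 \<psi> (t \<otimes>\<^bsub>tensor L L\<^esub> tens L L \<one>\<^bsub>L\<^esub> y) = leg2 \<psi> t \<otimes>\<^bsub>L\<^esub> y"
  by (rule linear_map_eqI[where f = "\<lambda>t. leg2 \<psi> (t \<otimes>\<^bsub>tensor L L\<^esub> tens L L \<one>\<^bsub>L\<^esub> y)",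
        OF L.lspace_axioms L.lspace_axioms linear_map_comp[OF LL.T.linear_mult_right linear_map_leg2]
          linear_map_comp[OF linear_map_leg2 L.linear_mult_right]])
    (use assms in \<open>auto simp: LL.tensor_mult_tens leg2_tens L.mult_scl_left tens_in\<close>)

lemma linear_map_leg2_comul: "linear_map L L (\<lambda>x. leg2 \<psi> (comul L x))"
  by (rule linear_map_comp[OF comul_linear linear_map_leg2])

lemmas linear_map_tmap_leg2 = linear_map_tmap[OF L.lspace_axioms A.lspace_axioms linear_map_leg2_comul linear_map_id]
lemmas tmap_leg2_tens = tmap_tens[OF L.lspace_axioms A.lspace_axioms linear_map_leg2_comul linear_map_id]

text \<open>Coassociativity again: on a basis element \<open>j\<close> both sides are the sum of
  \<open>\<psi>(cf j m) cf m k \<otimes> k\<close> over \<open>m\<close> and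
  \<open>k\<close>.\<close>

lemma coaction_leg:
  assumes "x \<in> carrier A"
  shows "\<delta> (leg \<psi> (\<delta> x)) = tmap L A L A (\<lambda>x. leg2 \<psi> (comul L x)) id (\<delta> x)"
proof (rule linear_map_Bs_eq[where f = "\<lambda>x. \<delta> (leg \<psi> (\<delta> x))",
      OF linear_map_comp[OF linear_map_leg_coaction[OF \<psi>] coaction_linear]
        linear_map_comp[OF coaction_linear linear_map_tmap_leg2] assms])
  fix j assume j: "j \<in> Bs"
  have 1: "leg \<psi> (\<delta> j) = (\<Sum>m\<in>Bs. scl A (\<psi> (cf j m)) m)"
    unfolding coaction_expand[OF j]
    by (subst linear_map_sum[OF linear_map_leg[OF \<psi>] lspace_tensor])
      (auto simp: tens_in j leg_tens[OF \<psi>] intro!: sum.cong)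
  have 2: "leg2 \<psi> (comul L (cf j k)) = (\<Sum>m\<in>Bs. scl L (\<psi> (cf j m)) (cf m k))" if "k \<in> Bs" for k
    unfolding comul_cf[OF j that]
    by (subst linear_map_sum[OF linear_map_leg2 lspace_tensor])
      (auto simp: tens_in j that leg2_tens intro!: sum.cong)
  have "\<delta> (leg \<psi> (\<delta> j)) = (\<Sum>m\<in>Bs. \<delta> (scl A (\<psi> (cf j m)) m))"
    unfolding 1 by (rule linear_map_sum[OF coaction_linear A.lspace_axioms]) (auto simp: A.scl_in)
  also have "\<dots> = (\<Sum>m\<in>Bs. \<Sum>k\<in>Bs. fun_scl (\<psi> (cf j m)) (tens L A (cf m k) k))"
    by (intro sum.cong) (auto simp: linear_mapD(3)[OF coaction_linear] fs.scale_sum_right coaction_expand)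
  also have "\<dots> = (\<Sum>k\<in>Bs. tens L A (leg2 \<psi> (comul L (cf j k))) k)"
    by (subst sum.swap) (auto simp: 2 tens_sum_left tens_scl_left intro!: sum.cong)
  also have "\<dots> = tmap L A L A (\<lambda>x. leg2 \<psi> (comul L x)) id (\<Sum>k\<in>Bs. tens L A (cf j k) k)"
    by (subst linear_map_sum[OF linear_map_tmap_leg2 lspace_tensor])
      (auto simp: tens_in j tmap_leg2_tens intro!: sum.cong)
  also have "(\<Sum>k\<in>Bs. tens L A (cf j k) k) = \<delta> j"
    by (rule coaction_expand[OF j, symmetric])
  finally show "\<delta> (leg \<psi> (\<delta> j)) = tmap L A L A (\<lambda>x. leg2 \<psi> (comul L x)) id (\<delta> j)" .
qed

lemma tmap_leg2_mult_right:
  assumes "t \<in> LA" "y \<in> carrier A"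
  shows "tmap L A L A (\<lambda>x. leg2 \<psi> (comul L x)) id (t \<otimes>\<^bsub>tensor L A\<^esub> tens L A \<one>\<^bsub>L\<^esub> y)
    = tmap L A L A (\<lambda>x. leg2 \<psi> (comul L x)) id t \<otimes>\<^bsub>tensor L A\<^esub> tens L A \<one>\<^bsub>L\<^esub> y"
  by (rule LA_eqI[where f = "\<lambda>t. tmap L A L A (\<lambda>x. leg2 \<psi> (comul L x)) id (t \<otimes>\<^bsub>tensor L A\<^esub> tens L A \<one>\<^bsub>L\<^esub> y)", OF linear_map_comp[OF LA.T.linear_mult_right linear_map_tmap_leg2]
          linear_map_comp[OF linear_map_tmap_leg2 LA.T.linear_mult_right] assms(1)])
    (use assms linear_mapD(1)[OF linear_map_leg2_comul] in \<open>auto simp: LA.tensor_mult_tens tmap_leg2_tens tens_in\<close>)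

lemmas linear_map_tmap_leg = linear_map_tmap[OF A.lspace_axioms A.lspace_axioms linear_map_leg_coaction[OF \<psi>] linear_map_id]
lemmas tmap_leg_tens = tmap_tens[OF A.lspace_axioms A.lspace_axioms linear_map_leg_coaction[OF \<psi>] linear_map_id]

text \<open>Serves to translate a condition on \<open>w\<^sub>1 \<otimes> w\<^sub>2\<close>,
  contracted with an arbitrary functional, into one on the tensor of \<open>w\<close>.\<close>

lemma canon_leg:
  assumes "t \<in> AA"
  shows "canon (tmap A A A A (\<lambda>x. leg \<psi> (\<delta> x)) id t) = tmap L A L A (\<lambda>x. leg2 \<psi> (comul L x)) id (canon t)"
  by (rule AA_eqI[where f = "\<lambda>t. canon (tmap A A A A (\<lambda>x. leg \<psi> (\<delta> x)) id t)", OF linear_map_comp[OF linear_map_tmap_leg linear_map_canon]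
          linear_map_comp[OF linear_map_canon linear_map_tmap_leg2] assms])
    (auto simp: canon_tens tmap_leg_tens leg_in[OF \<psi>] coaction_in coaction_leg tmap_leg2_mult_right)

lemma crd_leg:
  assumes "b \<in> Bs" "u \<in> LA"
  shows "crd b (leg \<psi> u) = \<psi> (slice b u)"
  by (rule LA_eqI[where f = "\<lambda>u. crd b (leg \<psi> u)", OF linear_map_comp[OF linear_map_leg[OF \<psi>] crd_linear]
          linear_map_comp[OF linear_map_slice \<psi>]])
    (use assms linear_mapD(3)[OF \<psi>] in \<open>auto simp: leg_tens[OF \<psi>] slice_tens crd_scl mult.commute\<close>)

end

lemma tensor_leg_eqI:
  assumes t: "t \<in> LA" and u: "u \<in> LA"
    and eq: "\<And>\<psi>. linear_map L base_field \<psi> \<Longrightarrow> leg \<psi> t = leg \<psi> u"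
  shows "t = u"
proof (rule tensor_slice_eqI[OF t u])
  fix b assume b: "b \<in> Bs"
  have "slice b t - slice b u = 0"
  proof (rule zero_if_linear_functionals_zero[OF L.ambient])
    fix \<psi> assume "Vector_Spaces.linear (scl L) (*) \<psi>"
    then have \<psi>: "linear_map L base_field \<psi>" and diff: "\<And>x y. \<psi> (x - y) = \<psi> x - \<psi> y"
      by (auto simp: linear_map_def Vector_Spaces.linear_iff module_hom.diff[OF Vector_Spaces.linear.axioms(3)])
    then show "\<psi> (slice b t - slice b u) = 0"
      using crd_leg[OF \<psi> b t] crd_leg[OF \<psi> b u] eq[OF \<psi>] by simp
  qed
  then show "slice b t = slice b u" by simp
qed

end

section \<open>Normality from centrality of the integral\<close>

context galois_integral
begin

lemma tmap_act_id_fixed: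
  assumes "n \<in> F" "t \<in> tensor_carrier A' A'"
  shows "tmap A A A A (act n) id t = t"
proof -
  define N where "N = tmap A A A A (act n) id"
  have n: "n \<in> carrier G" using assms(1) by simp
  note lin = linear_map_tmap[OF A.lspace_axioms A.lspace_axioms act_linear[OF n] linear_map_id, folded N_def]
  note N_tens = tmap_tens[OF A.lspace_axioms A.lspace_axioms act_linear[OF n] linear_map_id, folded N_def]
  have "N t = t"
    using lspace_sub(1) lspace_sub(1) assms(2)
  proof (induction rule: tensor_induct)
    case (tens x y)
    then have "x \<in> carrier A" "y \<in> carrier A" "act n x = x" using assms(1) by (auto simp: fixed_def)
    then show ?case by (simp add: tens_carrier_update N_tens)
  next
    case (add t u)
    then show ?case using linear_mapD(2)[OF lin] by (simp add: tensor_sub)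
  qed
  then show ?thesis by (simp only: N_def)
qed

text \<open>Such a \<open>t\<close> equals its average over \<open>F \<times> F\<close>, and
  averaging a pure tensor yields a pure tensor of \<open>F\<close>-invariants.\<close>

lemma fixed_tensor:
  assumes t: "t \<in> AA" and inv: "\<And>n m. \<lbrakk>n \<in> F; m \<in> F\<rbrakk> \<Longrightarrow> act2 n m t = t"
  shows "t \<in> tensor_carrier A' A'"
proof -
  let ?N = "of_nat (card F) :: 'k"
  have "finite F" "F \<noteq> {}"
    using F_carrier finite_G finite_subset subgroup.one_closed[OF F_subgroup] by auto
  then have N: "?N \<noteq> 0" by simp
  have "(\<Sum>n\<in>F. \<Sum>m\<in>F. act2 n m s) \<in> tensor_carrier A' A'" if "s \<in> AA" for s
    using A.lspace_axioms A.lspace_axioms that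
  proof (induction rule: tensor_induct)
    case (tens x y)
    have "(\<Sum>n\<in>F. act n x) \<in> fixed F" if "x \<in> carrier A" for x
      using that by (auto simp: fixed_def sum_act_subgroup[OF F_subgroup] intro!: A.sum_in)
    then have "tens A' A' (\<Sum>n\<in>F. act n x) (\<Sum>m\<in>F. act m y) \<in> tensor_carrier A' A'"
      using tens by (intro tens_in) auto
    also have "tens A' A' (\<Sum>n\<in>F. act n x) (\<Sum>m\<in>F. act m y) = (\<Sum>n\<in>F. \<Sum>m\<in>F. act2 n m (tens A A x y))"
      unfolding tens_carrier_update tens_sum_left tens_sum_right
      using tens by (subst sum.swap) (simp add: act2_tens)
    finally show ?case .
  next
    case (add t u)
    then show ?case
      by (simp add: linear_mapD(2)[OF linear_map_act2] sum.distrib tensor_add_in)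
  qed
  from this[OF t] have "fun_scl ?N (fun_scl ?N t) \<in> tensor_carrier A' A'"
    by (simp add: inv fs.sum_constant_scale del: sum_constant)
  from tensor_scl_in[OF this, of "inverse (?N * ?N)"] have "fun_scl (inverse (?N * ?N) * (?N * ?N)) t \<in> tensor_carrier A' A'"
    by (simp only: fs.scale_scale)
  then show ?thesis using N by (simp only: left_inverse mult_eq_0_iff fs.scale_one simp_thms)
qed

text \<open>Contracted with \<open>\<psi>\<close>, the hypothesis says that the tensor of
  \<open>\<psi>(w\<^sub>1) w\<^sub>2\<close> times \<open>e\<close> is \<open>\<psi>(w) e\<close>.
  Acting by \<open>n\<close> in \<open>F\<close> on the first factor leaves \<open>e\<close> alone,
  so the acted tensor has the same product of factors. Since this holds for all
  \<open>\<psi>\<close>, the canonical map cannot distinguish \<open>t\<close> from its image under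
  \<open>n\<close>.\<close>

lemma coinvariant_in_M:
  assumes w: "w \<in> carrier L"
    and coinv: "comul L w \<otimes>\<^bsub>tensor L L\<^esub> tens L L \<one>\<^bsub>L\<^esub> \<Lambda> = tens L L w \<Lambda>"
  shows "w \<in> M"
proof -
  obtain t where t: "corr t w" using w by (rule corr_exists)
  then have tA: "t \<in> AA" by (simp add: corr_def)
  have fix_left: "tmap A A A A (act n) id t = t" if n: "n \<in> F" for n
  proof -
    let ?n = "tmap A A A A (act n) id"
    have n_lin: "linear_map (tensor A A) (tensor A A) ?n"
      using n by (intro linear_map_tmap A.lspace_axioms act_linear linear_map_id) simp
    note n_tens = tmap_tens[OF A.lspace_axioms A.lspace_axioms act_linear[OF F_in[OF n]] linear_map_id]
    have "canon (?n t) = tens L A w \<one>\<^bsub>A\<^esub>"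
    proof (rule tensor_leg_eqI)
      show "canon (?n t) \<in> LA" "tens L A w \<one>\<^bsub>A\<^esub> \<in> LA"
        using w tA linear_mapD(1)[OF n_lin] by (simp_all add: tens_in canon_in)
      fix \<psi> assume \<psi>: "linear_map L base_field \<psi>"
      let ?q = "tmap A A A A (\<lambda>x. leg \<psi> (\<delta> x)) id" and ?P = "\<lambda>x. leg2 \<psi> (comul L x)"
      note q_lin = linear_map_tmap_leg[OF \<psi>] and P_lin = linear_map_leg2_comul[OF \<psi>]
      have qt: "?q t \<in> AA" using linear_mapD(1)[OF q_lin] tA by simp
      have "corr (?q t) (?P w)"
        using t w qt linear_mapD(1)[OF P_lin]
        by (simp add: corr_def canon_leg[OF \<psi>] tmap_leg2_tens[OF \<psi>])
      then have c: "corr (?q t \<star> e) (?P w \<otimes>\<^bsub>L\<^esub> \<Lambda>)"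
        using corr_\<Lambda> by (rule corr_mult)
      have "?P w \<otimes>\<^bsub>L\<^esub> \<Lambda> = scl L (\<psi> w) \<Lambda>"
        using w by (simp add: leg2_mult_right[OF \<psi>, symmetric] comul_in coinv leg2_tens[OF \<psi>])
      with c corr_scl[OF corr_\<Lambda>, of "\<psi> w"] have "?q t \<star> e = fun_scl (\<psi> w) e"
        by (auto intro: corr_unique_left)
      then have "?n (?q t \<star> e) = fun_scl (\<psi> w) (?n e)"
        using e_tensor linear_mapD(3)[OF n_lin] by simp
      moreover have "?n (?q t \<star> e) = ?n (?q t) \<star> ?n e"
        using n qt e_tensor by (intro tmap_E_mult) (auto simp: act_linear linear_map_id act_mult)
      moreover have "?n e = e" using n e_in by (rule tmap_act_id_fixed)
      ultimately have "?n (?q t) \<star> e = fun_scl (\<psi> w) e" by simp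
      \<comment> \<open>As \<open>e\<close> has product \<open>1\<close>, multiplying by it from the
        right does not change the product of the factors.\<close>
      then have "multiply (?n (?q t)) = multiply (fun_scl (\<psi> w) e)"
        using multiply_mult_unit[OF _ e_tensor e_one, of "?n (?q t)"] linear_mapD(1)[OF n_lin] qt by simp
      also have "\<dots> = scl A (\<psi> w) \<one>\<^bsub>A\<^esub>"
        using linear_mapD(3)[OF linear_map_multiply] e_tensor by (simp add: e_one)
      \<comment> \<open>The action of \<open>n\<close> commutes with the left coaction and can be
        moved next to \<open>t\<close>.\<close>
      also have "?n (?q t) = ?q (?n t)"
      proof (rule AA_eqI[where f = "\<lambda>t. ?n (?q t)", OF
            linear_map_comp[OF q_lin n_lin] linear_map_comp[OF n_lin q_lin] tA])
        fix x y assume xy: "x \<in> carrier A" "y \<in> carrier A"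
        have "leg \<psi> (idact n u) = act n (leg \<psi> u)" if "u \<in> LA" for u
          by (rule LA_eqI[where f = "\<lambda>u. leg \<psi> (idact n u)", OF
              linear_map_comp[OF linear_map_idact linear_map_leg[OF \<psi>]] linear_map_comp[OF linear_map_leg[OF \<psi>] act_linear] that])
            (use n in \<open>auto simp: idact_tens leg_tens[OF \<psi>] linear_mapD(3)[OF act_linear]\<close>)
        then have "leg \<psi> (\<delta> (act n x)) = act n (leg \<psi> (\<delta> x))"
          using n xy by (simp add: act_coaction' coaction_in)
        then show "?n (?q (tens A A x y)) = ?q (?n (tens A A x y))"
          using xy n by (simp add: n_tens tmap_leg_tens[OF \<psi>] leg_in[OF \<psi>] coaction_in)
      qed
      finally show "leg \<psi> (canon (?n t)) = leg \<psi> (tens L A w \<one>\<^bsub>A\<^esub>)"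
        using w linear_mapD(1)[OF n_lin] tA by (simp add: leg_canon[OF \<psi>] leg_tens[OF \<psi>])
    qed
    then have "corr (?n t) w"
      using w linear_mapD(1)[OF n_lin] tA by (simp add: corr_def)
    then show ?thesis using t by (rule corr_unique_left)
  qed
  \<comment> \<open>Invariance under the diagonal action extends the invariance from the first
    factor to both.\<close>
  have "act2 n m t = t" if nm: "n \<in> F" "m \<in> F" for n m
  proof -
    let ?i = "inv\<^bsub>G\<^esub> m \<otimes>\<^bsub>G\<^esub> n"
    have i: "?i \<in> F" "m \<otimes>\<^bsub>G\<^esub> ?i = n"
      using nm F_subgroup by (auto simp: subgroup.m_closed subgroup.m_inv_closed G.m_assoc[symmetric])
    have "act2 n m t = act2 m m (tmap A A A A (act ?i) id t)"
    proof (rule AA_eqI[where f = "act2 n m", OF linear_map_act2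
          linear_map_comp[OF linear_map_tmap[OF A.lspace_axioms A.lspace_axioms act_linear linear_map_id] linear_map_act2] tA])
      fix x y assume "x \<in> carrier A" "y \<in> carrier A"
      then show "act2 n m (tens A A x y) = act2 m m (tmap A A A A (act ?i) id (tens A A x y))"
        using nm i by (subst tmap_tens[OF A.lspace_axioms A.lspace_axioms act_linear linear_map_id])
          (auto simp: act2_tens act_act)
    qed (use nm i in auto)
    also have "\<dots> = t"
      using fix_left[OF i(1)] corr_inv[OF t] nm by (simp add: inv_tensor_def)
    finally show ?thesis .
  qed
  with tA have "t \<in> tensor_carrier A' A'" by (rule fixed_tensor)
  with t show ?thesis by (rule corr_sub)
qed

text \<open>The comultiplication of \<open>r\<close> stays in \<open>M \<otimes> M\<close>, so
  \<open>\<Lambda>\<close> absorbs the second leg through the counit.\<close>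

lemma comul_absorb:
  assumes r: "r \<in> M"
  shows "comul L r \<otimes>\<^bsub>tensor L L\<^esub> tens L L \<one>\<^bsub>L\<^esub> \<Lambda> = tens L L r \<Lambda>"
proof -
  have b: "bilinear_on L L (scl L) (\<lambda>x y. scl L (counit L y) x)"
    by (rule bilinear_onI) (auto simp: L.ambient counit_add counit_scl L.vs.scale_left_distrib
        L.vs.scale_right_distrib L.vs.scale_left_commute)
  let ?c = "tlift L L (\<lambda>x y. scl L (counit L y) x)"
  have "s \<otimes>\<^bsub>tensor L L\<^esub> tens L L \<one>\<^bsub>L\<^esub> \<Lambda> = tens L L (?c s) \<Lambda>" if "s \<in> tensor_carrier L' L'" for s
    using lspace_sub(2) lspace_sub(2) that
  proof (induction rule: tensor_induct)
    case (tens x y)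
    then show ?case
      by (simp add: tens_carrier_update LL.tensor_mult_tens \<Lambda>_left tens_scl_left tens_scl_right
          tlift_tens[OF L.lspace_axioms L.lspace_axioms b])
  next
    case (add t u)
    then show ?case
      by (simp add: tensor_sub LL.tensor_mult_add_left tens_in tens_add_left
          tlift_add[OF L.lspace_axioms L.lspace_axioms b])
  qed
  from this[OF M_comul[OF r]] show ?thesis using L.counit_right r by simp
qed

text \<open>By the two preceding lemmas it suffices that the condition characterising
  \<open>M\<close> passes from \<open>r\<close> to \<open>h\<^sub>1 r S(h\<^sub>2)\<close>. In its
  comultiplication, multiplied by \<open>1 \<otimes> \<Lambda>\<close>, centrality brings
  \<open>1 \<otimes> \<Lambda>\<close> next to the comultiplication of \<open>r\<close>, which it
  absorbs.\<close>

theorem central_imp_normal: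
  assumes central: "\<And>t. inv_tensor t \<Longrightarrow> t \<star> e = e \<star> t"
  shows "normal_hopf_subalgebra L M"
proof -
  have \<Lambda>_central: "l \<otimes>\<^bsub>L\<^esub> \<Lambda> = \<Lambda> \<otimes>\<^bsub>L\<^esub> l" if l: "l \<in> carrier L" for l
  proof -
    obtain t where t: "corr t l" using l by (rule corr_exists)
    show ?thesis
      using corr_mult[OF t corr_\<Lambda>] corr_mult[OF corr_\<Lambda> t] central[OF corr_inv[OF t]]
      by (auto intro: corr_unique_right)
  qed
  let ?LL = "tensor L L" and ?\<Lambda> = "tens L L \<one>\<^bsub>L\<^esub> \<Lambda>"
  have \<Lambda>2: "?\<Lambda> \<in> tensor_carrier L L" by (simp add: tens_in)
  have \<Lambda>2_central: "s \<otimes>\<^bsub>?LL\<^esub> ?\<Lambda> = ?\<Lambda> \<otimes>\<^bsub>?LL\<^esub> s" if "s \<in> tensor_carrier L L" for s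
    by (rule linear_map_eqI[OF L.lspace_axioms L.lspace_axioms LL.T.linear_mult_right LL.T.linear_mult_left that])
      (auto simp: tens_in LL.tensor_mult_tens \<Lambda>_central)
  have "left_adjoint L (cf i k) r \<in> M" if ik: "i \<in> Bs" "k \<in> Bs" and r: "r \<in> M" for i k r
  proof (rule coinvariant_in_M)
    let ?w = "\<lambda>p. left_adjoint L (cf i p) r"
    have w: "?w p \<in> carrier L" if "p \<in> Bs" for p
      using that ik r by (intro left_adjoint_in) auto
    show "?w k \<in> carrier L" using w ik by simp
    let ?D = "\<lambda>i j. comul L (cf i j)" and ?S = "\<lambda>i j. comul L (antipode L (cf i j))"
    have D: "?D i j \<in> tensor_carrier L L" "?S i j \<in> tensor_carrier L L" if "i \<in> Bs" "j \<in> Bs" for i j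
      using that by (auto intro: comul_in)
    \<comment> \<open>In the first leg \<open>h r\<close> becomes
      \<open>ad(h\<^sub>1)(r) h\<^sub>2\<close>; in the second leg \<open>\<Lambda>\<close> is moved
      to the left. The comultiplications of the coefficients then stand on the right.\<close>
    have Dr: "?D i m \<otimes>\<^bsub>?LL\<^esub> tens L L r \<Lambda> = (\<Sum>p\<in>Bs. tens L L (?w p) \<Lambda> \<otimes>\<^bsub>?LL\<^esub> ?D p m)" if m: "m \<in> Bs" for m
    proof -
      have "?D i m \<otimes>\<^bsub>?LL\<^esub> tens L L r \<Lambda> = (\<Sum>q\<in>Bs. tens L L (cf i q \<otimes>\<^bsub>L\<^esub> r) (cf q m \<otimes>\<^bsub>L\<^esub> \<Lambda>))"
        using ik m r by (simp add: comul_cf) (subst LL.T.mult_sum_left, auto simp: tens_in LL.tensor_mult_tens intro!: sum.cong)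
      also have "\<dots> = (\<Sum>q\<in>Bs. \<Sum>p\<in>Bs. tens L L (?w p) \<Lambda> \<otimes>\<^bsub>?LL\<^esub> tens L L (cf p q) (cf q m))"
        using ik m r w
        by (intro sum.cong) (auto simp: left_adjoint_swap tens_sum_left LL.tensor_mult_tens \<Lambda>_central)
      also have "\<dots> = (\<Sum>p\<in>Bs. tens L L (?w p) \<Lambda> \<otimes>\<^bsub>?LL\<^esub> (\<Sum>q\<in>Bs. tens L L (cf p q) (cf q m)))"
        using m w by (subst sum.swap) (auto intro!: sum.cong LL.T.mult_sum_right[symmetric] simp: tens_in)
      finally show ?thesis using m by (simp add: comul_cf)
    qed
    \<comment> \<open>The comultiplication is multiplicative, so the antipode relation survives it
      and leaves only the term \<open>p = k\<close>.\<close>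
    have DS: "(\<Sum>m\<in>Bs. ?D p m \<otimes>\<^bsub>?LL\<^esub> ?S m k) = (if p = k then \<one>\<^bsub>?LL\<^esub> else 0)" if p: "p \<in> Bs" for p
    proof -
      have "(\<Sum>m\<in>Bs. ?D p m \<otimes>\<^bsub>?LL\<^esub> ?S m k) = comul L (\<Sum>m\<in>Bs. cf p m \<otimes>\<^bsub>L\<^esub> antipode L (cf m k))"
        using p ik by (subst linear_map_sum[OF comul_linear L.lspace_axioms]) (auto simp: comul_mult)
      then show ?thesis
        using p ik antipode_cf(2)[OF p ik(2)] linear_map_zero[OF comul_linear L.lspace_axioms]
        by (simp add: comul_one)
    qed
    have "comul L (?w k) = (\<Sum>m\<in>Bs. ?D i m \<otimes>\<^bsub>?LL\<^esub> comul L r \<otimes>\<^bsub>?LL\<^esub> ?S m k)"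
      using ik r by (simp add: left_adjoint_cf) (subst linear_map_sum[OF comul_linear L.lspace_axioms], auto simp: comul_mult)
    then have "comul L (?w k) \<otimes>\<^bsub>?LL\<^esub> ?\<Lambda> = (\<Sum>m\<in>Bs. ?D i m \<otimes>\<^bsub>?LL\<^esub> comul L r \<otimes>\<^bsub>?LL\<^esub> ?S m k \<otimes>\<^bsub>?LL\<^esub> ?\<Lambda>)"
      using ik r D comul_in[of r] by (simp add: LL.T.mult_sum_left \<Lambda>2 LL.tensor_mult_in)
    also have "\<dots> = (\<Sum>m\<in>Bs. ?D i m \<otimes>\<^bsub>?LL\<^esub> tens L L r \<Lambda> \<otimes>\<^bsub>?LL\<^esub> ?S m k)"
    proof (rule sum.cong[OF refl])
      fix m assume m: "m \<in> Bs"
      have "?D i m \<otimes>\<^bsub>?LL\<^esub> comul L r \<otimes>\<^bsub>?LL\<^esub> ?S m k \<otimes>\<^bsub>?LL\<^esub> ?\<Lambda>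
        = ?D i m \<otimes>\<^bsub>?LL\<^esub> (comul L r \<otimes>\<^bsub>?LL\<^esub> ?\<Lambda>) \<otimes>\<^bsub>?LL\<^esub> ?S m k"
        using ik m r D comul_in[of r] \<Lambda>2 by (simp add: LL.tensor_mult_assoc LL.tensor_mult_in \<Lambda>2_central[of "?S m k"])
      then show "?D i m \<otimes>\<^bsub>?LL\<^esub> comul L r \<otimes>\<^bsub>?LL\<^esub> ?S m k \<otimes>\<^bsub>?LL\<^esub> ?\<Lambda>
        = ?D i m \<otimes>\<^bsub>?LL\<^esub> tens L L r \<Lambda> \<otimes>\<^bsub>?LL\<^esub> ?S m k"
        using r by (simp add: comul_absorb)
    qed
    also have "\<dots> = (\<Sum>m\<in>Bs. \<Sum>p\<in>Bs. tens L L (?w p) \<Lambda> \<otimes>\<^bsub>?LL\<^esub> (?D p m \<otimes>\<^bsub>?LL\<^esub> ?S m k))"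
      using ik D w
      by (intro sum.cong) (auto simp: Dr LL.T.mult_sum_left LL.tensor_mult_in tens_in LL.tensor_mult_assoc)
    also have "\<dots> = (\<Sum>p\<in>Bs. tens L L (?w p) \<Lambda> \<otimes>\<^bsub>?LL\<^esub> (\<Sum>m\<in>Bs. ?D p m \<otimes>\<^bsub>?LL\<^esub> ?S m k))"
      using ik D w
      by (subst sum.swap) (auto intro!: sum.cong LL.T.mult_sum_right[symmetric] simp: tens_in LL.tensor_mult_in)
    also have "\<dots> = (\<Sum>p\<in>Bs. if p = k then tens L L (?w p) \<Lambda> else 0)"
      using w by (intro sum.cong) (auto simp: DS LL.T.mult_zero_right tens_in simp del: tensor_simps(3) intro!: LL.T.r_one)
    also have "\<dots> = tens L L (?w k) \<Lambda>" using ik finite_Bs by simp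
    finally show "comul L (?w k) \<otimes>\<^bsub>?LL\<^esub> ?\<Lambda> = tens L L (?w k) \<Lambda>" .
  qed
  then have "left_adjoint L h r \<in> M" if "h \<in> carrier L" "r \<in> M" for h r
    using that by (intro linear_map_cf_in[OF linear_map_left_adjoint[OF M_in[OF that(2)]] L.lspace_axioms M_subspace _ that(1)])
  then show ?thesis using M by (simp add: normal_hopf_subalgebra_def)
qed

end

section \<open>Twisted group algebras\<close>

lemma fun_scl_apply: "fun_scl c f x = c * f x"
  by (simp add: fun_scl_def)

lemma delta_apply: "delta g h = (if h = g then 1 else 0)"
  by (simp add: delta_def)

lemma sum_apply: "(sum f I) x = (\<Sum>i\<in>I. f i x)"
  by (induction I rule: infinite_finite_induct) (simp_all add: plus_fun_apply zero_fun_apply)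

lemma (in k_algebra) inv_scl_unit:
  assumes "a \<in> Units A" "c \<noteq> 0"
  shows "scl A c a \<in> Units A" "inv (scl A c a) = scl A (inverse c) (inv a)"
proof -
  have a: "a \<in> carrier A" "inv a \<in> carrier A" using assms(1) by auto
  have 1: "scl A (inverse c) (inv a) \<otimes> scl A c a = \<one>" "scl A c a \<otimes> scl A (inverse c) (inv a) = \<one>"
    using assms a by (simp_all add: mult_scl_left mult_scl_right scl_in)
  then show "scl A c a \<in> Units A"
    using a unfolding Units_def by (auto simp: scl_in intro!: bexI[of _ "scl A (inverse c) (inv a)"])
  then show "inv (scl A c a) = scl A (inverse c) (inv a)"
    using 1 a by (intro inv_unique'[symmetric]) (auto simp: scl_in)
qed

lemma (in monoid) inv_mult_units:
  assumes "a \<in> Units G" "b \<in> Units G"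
  shows "inv (a \<otimes> b) = inv b \<otimes> inv a"
proof (rule inv_unique'[symmetric])
  have c: "a \<in> carrier G" "b \<in> carrier G" "inv a \<in> carrier G" "inv b \<in> carrier G"
    using assms by auto
  have "b \<otimes> (inv b \<otimes> inv a) = inv a" "inv a \<otimes> (a \<otimes> b) = b"
    using assms c by (simp_all add: m_assoc[symmetric])
  then show "a \<otimes> b \<otimes> (inv b \<otimes> inv a) = \<one>" "inv b \<otimes> inv a \<otimes> (a \<otimes> b) = \<one>"
    using assms c by (simp_all add: m_assoc)
qed (use assms in auto)

locale twisted = G: group G
  for G :: "('g, 'x) monoid_scheme" (structure) +
  fixes S :: "'g set" and \<alpha> :: "'g \<Rightarrow> 'g \<Rightarrow> 'k::field_char_0"
  assumes finite_G: "finite (carrier G)" and S: "subgroup S G" and \<alpha>: "cocycle2 G S \<alpha>"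
begin

abbreviation "T \<equiv> twisted_group_algebra G S \<alpha>"

abbreviation T_times (infixl "\<cdot>" 70) where
  "v \<cdot> w \<equiv> v \<otimes>\<^bsub>T\<^esub> w"

lemma S_in [simp]: "s \<in> S \<Longrightarrow> s \<in> carrier G"
  using subgroup.subset[OF S] by blast

lemma finite_S: "finite S"
  using finite_subset[OF subgroup.subset[OF S] finite_G] .

lemma S_closed [simp]: "s \<in> S \<Longrightarrow> t \<in> S \<Longrightarrow> s \<otimes> t \<in> S" "s \<in> S \<Longrightarrow> inv s \<in> S" "\<one> \<in> S"
  using S by (auto simp: subgroup.m_closed subgroup.m_inv_closed subgroup.one_closed)

lemma \<alpha>_nonzero [simp]: "s \<in> S \<Longrightarrow> t \<in> S \<Longrightarrow> \<alpha> s t \<noteq> 0"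
  and \<alpha>_cocycle: "s \<in> S \<Longrightarrow> t \<in> S \<Longrightarrow> u \<in> S \<Longrightarrow> \<alpha> s t * \<alpha> (s \<otimes> t) u = \<alpha> t u * \<alpha> s (t \<otimes> u)"
  using \<alpha> by (auto simp: cocycle2_def)

text \<open>The cocycle identity at \<open>(\<one>, \<one>, s)\<close> and
  \<open>(s, \<one>, \<one>)\<close>. The scalar \<open>\<alpha> \<one> \<one>\<close> compares
  \<open>x\<^sub>1\<close> with the unit.\<close>

lemma \<alpha>_one: "s \<in> S \<Longrightarrow> \<alpha> \<one> s = \<alpha> \<one> \<one>" "s \<in> S \<Longrightarrow> \<alpha> s \<one> = \<alpha> \<one> \<one>"
  using \<alpha>_cocycle[of "\<one>" "\<one>" s] \<alpha>_cocycle[of s "\<one>" "\<one>"] by simp_all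

lemma T_simps [simp]:
  "carrier T = {v. \<forall>s. s \<notin> S \<longrightarrow> v s = 0}" "scl T = fun_scl"
  "\<one>\<^bsub>T\<^esub> = fun_scl (inverse (\<alpha> \<one> \<one>)) (delta \<one>)"
  by (simp_all add: twisted_group_algebra_def)

lemma T_mult: "v \<cdot> w = (\<Sum>s\<in>S. \<Sum>t\<in>S. fun_scl (v s * w t * \<alpha> s t) (delta (s \<otimes> t)))"
  by (simp add: twisted_group_algebra_def)

lemma lspace_T: "lspace T"
  by (auto simp: lspace_def vector_space_fun_scl fs.subspace_def zero_fun_apply plus_fun_apply fun_scl_def)

lemma delta_in: "s \<in> S \<Longrightarrow> delta s \<in> carrier T"
  by (auto simp: delta_def)

lemma delta_expand:
  assumes "v \<in> carrier T"
  shows "v = (\<Sum>s\<in>S. fun_scl (v s) (delta s))"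
proof
  fix x
  have "(\<Sum>s\<in>S. fun_scl (v s) (delta s)) x = (\<Sum>s\<in>S. if x = s then v s else 0)"
    by (auto simp: sum_apply fun_scl_def delta_def intro!: sum.cong)
  also have "\<dots> = v x" using assms finite_S by simp
  finally show "v x = (\<Sum>s\<in>S. fun_scl (v s) (delta s)) x" ..
qed

lemma linear_map_T_eq:
  assumes "linear_map T V f" "linear_map T V g" "\<And>s. s \<in> S \<Longrightarrow> f (delta s) = g (delta s)" "v \<in> carrier T"
  shows "f v = g v"
proof -
  have "h v = (\<Sum>s\<in>S. scl V (v s) (h (delta s)))" if h: "linear_map T V h" for h
  proof -
    have "h v = h (\<Sum>s\<in>S. fun_scl (v s) (delta s))" using delta_expand[OF assms(4)] by simp
    also have "\<dots> = (\<Sum>s\<in>S. h (fun_scl (v s) (delta s)))"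
      using lspace.scl_in[OF lspace_T] delta_in by (intro linear_map_sum[OF h lspace_T]) auto
    also have "\<dots> = (\<Sum>s\<in>S. scl V (v s) (h (delta s)))"
      using linear_mapD(3)[OF h] delta_in by (intro sum.cong) auto
    finally show ?thesis .
  qed
  from this[OF assms(1)] this[OF assms(2)] assms(3) show ?thesis by (simp cong: sum.cong)
qed

lemma delta_mult:
  assumes "s \<in> S" "t \<in> S"
  shows "delta s \<cdot> delta t = fun_scl (\<alpha> s t) (delta (s \<otimes> t))"
proof -
  have "delta s \<cdot> delta t = (\<Sum>s'\<in>S. if s' = s then (\<Sum>t'\<in>S. if t' = t then fun_scl (\<alpha> s' t') (delta (s' \<otimes> t')) else 0) else 0)"
    unfolding T_mult by (intro sum.cong refl) (auto simp: delta_def intro!: sum.cong sum.neutral)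
  also have "\<dots> = fun_scl (\<alpha> s t) (delta (s \<otimes> t))"
    using assms finite_S by simp
  finally show ?thesis .
qed

lemma T_mult_closed: "v \<cdot> w \<in> carrier T"
  unfolding T_mult using delta_in lspace.scl_in[OF lspace_T]
  by (intro lspace.sum_in[OF lspace_T]) auto

lemma T_mult_linear_left: "linear_map T T (\<lambda>w. v \<cdot> w)"
  and T_mult_linear_right: "linear_map T T (\<lambda>v. v \<cdot> w)"
  unfolding linear_map_def
  by (intro conjI ballI allI funcsetI T_mult_closed;
      simp add: T_mult plus_fun_apply fun_scl_apply algebra_simps fs.scale_left_distrib sum.distrib
        fs.scale_sum_right)+

lemma T_assoc:
  assumes "u \<in> carrier T" "v \<in> carrier T" "w \<in> carrier T"
  shows "u \<cdot> v \<cdot> w = u \<cdot> (v \<cdot> w)"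
proof -
  note L = T_mult_linear_left and R = T_mult_linear_right
  have 1: "delta s \<cdot> delta t \<cdot> delta r = delta s \<cdot> (delta t \<cdot> delta r)"
    if "s \<in> S" "t \<in> S" "r \<in> S" for s t r
    using that linear_mapD(3)[OF L] linear_mapD(3)[OF R] delta_in \<alpha>_cocycle[OF that]
    by (simp add: delta_mult G.m_assoc del: T_simps(1))
  have 2: "delta s \<cdot> delta t \<cdot> w = delta s \<cdot> (delta t \<cdot> w)" if "s \<in> S" "t \<in> S" for s t
    by (rule linear_map_T_eq[OF L linear_map_comp[OF L L] 1[OF that] assms(3)])
  have 3: "delta s \<cdot> v \<cdot> w = delta s \<cdot> (v \<cdot> w)" if "s \<in> S" for s
    by (rule linear_map_T_eq[OF linear_map_comp[OF L R] linear_map_comp[OF R L] 2[OF that] assms(2)])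
  show ?thesis
    by (rule linear_map_T_eq[OF linear_map_comp[OF R R] R 3 assms(1)])
qed

sublocale T: k_algebra T
proof (rule k_algebraI)
  note L = T_mult_linear_left and R = T_mult_linear_right
  show "monoid T"
  proof (rule monoidI)
    show "\<one>\<^bsub>T\<^esub> \<in> carrier T"
      using delta_in[of "\<one>"] lspace.scl_in[OF lspace_T] by simp
    fix v assume v: "v \<in> carrier T"
    have one: "linear_map T T (\<lambda>v. v)" by (simp add: linear_map_def)
    have unit: "\<one>\<^bsub>T\<^esub> \<cdot> delta s = delta s" "delta s \<cdot> \<one>\<^bsub>T\<^esub> = delta s" if "s \<in> S" for s
      using linear_mapD(3)[OF R delta_in, of "\<one>" "inverse (\<alpha> \<one> \<one>)" "delta s"]
        linear_mapD(3)[OF L delta_in, of "\<one>" "delta s" "inverse (\<alpha> \<one> \<one>)"] that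
      by (simp_all add: delta_mult \<alpha>_one[OF that])
    show "\<one>\<^bsub>T\<^esub> \<cdot> v = v"
      by (rule linear_map_T_eq[where f = "\<lambda>v. \<one>\<^bsub>T\<^esub> \<cdot> v", OF L one _ v]) (rule unit)
    show "v \<cdot> \<one>\<^bsub>T\<^esub> = v"
      by (rule linear_map_T_eq[where f = "\<lambda>v. v \<cdot> \<one>\<^bsub>T\<^esub>", OF R one _ v]) (rule unit)
  qed (rule T_mult_closed, rule T_assoc)
qed (rule lspace_T, (rule linear_mapD[OF T_mult_linear_left] linear_mapD[OF T_mult_linear_right]; assumption)+)

declare T_simps(1,3) [simp del]

abbreviation X :: "'g \<Rightarrow> 'g \<Rightarrow> 'k" where "X \<equiv> delta"
abbreviation XI :: "'g \<Rightarrow> 'g \<Rightarrow> 'k" where "XI s \<equiv> inv\<^bsub>T\<^esub> (delta s)"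

lemma X_in [simp]: "s \<in> S \<Longrightarrow> X s \<in> carrier T"
  by (rule delta_in)

lemma X_one: "X \<one> = fun_scl (\<alpha> \<one> \<one>) \<one>\<^bsub>T\<^esub>"
  by (simp add: T_simps(3))

lemma X_Units [simp]:
  assumes "s \<in> S"
  shows "X s \<in> Units T"
proof -
  \<comment> \<open>\<open>X (inv s) \<cdot> X s\<close> is \<open>\<alpha> (inv s) s\<close> times
    \<open>X \<one>\<close>, and \<open>X \<one>\<close> is \<open>\<alpha> \<one> \<one>\<close>
    times the unit.\<close>
  let ?c = "inverse (\<alpha> (inv s) s * \<alpha> \<one> \<one>)"
  have \<alpha>_inv: "\<alpha> s (inv s) = \<alpha> (inv s) s"
    using assms \<alpha>_cocycle[of s "inv s" s] by (simp add: \<alpha>_one[OF assms])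
  have "X s \<cdot> fun_scl ?c (X (inv s)) = \<one>\<^bsub>T\<^esub>" "fun_scl ?c (X (inv s)) \<cdot> X s = \<one>\<^bsub>T\<^esub>"
    using assms T.mult_scl_right[of "X s" "X (inv s)" ?c] T.mult_scl_left[of "X s" "X (inv s)" ?c]
    by (simp_all add: delta_mult \<alpha>_inv T_simps(3))
  moreover have "fun_scl ?c (X (inv s)) \<in> carrier T"
    using assms T.scl_in[of "X (inv s)"] by simp
  ultimately show ?thesis
    using assms unfolding Units_def by (auto intro!: bexI[of _ "fun_scl ?c (X (inv s))"])
qed

lemma XI_in [simp]: "s \<in> S \<Longrightarrow> XI s \<in> carrier T"
  by simp

lemma X_mult: "s \<in> S \<Longrightarrow> t \<in> S \<Longrightarrow> X (s \<otimes> t) = fun_scl (inverse (\<alpha> s t)) (X s \<cdot> X t)"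
  by (simp add: delta_mult)

lemma XI_mult: "s \<in> S \<Longrightarrow> t \<in> S \<Longrightarrow> XI (s \<otimes> t) = fun_scl (\<alpha> s t) (XI t \<cdot> XI s)"
  using T.inv_scl_unit(2)[of "X s \<cdot> X t" "inverse (\<alpha> s t)"] T.inv_mult_units[of "X s" "X t"]
  by (simp add: X_mult T.Units_m_closed)

text \<open>The scalar is left abstract: where it is used, it either cancels against its inverse or
  only its being non-zero matters.\<close>

lemma X_inv:
  assumes "s \<in> S"
  obtains c where "c \<noteq> 0" "X (inv s) = fun_scl c (XI s)" "XI (inv s) = fun_scl (inverse c) (X s)"
proof -
  let ?c = "\<alpha> s (inv s) * \<alpha> \<one> \<one>"
  have "X (inv s) = XI s \<cdot> (X s \<cdot> X (inv s))"
    using assms by (simp add: T.m_assoc[symmetric])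
  also have "\<dots> = fun_scl ?c (XI s)"
    using assms T.mult_scl_right[of "XI s" "\<one>\<^bsub>T\<^esub>"] by (simp add: delta_mult X_one)
  finally have 1: "X (inv s) = fun_scl ?c (XI s)" .
  have c: "?c \<noteq> 0" using assms by simp
  have "XI (inv s) = fun_scl (inverse ?c) (X s)"
    unfolding 1 using T.inv_scl_unit(2)[of "XI s" ?c] assms c by simp
  with c 1 show ?thesis by (rule that)
qed

definition cj :: "'g \<Rightarrow> ('g \<Rightarrow> 'k) \<Rightarrow> 'g \<Rightarrow> 'k" where
  "cj s v = X s \<cdot> v \<cdot> XI s"

lemma conj_action_eq: "conj_action G S \<alpha> = cj"
  by (simp add: fun_eq_iff conj_action_def cj_def Let_def)

lemma linear_map_cj: "s \<in> S \<Longrightarrow> linear_map T T (cj s)"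
  unfolding cj_def by (rule linear_map_comp[OF T.linear_mult_left T.linear_mult_right]) auto

lemma cj_in [simp]: "s \<in> S \<Longrightarrow> v \<in> carrier T \<Longrightarrow> cj s v \<in> carrier T"
  by (simp add: cj_def)

lemma cj_mult: "\<lbrakk>s \<in> S; v \<in> carrier T; w \<in> carrier T\<rbrakk> \<Longrightarrow> cj s (v \<cdot> w) = cj s v \<cdot> cj s w"
proof -
  assume a: "s \<in> S" "v \<in> carrier T" "w \<in> carrier T"
  have "cj s v \<cdot> cj s w = X s \<cdot> v \<cdot> (XI s \<cdot> X s) \<cdot> w \<cdot> XI s"
    unfolding cj_def using a by (simp only: T.m_assoc T.m_closed X_in XI_in)
  also have "\<dots> = cj s (v \<cdot> w)" using a by (simp add: cj_def T.m_assoc)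
  finally show ?thesis ..
qed

lemma cj_one: "s \<in> S \<Longrightarrow> cj s \<one>\<^bsub>T\<^esub> = \<one>\<^bsub>T\<^esub>"
  by (simp add: cj_def)

text \<open>The cocycle factors of \<open>X (s \<otimes> t)\<close> and of its inverse cancel:
  conjugation is an honest action of \<open>S\<close>, although \<open>s \<mapsto> X s\<close> is
  only projective.\<close>

lemma cj_cj: "\<lbrakk>s \<in> S; t \<in> S; v \<in> carrier T\<rbrakk> \<Longrightarrow> cj (s \<otimes> t) v = cj s (cj t v)"
  using T.mult_scl_left[of v "X s \<cdot> X t" "inverse (\<alpha> s t)"]
    T.mult_scl_left[of "fun_scl (\<alpha> s t) (XI t \<cdot> XI s)" "X s \<cdot> X t \<cdot> v" "inverse (\<alpha> s t)"]
    T.mult_scl_right[of "X s \<cdot> X t \<cdot> v" "XI t \<cdot> XI s" "\<alpha> s t"]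
    T.scl_in[of "XI t \<cdot> XI s" "\<alpha> s t"]
  by (simp only: cj_def XI_mult) (simp add: X_mult T.m_assoc)

lemma cj_id: "v \<in> carrier T \<Longrightarrow> cj \<one> v = v"
  using T.inv_scl_unit(2)[of "\<one>\<^bsub>T\<^esub>" "\<alpha> \<one> \<one>"] T.mult_scl_left[of v "\<one>\<^bsub>T\<^esub>"] T.mult_scl_right[of _ "\<one>\<^bsub>T\<^esub>"]
  by (simp add: cj_def X_one T.scl_in[simplified])

lemma cj_eq: "s \<in> S \<Longrightarrow> v \<in> carrier T \<Longrightarrow> X s \<cdot> v = cj s v \<cdot> X s"
  by (simp add: cj_def T.m_assoc)

lemma cj_XI: "s \<in> S \<Longrightarrow> v \<in> Units T \<Longrightarrow> cj s (inv\<^bsub>T\<^esub> v) = inv\<^bsub>T\<^esub> (cj s v)"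
proof -
  assume a: "s \<in> S" "v \<in> Units T"
  then have v: "v \<in> carrier T" "inv\<^bsub>T\<^esub> v \<in> carrier T" by auto
  have "cj s v \<cdot> cj s (inv\<^bsub>T\<^esub> v) = \<one>\<^bsub>T\<^esub>" "cj s (inv\<^bsub>T\<^esub> v) \<cdot> cj s v = \<one>\<^bsub>T\<^esub>"
    using a v by (simp_all add: cj_mult[symmetric] cj_one)
  then show ?thesis using a v by (intro T.inv_unique') auto
qed

section \<open>Sums over subgroups and the Casimir element of
  \<open>k\<^sub>\<alpha>S\<close>\<close>

lemma sum_translate:
  assumes "subgroup N G" "t \<in> N"
  shows "(\<Sum>u\<in>N. f (u \<otimes> t)) = (\<Sum>u\<in>N. f u)"
proof (rule sum.reindex_bij_betw)
  have N: "N \<subseteq> carrier G" using assms(1) by (rule subgroup.subset)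
  show "bij_betw (\<lambda>u. u \<otimes> t) N N"
    by (rule bij_betwI[where g = "\<lambda>u. u \<otimes> inv t"])
      (use assms N in \<open>auto simp: subgroup.m_closed subgroup.m_inv_closed G.m_assoc subset_iff\<close>)
qed

lemma sum_translate_left:
  assumes "subgroup N G" "t \<in> N"
  shows "(\<Sum>u\<in>N. f (t \<otimes> u)) = (\<Sum>u\<in>N. f u)"
proof (rule sum.reindex_bij_betw)
  have N: "N \<subseteq> carrier G" using assms(1) by (rule subgroup.subset)
  show "bij_betw (\<lambda>u. t \<otimes> u) N N"
    by (rule bij_betwI[where g = "\<lambda>u. inv t \<otimes> u"])
      (use assms N in \<open>auto simp: subgroup.m_closed subgroup.m_inv_closed G.m_assoc[symmetric] subset_iff\<close>)
qed

lemma sum_inverse: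
  assumes "subgroup N G"
  shows "(\<Sum>u\<in>N. f (inv u)) = (\<Sum>u\<in>N. f u)"
proof (rule sum.reindex_bij_betw)
  have N: "N \<subseteq> carrier G" using assms(1) by (rule subgroup.subset)
  show "bij_betw (\<lambda>u. inv u) N N"
    by (rule bij_betwI[where g = "\<lambda>u. inv u"])
      (use assms N in \<open>auto simp: subgroup.m_inv_closed subset_iff\<close>)
qed

text \<open>For \<open>b = X u\<close> substitute \<open>u \<otimes> v\<close> for \<open>v\<close>;
  the factor \<open>\<alpha> u v\<close> moves from one leg to the other.\<close>

lemma casimir:
  assumes "b \<in> carrier T"
  shows "(\<Sum>v\<in>S. tens T T (b \<cdot> X v) (XI v)) = (\<Sum>v\<in>S. tens T T (X v) (XI v \<cdot> b))"
proof (rule linear_map_T_eq[OF _ _ _ assms])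
  show "linear_map T (tensor T T) (\<lambda>b. \<Sum>v\<in>S. tens T T (b \<cdot> X v) (XI v))"
    by (intro linear_map_lincomb lspace_tensor lspace_T linear_map_comp[OF T.linear_mult_right linear_map_tens_left]) auto
  show "linear_map T (tensor T T) (\<lambda>b. \<Sum>v\<in>S. tens T T (X v) (XI v \<cdot> b))"
    by (intro linear_map_lincomb lspace_tensor lspace_T linear_map_comp[OF T.linear_mult_left linear_map_tens_right]) auto
  fix u assume u: "u \<in> S"
  have "tens T T (X u \<cdot> X v) (XI v) = tens T T (X (u \<otimes> v)) (XI (u \<otimes> v) \<cdot> X u)" if "v \<in> S" for v
    using u that tens_scl_left[of T T "\<alpha> u v"] tens_scl_right[of T T _ "\<alpha> u v"] T.mult_scl_left[of "X u" "XI v \<cdot> XI u" "\<alpha> u v"]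
    by (simp add: delta_mult XI_mult T.m_assoc)
  then show "(\<Sum>v\<in>S. tens T T (X u \<cdot> X v) (XI v)) = (\<Sum>v\<in>S. tens T T (X v) (XI v \<cdot> X u))"
    using sum_translate_left[OF S u, of "\<lambda>v. tens T T (X v) (XI v \<cdot> X u)"] by simp
qed

text \<open>Substituting \<open>inv v\<close> for \<open>v\<close> exchanges the legs up to two
  scalars that cancel. This symmetry is the source of \<open>e_flip\<close>.\<close>

lemma casimir_sym: "(\<Sum>v\<in>S. tens T T (X v) (XI v)) = (\<Sum>v\<in>S. tens T T (XI v) (X v))"
proof -
  have "tens T T (X (inv v)) (XI (inv v)) = tens T T (XI v) (X v)" if v: "v \<in> S" for v
  proof -
    obtain c where c: "c \<noteq> 0" "X (inv v) = fun_scl c (XI v)" "XI (inv v) = fun_scl (inverse c) (X v)"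
      using v by (rule X_inv)
    then show ?thesis using tens_scl_left[of T T c] tens_scl_right[of T T _ "inverse c"] by simp
  qed
  then show ?thesis
    using sum_inverse[OF S, of "\<lambda>v. tens T T (X v) (XI v)"] by simp
qed

lemma cj_X:
  assumes "u \<in> S" "v \<in> S"
  obtains c where "c \<noteq> 0" "cj u (X v) = fun_scl c (X (u \<otimes> v \<otimes> inv u))"
proof -
  obtain c where c: "c \<noteq> 0" "X (inv u) = fun_scl c (XI u)"
    using assms(1) by (rule X_inv)
  then have "XI u = fun_scl (inverse c) (X (inv u))" by simp
  then have "cj u (X v) = fun_scl (inverse c * \<alpha> u v * \<alpha> (u \<otimes> v) (inv u)) (X (u \<otimes> v \<otimes> inv u))"
    unfolding cj_def using assms T.mult_scl_left[of "X (inv u)" "X (u \<otimes> v)"]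
      T.mult_scl_right[of "fun_scl (\<alpha> u v) (X (u \<otimes> v))" "X (inv u)"] T.scl_in[of "X (u \<otimes> v)"]
    by (simp add: delta_mult mult.assoc)
  then show ?thesis using that[of "inverse c * \<alpha> u v * \<alpha> (u \<otimes> v) (inv u)"] assms c(1) by simp
qed

lemma cj_X_commute:
  assumes "t \<in> S" "v \<in> S" "t \<otimes> v = v \<otimes> t"
  shows "cj t (X v) = fun_scl (\<alpha> t v / \<alpha> v t) (X v)"
proof -
  have "X t \<cdot> X v = fun_scl (\<alpha> t v / \<alpha> v t) (X v \<cdot> X t)"
    using assms by (simp add: delta_mult)
  then show ?thesis
    unfolding cj_def using assms T.mult_scl_left[of "XI t" "X v \<cdot> X t"] by (simp add: T.m_assoc)
qed

text \<open>Replacing \<open>u\<close> by \<open>u \<otimes> t\<close> permutes the summands, but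
  also multiplies the sum by the eigenvalue.\<close>

lemma sum_cj_eigenvector:
  assumes N: "subgroup N G" "N \<subseteq> S" and y: "y \<in> carrier T" and t: "t \<in> N" "cj t y = fun_scl l y" "l \<noteq> 1"
  shows "(\<Sum>u\<in>N. cj u y) = 0"
proof -
  have tS: "t \<in> S" using N t by auto
  have "(\<Sum>u\<in>N. cj u y) = (\<Sum>u\<in>N. cj (u \<otimes> t) y)"
    using sum_translate[OF N(1) t(1), of "\<lambda>u. cj u y"] by simp
  also have "\<dots> = (\<Sum>u\<in>N. fun_scl l (cj u y))"
  proof (rule sum.cong[OF refl])
    fix u assume "u \<in> N"
    then have u: "u \<in> S" using N by auto
    then show "cj (u \<otimes> t) y = fun_scl l (cj u y)"
      using tS t y linear_mapD(3)[OF linear_map_cj[OF u], of y] by (simp add: cj_cj)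
  qed
  also have "\<dots> = fun_scl l (\<Sum>u\<in>N. cj u y)" by (simp add: fs.scale_sum_right)
  finally have "fun_scl (1 - l) (\<Sum>u\<in>N. cj u y) = 0"
    by (simp add: fs.scale_left_diff_distrib)
  then have "1 - l = 0 \<or> (\<Sum>u\<in>N. cj u y) = 0" by (simp only: fs.scale_eq_0_iff)
  then show ?thesis using t(3) by (auto simp only: right_minus_eq)
qed

text \<open>Where the regularity condition fails at \<open>t\<close>, \<open>X v\<close> is an
  eigenvector of conjugation by \<open>t\<close> with eigenvalue different from \<open>1\<close>,
  and so is its inverse.\<close>

lemma sum_cj_zero:
  assumes N: "subgroup N G" "N \<subseteq> S" and v: "v \<in> S" and t: "t \<in> N" "t \<otimes> v = v \<otimes> t" "\<alpha> v t \<noteq> \<alpha> t v"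
  shows "(\<Sum>u\<in>N. cj u (X v)) = 0" "(\<Sum>u\<in>N. cj u (XI v)) = 0"
proof -
  have tS: "t \<in> S" using N t by auto
  let ?l = "\<alpha> t v / \<alpha> v t"
  have l: "?l \<noteq> 1" "inverse ?l \<noteq> 1" "?l \<noteq> 0" using t v tS by simp_all
  have c: "cj t (X v) = fun_scl ?l (X v)" using tS v t(2) by (rule cj_X_commute)
  show "(\<Sum>u\<in>N. cj u (X v)) = 0"
    using v by (intro sum_cj_eigenvector[OF N _ t(1) c l(1)]) simp
  have "cj t (XI v) = fun_scl (inverse ?l) (XI v)"
    using tS v c T.inv_scl_unit(2)[of "X v" ?l] l(3) by (simp add: cj_XI)
  then show "(\<Sum>u\<in>N. cj u (XI v)) = 0"
    using v by (intro sum_cj_eigenvector[OF N _ t(1) _ l(2)]) simp_all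
qed

end

section \<open>The trace of a non-degenerate twisted group algebra\<close>

locale nondegenerate_twisted = twisted G S \<alpha>
  for G :: "('g, 'x) monoid_scheme" (structure) and S :: "'g set" and \<alpha> :: "'g \<Rightarrow> 'g \<Rightarrow> 'k::field_char_0" +
  assumes nondeg: "nondegenerate G S \<alpha>"
begin

text \<open>The trace of left multiplication on \<open>k\<^sub>\<alpha>S\<close>: only the
  coefficient at the identity contributes, and \<open>X \<one>\<close> is
  \<open>\<alpha> \<one> \<one>\<close> times the unit.\<close>

definition tr :: "('g \<Rightarrow> 'k) \<Rightarrow> 'k" where
  "tr v = of_nat (card S) * v \<one> * \<alpha> \<one> \<one>"

lemma linear_map_tr: "linear_map T base_field tr"
  by (auto simp: linear_map_def tr_def plus_fun_apply fun_scl_def algebra_simps)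

lemma card_S: "(of_nat (card S) :: 'k) \<noteq> 0"
proof -
  have "S \<noteq> {}" using subgroup.one_closed[OF S] by blast
  then show ?thesis using finite_S by simp
qed

lemma tr_one: "tr \<one>\<^bsub>T\<^esub> = of_nat (card S)"
  by (simp add: tr_def T_simps(3) fun_scl_def delta_def)

lemma tr_X: "s \<in> S \<Longrightarrow> tr (X s) = (if s = \<one> then of_nat (card S) * \<alpha> \<one> \<one> else 0)"
  by (auto simp: tr_def delta_def)

text \<open>Non-degeneracy enters here: an element \<open>s\<close> other than the identity is not
  regular, so the conjugates of \<open>X s\<close> cancel.\<close>

lemma sum_cj:
  assumes "y \<in> carrier T"
  shows "(\<Sum>v\<in>S. cj v y) = fun_scl (tr y) \<one>\<^bsub>T\<^esub>"
proof (rule linear_map_T_eq[OF _ _ _ assms])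
  show "linear_map T T (\<lambda>y. \<Sum>v\<in>S. cj v y)"
    by (intro linear_map_lincomb lspace_T linear_map_cj)
  show "linear_map T T (\<lambda>y. fun_scl (tr y) \<one>\<^bsub>T\<^esub>)"
    using linear_mapD[OF linear_map_tr] T.scl_in[of "\<one>\<^bsub>T\<^esub>"]
    by (auto simp: linear_map_def fs.scale_left_distrib)
  fix s assume s: "s \<in> S"
  show "(\<Sum>v\<in>S. cj v (X s)) = fun_scl (tr (X s)) \<one>\<^bsub>T\<^esub>"
  proof (cases "s = \<one>")
    case True
    have "cj v (X s) = fun_scl (\<alpha> \<one> \<one>) \<one>\<^bsub>T\<^esub>" if "v \<in> S" for v
      using that linear_mapD(3)[OF linear_map_cj[OF that], of "\<one>\<^bsub>T\<^esub>"] by (simp add: True X_one cj_one)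
    then have "(\<Sum>v\<in>S. cj v (X s)) = (\<Sum>v\<in>S. fun_scl (\<alpha> \<one> \<one>) \<one>\<^bsub>T\<^esub>)" by simp
    also have "\<dots> = fun_scl (of_nat (card S)) (fun_scl (\<alpha> \<one> \<one>) \<one>\<^bsub>T\<^esub>)" by (rule fs.sum_constant_scale)
    finally show ?thesis using s by (simp add: tr_X True)
  next
    case False
    then obtain t where "t \<in> S" "t \<otimes> s = s \<otimes> t" "\<alpha> s t \<noteq> \<alpha> t s"
      using nondeg s by (auto simp: nondegenerate_def regular_def centralizer_def)
    then show ?thesis using sum_cj_zero[OF S order_refl s] s False by (simp add: tr_X)
  qed
qed

lemma sum_cj': 
  assumes "y \<in> carrier T"
  shows "(\<Sum>v\<in>S. XI v \<cdot> y \<cdot> X v) = fun_scl (tr y) \<one>\<^bsub>T\<^esub>"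
proof -
  have "cj (inv v) y = XI v \<cdot> y \<cdot> X v" if v: "v \<in> S" for v
  proof -
    obtain c where c: "c \<noteq> 0" "X (inv v) = fun_scl c (XI v)" "XI (inv v) = fun_scl (inverse c) (X v)"
      using v by (rule X_inv)
    then show ?thesis
      using v assms T.mult_scl_left[of y "XI v"] T.mult_scl_left[of "fun_scl (inverse c) (X v)" "XI v \<cdot> y" c]
        T.mult_scl_right[of "XI v \<cdot> y" "X v"] T.scl_in[of "X v"]
      by (simp add: cj_def)
  qed
  then show ?thesis using sum_cj[OF assms] sum_inverse[OF S, of "\<lambda>v. cj v y"] by simp
qed

lemma tr_XI_X:
  assumes "s \<in> S" "t \<in> S"
  shows "tr (XI s \<cdot> X t) = (if s = t then of_nat (card S) else 0)"
proof (cases "s = t")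
  case True
  then show ?thesis using assms by (simp add: tr_one)
next
  case False
  obtain c where c: "c \<noteq> 0" "X (inv s) = fun_scl c (XI s)"
    using assms(1) by (rule X_inv)
  have ne: "inv s \<otimes> t \<noteq> \<one>"
  proof
    assume "inv s \<otimes> t = \<one>"
    moreover have "t = s \<otimes> (inv s \<otimes> t)" using assms by (simp add: G.m_assoc[symmetric])
    ultimately show False using assms False by simp
  qed
  have "fun_scl c (XI s \<cdot> X t) = X (inv s) \<cdot> X t"
    using assms T.mult_scl_left[of "X t" "XI s" c] by (simp add: c(2))
  then have "c * tr (XI s \<cdot> X t) = tr (fun_scl (\<alpha> (inv s) t) (X (inv s \<otimes> t)))"
    using linear_mapD(3)[OF linear_map_tr, of "XI s \<cdot> X t" c] assms by (simp add: delta_mult)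
  also have "\<dots> = 0"
    using linear_mapD(3)[OF linear_map_tr, of "X (inv s \<otimes> t)"] assms ne by (simp add: tr_X)
  finally show ?thesis using c(1) False by simp
qed

text \<open>Up to the factor \<open>card S\<close>, the \<open>XI s\<close> are dual to the
  \<open>X s\<close> under the trace form; the cocycle factor released by the trace recombines with
  \<open>X w \<cdot> XI w'\<close> to \<open>X u\<close>.\<close>

lemma tr_dual:
  assumes "u \<in> S" "w \<in> S" "w' \<in> S"
  shows "fun_scl (tr (XI w \<cdot> X u \<cdot> X w')) (X w \<cdot> XI w')
    = (if w = u \<otimes> w' then fun_scl (of_nat (card S)) (X u) else 0)"
proof -
  have "XI w \<cdot> X u \<cdot> X w' = fun_scl (\<alpha> u w') (XI w \<cdot> X (u \<otimes> w'))"
    using assms T.mult_scl_right[of "XI w" "X (u \<otimes> w')" "\<alpha> u w'"] by (simp add: T.m_assoc delta_mult)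
  then have 1: "tr (XI w \<cdot> X u \<cdot> X w') = (if w = u \<otimes> w' then \<alpha> u w' * of_nat (card S) else 0)"
    using assms linear_mapD(3)[OF linear_map_tr, of "XI w \<cdot> X (u \<otimes> w')" "\<alpha> u w'"] by (simp add: tr_XI_X)
  have 2: "fun_scl (\<alpha> u w') (X (u \<otimes> w') \<cdot> XI w') = X u"
  proof -
    have "fun_scl (\<alpha> u w') (X (u \<otimes> w') \<cdot> XI w') = X u \<cdot> X w' \<cdot> XI w'"
      using assms T.mult_scl_left[of "XI w'" "X (u \<otimes> w')" "\<alpha> u w'"] by (simp add: delta_mult)
    then show ?thesis using assms by (simp add: T.m_assoc)
  qed
  show ?thesis
  proof (cases "w = u \<otimes> w'")
    case True
    have "fun_scl (\<alpha> u w' * of_nat (card S)) (X w \<cdot> XI w') = fun_scl (of_nat (card S)) (fun_scl (\<alpha> u w') (X w \<cdot> XI w'))"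
      by (simp add: mult.commute)
    then show ?thesis unfolding 1 using 2 by (simp only: True if_True simp_thms)
  qed (simp add: 1)
qed

end

section \<open>The Galois objects of function algebras\<close>

lemma (in lspace) finite_basis:
  assumes "finite W" "carrier V \<subseteq> module.span (scl V) W"
  obtains Bs crd where "finite Bs" "Bs \<subseteq> carrier V"
    "\<And>b. b \<in> Bs \<Longrightarrow> linear_map V base_field (crd b)"
    "\<And>x. x \<in> carrier V \<Longrightarrow> x = (\<Sum>b\<in>Bs. scl V (crd b x) b)"
    "\<And>b b'. \<lbrakk>b \<in> Bs; b' \<in> Bs\<rbrakk> \<Longrightarrow> crd b b' = (if b = b' then 1 else 0)"
proof -
  obtain B where B: "B \<subseteq> carrier V" "vs.independent B" "carrier V \<subseteq> vs.span B"
    by (rule vs.maximal_independent_subset)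
  have fin: "finite B"
    using vs.independent_span_bound[OF assms(1) B(2)] B(1) assms(2) by blast
  define crd where "crd = (\<lambda>b x. vs.representation B x b)"
  show ?thesis
  proof (rule that[OF fin B(1), of crd])
    show "linear_map V base_field (crd b)" for b
      using B(3) by (auto simp: linear_map_def crd_def subset_iff vs.representation_add[OF B(2)]
          vs.representation_scale[OF B(2)])
    show "x = (\<Sum>b\<in>B. scl V (crd b x) b)" if "x \<in> carrier V" for x
      using that B(3) vs.sum_representation_eq[OF B(2) _ fin order_refl, of x] by (auto simp: crd_def)
    show "crd b b' = (if b = b' then 1 else 0)" if "b \<in> B" "b' \<in> B" for b b'
      using vs.representation_basis[OF B(2) that(2)] by (simp add: crd_def)
  qed
qed

section \<open>Functions on \<open>G\<close> and their translations\<close>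

context twisted
begin

abbreviation "A \<equiv> galois_alg G S \<alpha>"
abbreviation "H \<equiv> function_hopf G :: ('k, 'g \<Rightarrow> 'k) hopf"

lemma A_carrier: "f \<in> carrier A \<longleftrightarrow> (\<forall>g\<in>carrier G. f g \<in> carrier T) \<and> (\<forall>g. g \<notin> carrier G \<longrightarrow> f g = 0) \<and>
    (\<forall>s\<in>S. \<forall>g\<in>carrier G. f (s \<otimes> g) = cj s (f g))"
  by (simp add: galois_alg_def Let_def conj_action_eq)

lemma A_mult: "g \<in> carrier G \<Longrightarrow> (f \<otimes>\<^bsub>A\<^esub> f') g = f g \<cdot> f' g"
  and A_mult_outside: "g \<notin> carrier G \<Longrightarrow> (f \<otimes>\<^bsub>A\<^esub> f') g = 0"
  and A_one: "g \<in> carrier G \<Longrightarrow> \<one>\<^bsub>A\<^esub> g = \<one>\<^bsub>T\<^esub>"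
  and A_one_outside: "g \<notin> carrier G \<Longrightarrow> \<one>\<^bsub>A\<^esub> g = 0"
  and A_scl: "scl A c f g = fun_scl c (f g)"
  by (simp_all add: galois_alg_def Let_def)

lemma A_value [simp]: "f \<in> carrier A \<Longrightarrow> g \<in> carrier G \<Longrightarrow> f g \<in> carrier T"
  and A_outside: "f \<in> carrier A \<Longrightarrow> g \<notin> carrier G \<Longrightarrow> f g = 0"
  and A_equivariant: "f \<in> carrier A \<Longrightarrow> s \<in> S \<Longrightarrow> g \<in> carrier G \<Longrightarrow> f (s \<otimes> g) = cj s (f g)"
  by (auto simp: A_carrier)

lemma A_eqI: "\<lbrakk>f \<in> carrier A; f' \<in> carrier A; \<And>g. g \<in> carrier G \<Longrightarrow> f g = f' g\<rbrakk> \<Longrightarrow> f = f'"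
proof
  fix g assume a: "f \<in> carrier A" "f' \<in> carrier A" "\<And>g. g \<in> carrier G \<Longrightarrow> f g = f' g"
  show "f g = f' g"
    using A_outside[OF a(1), of g] A_outside[OF a(2), of g] a(3)[of g] by (cases "g \<in> carrier G") simp_all
qed

lemma linear_map_eval: "g \<in> carrier G \<Longrightarrow> linear_map A T (\<lambda>f. f g)"
  by (auto simp: linear_map_def plus_fun_apply A_scl)

lemma translate_apply: "h \<in> carrier G \<Longrightarrow> translate G g f h = f (h \<otimes> g)"
  by (simp add: translate_def)

lemma translate_in: "g \<in> carrier G \<Longrightarrow> f \<in> carrier A \<Longrightarrow> translate G g f \<in> carrier A"
  by (auto simp: A_carrier translate_def G.m_assoc)

lemma linear_map_translate: "g \<in> carrier G \<Longrightarrow> linear_map A A (translate G g)"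
  by (auto simp: linear_map_def translate_in) (auto simp: translate_def fun_eq_iff A_scl plus_fun_apply zero_fun_apply fun_scl_apply)

lemma translate_mult: "g \<in> carrier G \<Longrightarrow> translate G g (f \<otimes>\<^bsub>A\<^esub> f') = translate G g f \<otimes>\<^bsub>A\<^esub> translate G g f'"
  by (rule ext) (auto simp: translate_def A_mult A_mult_outside)

lemma translate_one: "g \<in> carrier G \<Longrightarrow> translate G g \<one>\<^bsub>A\<^esub> = \<one>\<^bsub>A\<^esub>"
  by (rule ext) (auto simp: translate_def A_one A_one_outside)

lemma translate_translate: "g \<in> carrier G \<Longrightarrow> h \<in> carrier G \<Longrightarrow>
    translate G g (translate G h f) = translate G (g \<otimes> h) f"
  by (rule ext) (auto simp: translate_def G.m_assoc)

lemma translate_id: "f \<in> carrier A \<Longrightarrow> translate G \<one> f = f"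
  using A_outside[of f] by (intro ext) (auto simp: translate_def)

text \<open>The spanning functions are concentrated at single points and need not be equivariant, so
  they may lie outside \<open>A\<close>; \<open>lspace.finite_basis\<close> asks only that the span
  contain the carrier.\<close>

lemma A_finite_span:
  assumes "lspace A"
  shows "\<exists>W. finite W \<and> carrier A \<subseteq> module.span (scl A) W"
proof -
  interpret A: lspace A by fact
  let ?d = "\<lambda>g s g'. if g' = g then delta s else (0 :: 'g \<Rightarrow> 'k)"
  let ?W = "(\<lambda>(g, s). ?d g s) ` (carrier G \<times> S)"
  have "f \<in> A.vs.span ?W" if f: "f \<in> carrier A" for f
  proof -
    have "f = (\<Sum>g\<in>carrier G. \<Sum>s\<in>S. scl A (f g s) (?d g s))"
    proof
      fix x
      have "(\<Sum>g\<in>carrier G. \<Sum>s\<in>S. scl A (f g s) (?d g s)) x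
        = (\<Sum>g\<in>carrier G. if x = g then (\<Sum>s\<in>S. fun_scl (f g s) (delta s)) else 0)"
        by (simp add: sum_apply A_scl) (auto intro!: sum.cong)
      also have "\<dots> = (if x \<in> carrier G then (\<Sum>s\<in>S. fun_scl (f x s) (delta s)) else 0)"
        using finite_G by simp
      also have "\<dots> = f x" using delta_expand[OF A_value[OF f], of x] A_outside[OF f, of x] by simp
      finally show "f x = (\<Sum>g\<in>carrier G. \<Sum>s\<in>S. scl A (f g s) (?d g s)) x" ..
    qed
    moreover have "(\<Sum>g\<in>carrier G. \<Sum>s\<in>S. scl A (f g s) (?d g s)) \<in> A.vs.span ?W"
      by (intro A.vs.span_sum A.vs.span_scale A.vs.span_base) auto
    ultimately show ?thesis by simp
  qed
  then show ?thesis using finite_G finite_S by (intro exI[of _ ?W]) auto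
qed

section \<open>The function algebra and its coaction\<close>

lemma H_simps [simp]: "carrier H = {f. \<forall>g. g \<notin> carrier G \<longrightarrow> f g = 0}" "scl H = fun_scl"
  "\<one>\<^bsub>H\<^esub> = (\<lambda>g. if g \<in> carrier G then 1 else 0)"
  by (simp_all add: function_hopf_def Let_def kalg.defs)

lemma lspace_H: "lspace H"
  by (auto simp: lspace_def vector_space_fun_scl fs.subspace_def zero_fun_apply plus_fun_apply fun_scl_def)

lemma delta_in_H: "g \<in> carrier G \<Longrightarrow> delta g \<in> carrier H"
  by (auto simp: delta_def)

lemma one_H_delta: "\<one>\<^bsub>H\<^esub> = (\<Sum>g\<in>carrier G. delta g)"
  using finite_G by (auto simp: fun_eq_iff sum_apply delta_def)

abbreviation "\<rho> \<equiv> galois_coaction G S \<alpha>"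

lemma coaction_eq: "\<rho> f = (\<Sum>g\<in>carrier G. tens A H (translate G g f) (delta g))"
  by (simp add: galois_coaction_def)

lemma coaction_invariant:
  assumes "\<And>g. g \<in> carrier G \<Longrightarrow> translate G g f = f"
  shows "\<rho> f = tens A H f \<one>\<^bsub>H\<^esub>"
  unfolding coaction_eq one_H_delta using assms by (simp add: tens_sum_right)

context
  fixes \<phi> :: "('g \<Rightarrow> 'k) \<Rightarrow> 'k"
  assumes \<phi>: "linear_map H base_field \<phi>" and A: "lspace A"
begin

text \<open>Contracts the leg in \<open>H\<close>; evaluation at \<open>g\<close> recovers
  translation by \<open>g\<close> from the coaction.\<close>

definition hleg :: "('k, 'g \<Rightarrow> 'g \<Rightarrow> 'k, 'g \<Rightarrow> 'k) tensor \<Rightarrow> 'g \<Rightarrow> 'g \<Rightarrow> 'k" where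
  "hleg = tlift A H (\<lambda>x h. scl A (\<phi> h) x)"

lemma hleg_bilinear: "bilinear_on A H (scl A) (\<lambda>x h. scl A (\<phi> h) x)"
proof -
  interpret A: lspace A by (rule A)
  show ?thesis
    using linear_mapD(2,3)[OF \<phi>]
    by (intro bilinear_onI) (auto simp del: H_simps(1) simp: A.lspace_ambient A.vs.scale_left_distrib
        A.vs.scale_right_distrib mult.commute)
qed

lemma linear_map_hleg: "linear_map (tensor A H) A hleg"
  unfolding hleg_def
  by (rule linear_map_tlift) (auto simp: A lspace_H hleg_bilinear lspace.scl_in[OF A] simp del: H_simps(1))

lemma hleg_tens: "x \<in> carrier A \<Longrightarrow> h \<in> carrier H \<Longrightarrow> hleg (tens A H x h) = scl A (\<phi> h) x"
  unfolding hleg_def by (rule tlift_tens[OF A lspace_H hleg_bilinear])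

lemma hleg_coaction:
  assumes "f \<in> carrier A"
  shows "hleg (\<rho> f) = (\<Sum>g\<in>carrier G. scl A (\<phi> (delta g)) (translate G g f))"
  unfolding coaction_eq
  by (subst linear_map_sum[OF linear_map_hleg lspace_tensor])
    (use assms in \<open>auto simp: tens_in delta_in_H translate_in hleg_tens simp del: H_simps(1)\<close>)

end

lemma linear_map_eval_H: "linear_map H base_field (\<lambda>h. h g)"
  by (simp add: linear_map_def plus_fun_apply fun_scl_apply)

lemma hleg_eval_coaction:
  assumes "lspace A" "f \<in> carrier A" "g \<in> carrier G"
  shows "hleg (\<lambda>h. h g) (\<rho> f) = translate G g f"
proof -
  interpret A: lspace A by fact
  have "hleg (\<lambda>h. h g) (\<rho> f) = (\<Sum>g'\<in>carrier G. if g = g' then translate G g' f else 0)"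
    unfolding hleg_coaction[OF linear_map_eval_H assms(1,2)]
    by (intro sum.cong) (auto simp: delta_def)
  then show ?thesis using assms(3) finite_G by simp
qed

lemma coaction_in_A: "f \<in> carrier A \<Longrightarrow> \<rho> f \<in> tensor_carrier A H"
  unfolding coaction_eq by (intro tensor_sum_in tens_in translate_in delta_in_H)

text \<open>The bicomodule identity, with the right leg evaluated at \<open>g\<close>.\<close>

lemma coaction_translate:
  assumes bi: "bigalois_object L H A \<delta> \<rho>" and g: "g \<in> carrier G" and f: "f \<in> carrier A"
  shows "\<delta> (translate G g f) = tmap L A L A id (translate G g) (\<delta> f)"
proof -
  interpret bi: bigalois_object L H A \<delta> \<rho> by (rule bi)
  have sp: "lspace L" "lspace A" "lspace H"
    using bi.left.L.lspace_axioms bi.left.A.lspace_axioms lspace_H by blast+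
  note ev = linear_map_hleg[OF linear_map_eval_H sp(2), of g]
  define K where "K = tmap L (tensor A H) L A id (hleg (\<lambda>h. h g))"
  have K: "linear_map (tensor L (tensor A H)) (tensor L A) K"
    unfolding K_def by (intro linear_map_tmap sp lspace_tensor linear_map_id ev)
  have K_tens: "K (tens L (tensor A H) l t) = tens L A l (hleg (\<lambda>h. h g) t)"
    if "l \<in> carrier L" "t \<in> tensor_carrier A H" for l t
    unfolding K_def using that by (subst tmap_tens[OF sp(1) lspace_tensor linear_map_id ev]) auto
  note as = linear_map_tassoc[OF sp]
  have \<rho>_lin: "linear_map A (tensor A H) \<rho>"
    using bi.right.coaction_hom by (simp add: algebra_hom_def)
  have "K (tmap L A L (tensor A H) id \<rho> (\<delta> f)) = tmap L A L A id (translate G g) (\<delta> f)"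
  proof (rule linear_map_eqI[OF sp(1,2) linear_map_comp[OF linear_map_tmap[OF sp(1,2) linear_map_id \<rho>_lin] K]
        linear_map_tmap[OF sp(1,2) linear_map_id linear_map_translate[OF g]] bi.left.coaction_in[OF f]])
    fix l x assume lx: "l \<in> carrier L" "x \<in> carrier A"
    then show "K (tmap L A L (tensor A H) id \<rho> (tens L A l x)) = tmap L A L A id (translate G g) (tens L A l x)"
      by (simp add: tmap_tens[OF sp(1,2) linear_map_id \<rho>_lin] K_tens coaction_in_A hleg_eval_coaction sp g
          tmap_tens[OF sp(1,2) linear_map_id linear_map_translate[OF g]])
  qed
  moreover have "K (tassoc L A H (tmap A H (tensor L A) H \<delta> id (\<rho> f))) = \<delta> (translate G g f)"
  proof -
    have a: "K (tassoc L A H (tens (tensor L A) H u h)) = fun_scl (h g) u"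
      if u: "u \<in> tensor_carrier L A" and h: "h \<in> carrier H" for u h
      by (rule linear_map_eqI[where f = "\<lambda>u. K (tassoc L A H (tens (tensor L A) H u h))" and U = "tensor L A" and U' = "tensor L A",
            OF sp(1,2) linear_map_comp[OF linear_map_comp[OF linear_map_tens_left[OF h] as] K] _ u])
        (use h in \<open>auto simp del: H_simps(1) simp: sp linear_map_def tensor_scl_in fs.scale_right_distrib tassoc_tens K_tens tens_in
           hleg_tens[OF linear_map_eval_H] tens_scl_right mult.commute\<close>)
    have 1: "tmap A H (tensor L A) H \<delta> id (\<rho> f) = (\<Sum>g'\<in>carrier G. tens (tensor L A) H (\<delta> (translate G g' f)) (delta g'))"
      unfolding coaction_eq
      by (subst linear_map_sum[OF linear_map_tmap[OF sp(2,3) bi.left.coaction_linear linear_map_id] lspace_tensor])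
        (auto simp: tens_in f translate_in delta_in_H tmap_tens[OF sp(2,3) bi.left.coaction_linear linear_map_id]
          simp del: H_simps(1) intro!: sum.cong)
    have cl: "tens (tensor L A) H (\<delta> (translate G g' f)) (delta g') \<in> carrier (tensor (tensor L A) H)"
      if "g' \<in> carrier G" for g'
      using that f by (simp add: tens_in translate_in bi.left.coaction_in delta_in_H del: H_simps(1))
    have "K (tassoc L A H (\<Sum>g'\<in>carrier G. tens (tensor L A) H (\<delta> (translate G g' f)) (delta g')))
      = (\<Sum>g'\<in>carrier G. K (tassoc L A H (tens (tensor L A) H (\<delta> (translate G g' f)) (delta g'))))"
      using cl by (rule linear_map_sum[OF linear_map_comp[OF as K] lspace_tensor])
    also have "\<dots> = (\<Sum>g'\<in>carrier G. if g = g' then \<delta> (translate G g' f) else 0)"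
    proof (rule sum.cong[OF refl])
      fix g' assume g': "g' \<in> carrier G"
      have "K (tassoc L A H (tens (tensor L A) H (\<delta> (translate G g' f)) (delta g'))) = fun_scl (delta g' g) (\<delta> (translate G g' f))"
        using f g' by (intro a bi.left.coaction_in translate_in delta_in_H)
      then show "K (tassoc L A H (tens (tensor L A) H (\<delta> (translate G g' f)) (delta g'))) = (if g = g' then \<delta> (translate G g' f) else 0)"
        by (simp add: delta_def)
    qed
    also have "\<dots> = \<delta> (translate G g f)" using g finite_G by simp
    finally show ?thesis unfolding 1 .
  qed
  ultimately show ?thesis
    using bi.bicomodule[OF f] by simp
qed

text \<open>The functions pulled back along \<open>\<pi>\<close> are those constant on the cosets of
  the kernel, and evaluating the coaction at \<open>g\<close> gives translation by
  \<open>g\<close>.\<close>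

lemma galois_restriction_eq:
  assumes "lspace A" and G': "group G'" and \<pi>: "\<pi> \<in> epi G G'"
  shows "galois_restriction H A \<rho> (pullback_functions G G' \<pi>) =
    {f \<in> carrier A. \<forall>n\<in>kernel G G' \<pi>. translate G n f = f}"
proof -
  interpret A: lspace A by fact
  interpret G': group G' by fact
  have hom: "\<pi> \<in> hom G G'" using \<pi> by (simp add: epi_def)
  interpret \<pi>: group_hom G G' \<pi>
    using hom by unfold_locales
  let ?K = "pullback_functions G G' \<pi> :: ('g \<Rightarrow> 'k) set"
  let ?H' = "H\<lparr>carrier := ?K\<rparr>"
  have K_eq: "h (g \<otimes> n) = h g" if "h \<in> ?K" "g \<in> carrier G" "n \<in> kernel G G' \<pi>" for h g n
    using that by (auto simp: pullback_functions_def kernel_def)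
  have K_sub: "?K \<subseteq> carrier H" by (auto simp: pullback_functions_def)
  have K_lspace: "lspace ?H'"
  proof (rule lspace.lspace_restrict[OF lspace_H])
    show "module.subspace (scl H) ?K"
      unfolding H_simps(2)
    proof (rule fs.subspaceI)
      show "0 \<in> ?K" unfolding pullback_functions_def
        by (rule image_eqI[of _ _ 0]) (auto simp: fun_eq_iff zero_fun_apply function_hopf_def Let_def kalg.defs)
      fix x y assume "x \<in> ?K" "y \<in> ?K"
      then obtain p q where pq: "p \<in> carrier (function_hopf G')" "x = (\<lambda>g. if g \<in> carrier G then p (\<pi> g) else 0)"
        "q \<in> carrier (function_hopf G')" "y = (\<lambda>g. if g \<in> carrier G then q (\<pi> g) else 0)"
        unfolding pullback_functions_def by blast
      then show "x + y \<in> ?K" unfolding pullback_functions_def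
        by (intro image_eqI[of _ _ "p + q"]) (auto simp: fun_eq_iff plus_fun_apply function_hopf_def Let_def kalg.defs)
    next
      fix c x assume "x \<in> ?K"
      then obtain p where p: "p \<in> carrier (function_hopf G')" "x = (\<lambda>g. if g \<in> carrier G then p (\<pi> g) else 0)"
        unfolding pullback_functions_def by blast
      then show "fun_scl c x \<in> ?K" unfolding pullback_functions_def
        by (intro image_eqI[of _ _ "fun_scl c p"]) (auto simp: fun_eq_iff fun_scl_def function_hopf_def Let_def kalg.defs)
    qed
  qed
  show ?thesis
  proof (rule Set.set_eqI, rule iffI)
    fix f assume "f \<in> galois_restriction H A \<rho> ?K"
    then have f: "f \<in> carrier A" "\<rho> f \<in> tensor_carrier A ?H'"
      by (simp_all add: galois_restriction_def)
    have "translate G n f = f" if n: "n \<in> kernel G G' \<pi>" for n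
    proof -
      have nG: "n \<in> carrier G" using n by (simp add: kernel_def)
      \<comment> \<open>Evaluations at \<open>n\<close> and at the identity agree on pulled back
        functions; on \<open>\<rho> f\<close> they return the translate by \<open>n\<close> and
        \<open>f\<close> itself.\<close>
      have "hleg (\<lambda>h. h n) t = hleg (\<lambda>h. h \<one>) t" if "t \<in> tensor_carrier A ?H'" for t
        using assms(1) K_lspace that
      proof (induction rule: tensor_induct)
        case (tens x h)
        then have "h \<in> ?K" "h \<in> carrier H" using K_sub by auto
        then show ?case
          using tens K_eq[of h "\<one>" n] n nG
          by (simp add: tens_carrier_update hleg_tens[OF linear_map_eval_H assms(1)] del: H_simps(1))
      next
        case (add t u)
        then have "t \<in> tensor_carrier A H" "u \<in> tensor_carrier A H"
          using tensor_carrier_mono[of A A ?H' H] K_sub by auto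
        then show ?case
          using add linear_mapD(2)[OF linear_map_hleg[OF linear_map_eval_H assms(1)]] by simp
      qed
      from this[OF f(2)] show ?thesis
        using f(1) nG by (simp add: hleg_eval_coaction[OF assms(1)] translate_id)
    qed
    with f show "f \<in> {f \<in> carrier A. \<forall>n\<in>kernel G G' \<pi>. translate G n f = f}" by blast
  next
    fix f assume "f \<in> {f \<in> carrier A. \<forall>n\<in>kernel G G' \<pi>. translate G n f = f}"
    then have f: "f \<in> carrier A" "\<And>n. n \<in> kernel G G' \<pi> \<Longrightarrow> translate G n f = f" by auto
    have eq: "translate G g f = translate G h f" if "g \<in> carrier G" "h \<in> carrier G" "\<pi> g = \<pi> h" for g h
    proof -
      have n: "inv h \<otimes> g \<in> kernel G G' \<pi>"
        using that by (simp add: kernel_def)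
      have "translate G g f = translate G h (translate G (inv h \<otimes> g) f)"
        using that by (simp add: translate_translate G.m_assoc[symmetric])
      then show ?thesis using f(2)[OF n] by simp
    qed
    \<comment> \<open>A representative of each fibre of \<open>\<pi>\<close>. The translate of
      \<open>f\<close> depends only on the fibre, so the coaction is summed fibrewise; the sum of
      \<open>delta g\<close> over a fibre is a pulled back function.\<close>
    let ?c = "\<lambda>y. SOME g. g \<in> carrier G \<and> \<pi> g = y"
    have c: "?c (\<pi> g) \<in> carrier G \<and> \<pi> (?c (\<pi> g)) = \<pi> g" if "g \<in> carrier G" for g
      using that by (intro someI[of "\<lambda>g'. g' \<in> carrier G \<and> \<pi> g' = \<pi> g"]) auto
    let ?Y = "\<pi> ` carrier G"
    have fY: "finite ?Y" using finite_G by simp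
    have "\<rho> f = (\<Sum>y\<in>?Y. \<Sum>g\<in>{g \<in> carrier G. \<pi> g = y}. tens A H (translate G g f) (delta g))"
      unfolding coaction_eq by (rule sum.image_gen[OF finite_G])
    also have "\<dots> = (\<Sum>y\<in>?Y. tens A H (translate G (?c y) f) (\<Sum>g\<in>{g \<in> carrier G. \<pi> g = y}. delta g))"
    proof (rule sum.cong[OF refl])
      fix y assume y: "y \<in> ?Y"
      have "(\<Sum>g\<in>{g \<in> carrier G. \<pi> g = y}. tens A H (translate G g f) (delta g))
        = (\<Sum>g\<in>{g \<in> carrier G. \<pi> g = y}. tens A H (translate G (?c y) f) (delta g))"
        using c by (intro sum.cong refl arg_cong2[where f = "tens A H"] eq) auto
      then show "(\<Sum>g\<in>{g \<in> carrier G. \<pi> g = y}. tens A H (translate G g f) (delta g))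
        = tens A H (translate G (?c y) f) (\<Sum>g\<in>{g \<in> carrier G. \<pi> g = y}. delta g)"
        by (simp add: tens_sum_right)
    qed
    also have "\<dots> = (\<Sum>y\<in>?Y. tens A ?H' (translate G (?c y) f) (\<Sum>g\<in>{g \<in> carrier G. \<pi> g = y}. delta g))"
      by (simp add: tens_carrier_update)
    also have "\<dots> \<in> tensor_carrier A ?H'"
    proof (intro tensor_sum_in tens_in)
      fix y assume y: "y \<in> ?Y"
      show "translate G (?c y) f \<in> carrier A" using y c f(1) by (auto intro: translate_in)
      have "(\<Sum>g\<in>{g \<in> carrier G. \<pi> g = y}. delta g) = (\<lambda>g. if g \<in> carrier G then delta y (\<pi> g) else (0 :: 'k))"
        using finite_G by (auto simp: fun_eq_iff sum_apply delta_def)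
      moreover have "(delta y :: 'a \<Rightarrow> 'k) \<in> carrier (function_hopf G')"
        using y by (auto simp: function_hopf_def Let_def kalg.defs delta_def)
      ultimately show "(\<Sum>g\<in>{g \<in> carrier G. \<pi> g = y}. delta g) \<in> carrier ?H'"
        by (simp add: pullback_functions_def)
    qed
    finally show "f \<in> galois_restriction H A \<rho> ?K"
      using f(1) by (simp add: galois_restriction_def)
  qed
qed

end

section \<open>The integral as a tensor\<close>

locale galois_normality = nondegenerate_twisted G S \<alpha>
  for G :: "('g, 'x) monoid_scheme" (structure) and S :: "'g set" and \<alpha> :: "'g \<Rightarrow> 'g \<Rightarrow> 'k::field_char_0" +
  fixes F :: "'g set"
    and L :: "('k, 'l::ab_group_add, 'z) hopf_scheme"
    and \<delta> :: "('g \<Rightarrow> 'g \<Rightarrow> 'k) \<Rightarrow> ('k, 'l, 'g \<Rightarrow> 'g \<Rightarrow> 'k) tensor"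
    and M :: "'l set"
  assumes F: "F \<lhd> G"
    and bigalois: "bigalois_object L H A \<delta> \<rho>"
    and M_hopf: "hopf_subalgebra L M"
    and sub_galois: "left_galois_object (L\<lparr>carrier := M\<rparr>)
      (A\<lparr>carrier := {f \<in> carrier A. \<forall>n\<in>F. translate G n f = f}\<rparr>) \<delta>"
begin

lemma left_galois: "left_galois_object L A \<delta>" and right_galois: "right_galois_object H A \<rho>"
  using bigalois by (simp_all add: bigalois_object_def)

lemma ex_basis: "\<exists>Bs crd. finite_left_galois L A \<delta> Bs crd"
proof -
  interpret left_galois_object L A \<delta> by (rule left_galois)
  obtain W where W: "finite W" "carrier A \<subseteq> module.span (scl A) W"
    using A_finite_span[OF A.lspace_axioms] by blast
  show ?thesis
  proof (rule A.finite_basis[OF W])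
    fix Bs crd
    assume "finite Bs" "Bs \<subseteq> carrier A"
      "\<And>b. b \<in> Bs \<Longrightarrow> linear_map A base_field (crd b)"
      "\<And>x. x \<in> carrier A \<Longrightarrow> x = (\<Sum>b\<in>Bs. scl A (crd b x) b)"
      "\<And>b b'. \<lbrakk>b \<in> Bs; b' \<in> Bs\<rbrakk> \<Longrightarrow> crd b b' = (if b = b' then 1 else 0)"
    then have "finite_left_galois L A \<delta> Bs crd"
      by (intro finite_left_galois.intro finite_left_galois_axioms.intro left_galois)
    then show ?thesis by blast
  qed
qed

text \<open>Fixed as a constant so that the sublocales can refer to one basis.\<close>

definition "Bs = (SOME Bs. \<exists>crd. finite_left_galois L A \<delta> Bs crd)"
definition "crd = (SOME crd. finite_left_galois L A \<delta> Bs crd)"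

lemma basis: "finite_left_galois L A \<delta> Bs crd"
proof -
  have "\<exists>crd. finite_left_galois L A \<delta> Bs crd"
    unfolding Bs_def by (rule someI_ex[OF ex_basis])
  then show ?thesis
    unfolding crd_def by (rule someI_ex)
qed

sublocale finite_left_galois L A \<delta> Bs crd
  by (rule basis)

notation E_times (infixl "\<star>" 70)

sublocale galois_action L A \<delta> Bs crd G "translate G"
proof unfold_locales
  fix x assume x: "x \<in> carrier A" "\<And>g. g \<in> carrier G \<Longrightarrow> translate G g x = x"
  have "\<rho> x = tens A H x \<one>\<^bsub>H\<^esub>" using x(2) by (rule coaction_invariant)
  then show "x \<in> range (\<lambda>c. scl A c \<one>\<^bsub>A\<^esub>)"
    using right_galois_object.coinvariants[OF right_galois] x(1) by blast
qed (auto simp: finite_G linear_map_translate translate_mult translate_one translate_translate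
    coaction_translate[OF bigalois])

lemma F_subgroup: "subgroup F G" and F_normal: "\<lbrakk>n \<in> F; g \<in> carrier G\<rbrakk> \<Longrightarrow> g \<otimes> n \<otimes> inv g \<in> F"
  using F by (auto intro: normal_imp_subgroup normal.inv_op_closed2)

lemma F_normal': "\<lbrakk>n \<in> F; g \<in> carrier G\<rbrakk> \<Longrightarrow> inv g \<otimes> n \<otimes> g \<in> F"
  using F by (auto intro: normal.inv_op_closed1)

lemma F_G [simp]: "n \<in> F \<Longrightarrow> n \<in> carrier G"
  using subgroup.subset[OF F_subgroup] by blast

lemma finite_F: "finite F"
  using finite_subset[OF subgroup.subset[OF F_subgroup] finite_G] .

lemma card_F: "(of_nat (card F) :: 'k) \<noteq> 0"
proof -
  have "F \<noteq> {}" using subgroup.one_closed[OF F_subgroup] by blast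
  then show ?thesis using finite_F by simp
qed

text \<open>The element of \<open>A\<close> that is supported on the coset \<open>S r\<close> and
  takes the value \<open>b\<close> at \<open>r\<close>.\<close>

definition ind :: "'g \<Rightarrow> ('g \<Rightarrow> 'k) \<Rightarrow> 'g \<Rightarrow> 'g \<Rightarrow> 'k" where
  "ind r b = (\<lambda>g. if g \<in> carrier G \<and> g \<otimes> inv r \<in> S then cj (g \<otimes> inv r) b else 0)"

lemma ind_apply: "g \<in> carrier G \<Longrightarrow> ind r b g = (if g \<otimes> inv r \<in> S then cj (g \<otimes> inv r) b else 0)"
  by (simp add: ind_def)

lemma S_cancel: "\<lbrakk>s \<in> S; g \<in> carrier G\<rbrakk> \<Longrightarrow> s \<otimes> g \<in> S \<longleftrightarrow> g \<in> S"
proof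
  assume a: "s \<in> S" "g \<in> carrier G" "s \<otimes> g \<in> S"
  then have "inv s \<otimes> (s \<otimes> g) \<in> S" by simp
  then show "g \<in> S" using a by (simp add: G.m_assoc[symmetric])
qed simp

lemma ind_in:
  assumes r: "r \<in> carrier G" and b: "b \<in> carrier T"
  shows "ind r b \<in> carrier A"
  unfolding A_carrier
proof (intro conjI ballI allI impI)
  fix s g assume sg: "s \<in> S" "g \<in> carrier G"
  then have "s \<otimes> g \<otimes> inv r = s \<otimes> (g \<otimes> inv r)" using r by (simp add: G.m_assoc)
  then show "ind r b (s \<otimes> g) = cj s (ind r b g)"
    using sg r b linear_map_zero[OF linear_map_cj[OF sg(1)] lspace_T]
    by (simp add: ind_apply S_cancel cj_cj)
qed (use b T.zero_in in \<open>auto simp: ind_def\<close>)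

lemma linear_map_ind: "r \<in> carrier G \<Longrightarrow> linear_map T A (ind r)"
  using linear_mapD(2,3)[OF linear_map_cj]
  by (auto simp: linear_map_def ind_in) (auto simp: ind_def fun_eq_iff[of "ind _ _"] fun_eq_iff[of "\<lambda>g. _ g"] plus_fun_apply A_scl zero_fun_apply intro!: ext)

lemma ind_mult_left:
  assumes "r \<in> carrier G" "b \<in> carrier T" "f \<in> carrier A"
  shows "f \<otimes>\<^bsub>A\<^esub> ind r b = ind r (f r \<cdot> b)"
proof (rule A_eqI)
  fix g assume g: "g \<in> carrier G"
  have "f g = cj (g \<otimes> inv r) (f r)" if "g \<otimes> inv r \<in> S"
    using A_equivariant[OF assms(3) that assms(1)] g assms(1) by (simp add: G.m_assoc)
  then show "(f \<otimes>\<^bsub>A\<^esub> ind r b) g = ind r (f r \<cdot> b) g"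
    using g assms by (simp add: A_mult ind_apply cj_mult T.mult_zero_right)
qed (use assms in \<open>auto intro: ind_in\<close>)

lemma ind_mult_right:
  assumes "r \<in> carrier G" "b \<in> carrier T" "f \<in> carrier A"
  shows "ind r b \<otimes>\<^bsub>A\<^esub> f = ind r (b \<cdot> f r)"
proof (rule A_eqI)
  fix g assume g: "g \<in> carrier G"
  have "f g = cj (g \<otimes> inv r) (f r)" if "g \<otimes> inv r \<in> S"
    using A_equivariant[OF assms(3) that assms(1)] g assms(1) by (simp add: G.m_assoc)
  then show "(ind r b \<otimes>\<^bsub>A\<^esub> f) g = ind r (b \<cdot> f r) g"
    using g assms by (simp add: A_mult ind_apply cj_mult T.mult_zero_left)
qed (use assms in \<open>auto intro: ind_in\<close>)

lemma translate_ind: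
  assumes "r \<in> carrier G" "h \<in> carrier G"
  shows "translate G h (ind r b) = ind (r \<otimes> inv h) b"
  using assms by (intro ext) (auto simp: translate_def ind_def G.inv_mult_group G.m_assoc)

text \<open>The \<open>r\<close> that contribute form the coset \<open>S g\<close>.\<close>

lemma sum_coset:
  assumes "g \<in> carrier G"
  shows "(\<Sum>r\<in>carrier G. if g \<otimes> inv r \<in> S then c else 0) = fun_scl (of_nat (card S)) c"
proof -
  have "(\<Sum>r\<in>carrier G. if g \<otimes> inv r \<in> S then c else 0) = (\<Sum>r\<in>carrier G. if g \<otimes> r \<in> S then c else 0)"
    by (rule sum_inverse[OF G.subgroup_self, of "\<lambda>r. if g \<otimes> r \<in> S then c else 0"])
  also have "\<dots> = (\<Sum>r\<in>carrier G. if r \<in> S then c else 0)"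
    by (rule sum_translate_left[OF G.subgroup_self assms, of "\<lambda>r. if r \<in> S then c else 0"])
  also have "\<dots> = (\<Sum>r\<in>S. c)"
    using finite_G by (simp add: sum.If_cases Int_absorb1 subgroup.subset[OF S] del: sum_constant)
  also have "\<dots> = fun_scl (of_nat (card S)) c" by (rule fs.sum_constant_scale)
  finally show ?thesis .
qed

lemma sum_ind_one: "(\<Sum>r\<in>carrier G. ind r \<one>\<^bsub>T\<^esub>) = scl A (of_nat (card S)) \<one>\<^bsub>A\<^esub>"
proof (rule A_eqI)
  fix g assume g: "g \<in> carrier G"
  have "(\<Sum>r\<in>carrier G. ind r \<one>\<^bsub>T\<^esub>) g = (\<Sum>r\<in>carrier G. if g \<otimes> inv r \<in> S then \<one>\<^bsub>T\<^esub> else 0)"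
    by (rule trans[OF sum_apply]) (use g in \<open>auto simp: ind_apply cj_one intro!: sum.cong\<close>)
  then show "(\<Sum>r\<in>carrier G. ind r \<one>\<^bsub>T\<^esub>) g = scl A (of_nat (card S)) \<one>\<^bsub>A\<^esub> g"
    using g by (simp add: sum_coset A_scl A_one)
qed (auto intro!: A.sum_in A.scl_in ind_in)

text \<open>The unnormalized transfer from \<open>A\<close> to the invariants of \<open>F\<close>;
  it is a bimodule map over them.\<close>

definition Nm :: "('g \<Rightarrow> 'g \<Rightarrow> 'k) \<Rightarrow> 'g \<Rightarrow> 'g \<Rightarrow> 'k" where
  "Nm f = (\<Sum>n\<in>F. translate G n f)"

lemma linear_map_Nm: "linear_map A A Nm"
  unfolding Nm_def by (intro linear_map_lincomb A.lspace_axioms linear_map_translate) simp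

lemma Nm_in: "f \<in> carrier A \<Longrightarrow> Nm f \<in> carrier A"
  using linear_mapD(1)[OF linear_map_Nm] .

lemma Nm_fixed: "f \<in> carrier A \<Longrightarrow> Nm f \<in> fixed F"
  using Nm_in sum_act_subgroup[OF F_subgroup] by (auto simp: fixed_def Nm_def)

lemma Nm_mult:
  assumes "f \<in> fixed F" "x \<in> carrier A"
  shows "f \<otimes>\<^bsub>A\<^esub> Nm x = Nm (f \<otimes>\<^bsub>A\<^esub> x)" "Nm x \<otimes>\<^bsub>A\<^esub> f = Nm (x \<otimes>\<^bsub>A\<^esub> f)"
  using assms by (auto simp: fixed_def Nm_def A.mult_sum_right A.mult_sum_left translate_in translate_mult
      intro!: sum.cong)

text \<open>Conjugation by \<open>g\<close> permutes the normal subgroup \<open>F\<close>.\<close>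

lemma translate_Nm:
  assumes "g \<in> carrier G" "x \<in> carrier A"
  shows "translate G g (Nm x) = Nm (translate G g x)"
proof -
  have "translate G g (Nm x) = (\<Sum>n\<in>F. translate G (g \<otimes> n) x)"
    unfolding Nm_def using assms
    by (subst linear_map_sum[OF linear_map_translate A.lspace_axioms]) (auto simp: translate_in translate_translate)
  also have "\<dots> = (\<Sum>n\<in>F. translate G (g \<otimes> n \<otimes> inv g) (translate G g x))"
    using assms by (intro sum.cong) (auto simp: translate_translate G.m_assoc)
  also have "\<dots> = (\<Sum>n\<in>F. translate G n (translate G g x))"
  proof (rule sum.reindex_bij_betw)
    show "bij_betw (\<lambda>n. g \<otimes> n \<otimes> inv g) F F"
      by (rule bij_betwI[where g = "\<lambda>n. inv g \<otimes> n \<otimes> g"])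
        (use assms(1) F_normal F_normal' in \<open>auto simp: G.m_assoc\<close>,
         use assms(1) in \<open>simp_all add: G.m_assoc[symmetric]\<close>)
  qed
  finally show ?thesis by (simp add: Nm_def)
qed

definition z :: "'g \<Rightarrow> ('g \<Rightarrow> 'k) \<Rightarrow> 'g \<Rightarrow> 'g \<Rightarrow> 'k" where
  "z r b = Nm (ind r b)"

lemma linear_map_z: "r \<in> carrier G \<Longrightarrow> linear_map T A (z r)"
  unfolding z_def by (rule linear_map_comp[OF linear_map_ind linear_map_Nm])

lemma z_fixed: "r \<in> carrier G \<Longrightarrow> b \<in> carrier T \<Longrightarrow> z r b \<in> fixed F"
  unfolding z_def by (intro Nm_fixed ind_in)

lemma z_in: "r \<in> carrier G \<Longrightarrow> b \<in> carrier T \<Longrightarrow> z r b \<in> carrier A"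
  unfolding z_def by (intro Nm_in ind_in)

lemma z_apply: "g \<in> carrier G \<Longrightarrow> r \<in> carrier G \<Longrightarrow>
    z r b g = (\<Sum>n\<in>F. if g \<otimes> n \<otimes> inv r \<in> S then cj (g \<otimes> n \<otimes> inv r) b else 0)"
  by (simp add: z_def Nm_def sum_apply translate_apply ind_apply)

text \<open>Three multiplicities are divided out: \<open>card S\<close> from the sum of
  \<open>X v \<cdot> XI v\<close>, another \<open>card S\<close> because each coset
  \<open>S r\<close> is counted once for each of its elements, and \<open>card F\<close> from the
  transfer of the unit.\<close>

definition \<kappa> :: 'k where
  "\<kappa> = inverse (of_nat (card S) * of_nat (card S) * of_nat (card F))"

text \<open>The Casimir element of \<open>k\<^sub>\<alpha>S\<close>, placed on the cosets of
  \<open>S\<close> and transferred to \<open>F\<close>-invariants in both factors. Summing over all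
  \<open>r\<close> in \<open>G\<close> rather than over coset representatives lets translations
  simply permute the summands.\<close>

definition e :: "('k, 'g \<Rightarrow> 'g \<Rightarrow> 'k, 'g \<Rightarrow> 'g \<Rightarrow> 'k) tensor" where
  "e = fun_scl \<kappa> (\<Sum>r\<in>carrier G. \<Sum>v\<in>S. tens A A (z r (X v)) (z r (XI v)))"

lemma tens_z_in: "r \<in> carrier G \<Longrightarrow> v \<in> S \<Longrightarrow> tens A A (z r (X v)) (z r (XI v)) \<in> AA"
  by (intro tens_in z_in) simp_all

lemma e_sum_in: "(\<Sum>r\<in>carrier G. \<Sum>v\<in>S. tens A A (z r (X v)) (z r (XI v))) \<in> AA"
  by (intro tensor_sum_in tens_z_in)

lemma linear_map_e:
  assumes "linear_map (tensor A A) V f"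
  shows "f e = scl V \<kappa> (\<Sum>r\<in>carrier G. \<Sum>v\<in>S. f (tens A A (z r (X v)) (z r (XI v))))"
proof -
  have "f e = scl V \<kappa> (f (\<Sum>r\<in>carrier G. \<Sum>v\<in>S. tens A A (z r (X v)) (z r (XI v))))"
    unfolding e_def using linear_mapD(3)[OF assms] e_sum_in by simp
  also have "f (\<Sum>r\<in>carrier G. \<Sum>v\<in>S. tens A A (z r (X v)) (z r (XI v)))
    = (\<Sum>r\<in>carrier G. f (\<Sum>v\<in>S. tens A A (z r (X v)) (z r (XI v))))"
    by (rule linear_map_sum[OF assms lspace_tensor]) (simp add: tensor_sum_in tens_z_in)
  also have "\<dots> = (\<Sum>r\<in>carrier G. \<Sum>v\<in>S. f (tens A A (z r (X v)) (z r (XI v))))"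
    by (intro sum.cong refl linear_map_sum[OF assms lspace_tensor]) (simp add: tens_z_in)
  finally show ?thesis .
qed

lemma z_casimir:
  assumes "r \<in> carrier G" "b \<in> carrier T"
  shows "(\<Sum>v\<in>S. tens A A (z r (b \<cdot> X v)) (z r (XI v))) = (\<Sum>v\<in>S. tens A A (z r (X v)) (z r (XI v \<cdot> b)))"
    "(\<Sum>v\<in>S. tens A A (z r (X v)) (z r (XI v))) = (\<Sum>v\<in>S. tens A A (z r (XI v)) (z r (X v)))"
proof -
  let ?m = "tmap T T A A (z r) (z r)"
  note lin = linear_map_tmap[OF lspace_T lspace_T linear_map_z[OF assms(1)] linear_map_z[OF assms(1)]]
  have m: "?m (\<Sum>v\<in>S. tens T T (p v) (q v)) = (\<Sum>v\<in>S. tens A A (z r (p v)) (z r (q v)))"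
    if "\<And>v. v \<in> S \<Longrightarrow> p v \<in> carrier T" "\<And>v. v \<in> S \<Longrightarrow> q v \<in> carrier T" for p q
    using that assms(1)
    by (subst linear_map_sum[OF lin lspace_tensor])
      (auto simp: tens_in tmap_tens[OF lspace_T lspace_T linear_map_z linear_map_z] intro!: sum.cong)
  show "(\<Sum>v\<in>S. tens A A (z r (b \<cdot> X v)) (z r (XI v))) = (\<Sum>v\<in>S. tens A A (z r (X v)) (z r (XI v \<cdot> b)))"
    using arg_cong[OF casimir[OF assms(2)], of ?m] assms(2) by (simp add: m)
  show "(\<Sum>v\<in>S. tens A A (z r (X v)) (z r (XI v))) = (\<Sum>v\<in>S. tens A A (z r (XI v)) (z r (X v)))"
    using arg_cong[OF casimir_sym, of ?m] by (simp add: m)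
qed

lemma fixed_in: "f \<in> fixed F \<Longrightarrow> f \<in> carrier A"
  by (simp add: fixed_def)

lemma z_mult:
  assumes "r \<in> carrier G" "b \<in> carrier T" "f \<in> fixed F"
  shows "f \<otimes>\<^bsub>A\<^esub> z r b = z r (f r \<cdot> b)" "z r b \<otimes>\<^bsub>A\<^esub> f = z r (b \<cdot> f r)"
  using assms fixed_in[OF assms(3)]
  by (simp_all add: z_def Nm_mult ind_in ind_mult_left ind_mult_right)

text \<open>An invariant \<open>f\<close> multiplies \<open>z r b\<close> through its value at
  \<open>r\<close>, which reduces the claim to the Casimir identity in
  \<open>k\<^sub>\<alpha>S\<close>.\<close>

lemma e_casimir:
  assumes f: "f \<in> fixed F"
  shows "tens A A f \<one>\<^bsub>A\<^esub> \<star> e = tens A A \<one>\<^bsub>A\<^esub> f \<star> e"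
proof -
  have fA: "f \<in> carrier A" using f by (rule fixed_in)
  have t: "tens A A f \<one>\<^bsub>A\<^esub> \<in> AA" "tens A A \<one>\<^bsub>A\<^esub> f \<in> AA"
    using fA by (simp_all add: tens_in)
  have "(\<Sum>v\<in>S. tens A A f \<one>\<^bsub>A\<^esub> \<star> tens A A (z r (X v)) (z r (XI v)))
    = (\<Sum>v\<in>S. tens A A \<one>\<^bsub>A\<^esub> f \<star> tens A A (z r (X v)) (z r (XI v)))" if r: "r \<in> carrier G" for r
    using z_casimir(1)[OF r, of "f r"] r f fA by (simp add: E_mult_tens z_in z_mult)
  then show ?thesis
    unfolding linear_map_e[OF linear_map_E_left[OF t(1)]] linear_map_e[OF linear_map_E_left[OF t(2)]]
    by (simp cong: sum.cong)
qed

lemma e_flip: "flip e = e"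
proof -
  have "(\<Sum>v\<in>S. flip (tens A A (z r (X v)) (z r (XI v)))) = (\<Sum>v\<in>S. tens A A (z r (X v)) (z r (XI v)))"
    if r: "r \<in> carrier G" for r
    using z_casimir(2)[OF r T.one_closed] r by (simp add: flip_tens z_in)
  then show ?thesis
    unfolding linear_map_e[OF linear_map_flip] by (simp add: e_def cong: sum.cong)
qed

lemma e_in_fixed: "e \<in> tensor_carrier (A\<lparr>carrier := fixed F\<rparr>) (A\<lparr>carrier := fixed F\<rparr>)"
  unfolding e_def
proof (intro tensor_scl_in tensor_sum_in)
  fix r v assume "r \<in> carrier G" "v \<in> S"
  then show "tens A A (z r (X v)) (z r (XI v)) \<in> tensor_carrier (A\<lparr>carrier := fixed F\<rparr>) (A\<lparr>carrier := fixed F\<rparr>)"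
    using tens_in[of "z r (X v)" "A\<lparr>carrier := fixed F\<rparr>" "z r (XI v)" "A\<lparr>carrier := fixed F\<rparr>"]
    by (simp add: z_fixed tens_carrier_update)
qed

lemma e_in_A: "e \<in> AA"
  unfolding e_def by (intro tensor_scl_in e_sum_in)

lemma e_inv: "inv_tensor e"
  unfolding inv_tensor_def
proof (intro conjI ballI e_in_A)
  fix g assume g: "g \<in> carrier G"
  have zt: "translate G g (z r b) = z (r \<otimes> inv g) b" if "r \<in> carrier G" "b \<in> carrier T" for r b
    using that g by (simp add: z_def translate_Nm ind_in translate_ind)
  have "(\<Sum>r\<in>carrier G. \<Sum>v\<in>S. act2 g g (tens A A (z r (X v)) (z r (XI v))))
    = (\<Sum>r\<in>carrier G. \<Sum>v\<in>S. tens A A (z (r \<otimes> inv g) (X v)) (z (r \<otimes> inv g) (XI v)))"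
    using g by (intro sum.cong) (auto simp: act2_tens z_in zt)
  also have "\<dots> = (\<Sum>r\<in>carrier G. \<Sum>v\<in>S. tens A A (z r (X v)) (z r (XI v)))"
    using g by (intro sum_translate[OF G.subgroup_self, of _ "\<lambda>r. \<Sum>v\<in>S. tens A A (z r (X v)) (z r (XI v))"]) simp
  finally show "act2 g g e = e"
    unfolding linear_map_e[OF linear_map_act2[OF g g]] by (simp add: e_def)
qed

abbreviation "N \<equiv> S \<inter> F"

lemma N_subgroup: "subgroup N G"
  using S F_subgroup by (rule G.subgroups_Inter_pair)

lemma conj_F_iff: "\<lbrakk>n \<in> carrier G; g \<in> carrier G\<rbrakk> \<Longrightarrow> g \<otimes> n \<otimes> inv g \<in> F \<longleftrightarrow> n \<in> F"
proof
  assume a: "n \<in> carrier G" "g \<in> carrier G" "g \<otimes> n \<otimes> inv g \<in> F"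
  from F_normal'[OF a(3) a(2)] show "n \<in> F"
    using a by (simp add: G.m_assoc[symmetric]) (simp add: G.m_assoc)
qed (rule F_normal)

lemma sum_F_conj:
  assumes "r \<in> carrier G"
  shows "(\<Sum>n\<in>F. f (r \<otimes> n \<otimes> inv r)) = (\<Sum>n\<in>F. f n)"
proof (rule sum.reindex_bij_betw)
  show "bij_betw (\<lambda>n. r \<otimes> n \<otimes> inv r) F F"
    by (rule bij_betwI[where g = "\<lambda>n. inv r \<otimes> n \<otimes> r"])
      (use assms(1) F_normal F_normal' in \<open>auto simp: G.m_assoc\<close>,
       use assms(1) in \<open>simp_all add: G.m_assoc[symmetric]\<close>)
qed

lemma z_self:
  assumes "r \<in> carrier G"
  shows "z r b r = (\<Sum>w\<in>N. cj w b)"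
proof -
  have "z r b r = (\<Sum>n\<in>F. if n \<in> S then cj n b else 0)"
    using sum_F_conj[OF assms, of "\<lambda>n. if n \<in> S then cj n b else 0"] assms by (simp add: z_apply)
  also have "\<dots> = (\<Sum>w\<in>N. cj w b)"
    using finite_F by (simp add: sum.inter_restrict[symmetric] Int_commute)
  finally show ?thesis .
qed

lemma e_one: "multiply e = \<one>\<^bsub>A\<^esub>"
proof -
  \<comment> \<open>Regrouped, the sum is the trace of \<open>X w\<close> times \<open>XI w\<close>,
    so of the terms in \<open>z_self\<close> only \<open>w = \<one>\<close> survives.\<close>
  have X_cj: "(\<Sum>v\<in>S. X v \<cdot> cj w (XI v)) = (if w = \<one> then fun_scl (of_nat (card S)) \<one>\<^bsub>T\<^esub> else 0)"
    if w: "w \<in> S" for w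
  proof (cases "w = \<one>")
    case True
    have "(\<Sum>v\<in>S. X v \<cdot> cj w (XI v)) = (\<Sum>v\<in>S. \<one>\<^bsub>T\<^esub>)"
      by (intro sum.cong) (simp_all add: True cj_id)
    then show ?thesis using True fs.sum_constant_scale[of "\<one>\<^bsub>T\<^esub>" S] by simp
  next
    case False
    have "(\<Sum>v\<in>S. X v \<cdot> cj w (XI v)) = (\<Sum>v\<in>S. cj v (X w) \<cdot> XI w)"
      using w by (intro sum.cong) (simp_all add: cj_def T.m_assoc)
    also have "\<dots> = fun_scl (tr (X w)) \<one>\<^bsub>T\<^esub> \<cdot> XI w"
      using w by (simp add: T.mult_sum_left[symmetric] sum_cj)
    also have "\<dots> = 0"
      using w False T.mult_zero_left[of "XI w"] by (simp add: tr_X)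
    finally show ?thesis using False by simp
  qed
  have "(\<Sum>v\<in>S. multiply (tens A A (z r (X v)) (z r (XI v)))) = scl A (of_nat (card S)) (Nm (ind r \<one>\<^bsub>T\<^esub>))"
    if r: "r \<in> carrier G" for r
  proof -
    have "(\<Sum>v\<in>S. multiply (tens A A (z r (X v)) (z r (XI v)))) = (\<Sum>v\<in>S. z r (X v \<cdot> z r (XI v) r))"
      using r by (intro sum.cong) (auto simp: multiply_tens z_in z_mult(2) z_fixed)
    also have "\<dots> = z r (\<Sum>v\<in>S. X v \<cdot> z r (XI v) r)"
      using r z_in by (subst linear_map_sum[OF linear_map_z lspace_T]) auto
    also have "(\<Sum>v\<in>S. X v \<cdot> z r (XI v) r) = (\<Sum>v\<in>S. \<Sum>w\<in>N. X v \<cdot> cj w (XI v))"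
      unfolding z_self[OF r] by (intro sum.cong refl T.mult_sum_right) auto
    also have "\<dots> = (\<Sum>w\<in>N. if w = \<one> then fun_scl (of_nat (card S)) \<one>\<^bsub>T\<^esub> else 0)"
      by (subst sum.swap) (auto simp: X_cj intro!: sum.cong)
    also have "\<dots> = fun_scl (of_nat (card S)) \<one>\<^bsub>T\<^esub>"
      using finite_S subgroup.one_closed[OF N_subgroup] by (simp add: subgroup.one_closed[OF F_subgroup])
    also have "z r \<dots> = scl A (of_nat (card S)) (Nm (ind r \<one>\<^bsub>T\<^esub>))"
      using linear_mapD(3)[OF linear_map_z[OF r] T.one_closed] by (simp add: z_def)
    finally show ?thesis .
  qed
  then have "multiply e = scl A \<kappa> (\<Sum>r\<in>carrier G. scl A (of_nat (card S)) (Nm (ind r \<one>\<^bsub>T\<^esub>)))"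
    unfolding linear_map_e[OF linear_map_multiply] by (simp cong: sum.cong)
  also have "\<dots> = scl A \<kappa> (scl A (of_nat (card S)) (Nm (\<Sum>r\<in>carrier G. ind r \<one>\<^bsub>T\<^esub>)))"
    by (subst linear_map_sum[OF linear_map_Nm A.lspace_axioms]) (auto simp: ind_in A.vs.scale_sum_right)
  also have "Nm (\<Sum>r\<in>carrier G. ind r \<one>\<^bsub>T\<^esub>) = scl A (of_nat (card S)) (Nm \<one>\<^bsub>A\<^esub>)"
    unfolding sum_ind_one by (rule linear_mapD(3)[OF linear_map_Nm A.one_closed])
  also have "Nm \<one>\<^bsub>A\<^esub> = scl A (of_nat (card F)) \<one>\<^bsub>A\<^esub>"
    unfolding Nm_def using A.vs.sum_constant_scale[of "\<one>\<^bsub>A\<^esub>" F] by (simp add: translate_one cong: sum.cong del: sum_constant)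
  also have "scl A \<kappa> (scl A (of_nat (card S)) (scl A (of_nat (card S)) (scl A (of_nat (card F)) \<one>\<^bsub>A\<^esub>)))
    = scl A (\<kappa> * (of_nat (card S) * of_nat (card S) * of_nat (card F))) \<one>\<^bsub>A\<^esub>"
    by (simp add: mult.assoc)
  also have "\<kappa> * (of_nat (card S) * of_nat (card S) * of_nat (card F)) = 1"
    unfolding \<kappa>_def by (rule left_inverse) (use card_S card_F in simp)
  finally show ?thesis by simp
qed

sublocale galois_integral L A \<delta> Bs crd G "translate G" F M e
proof (intro galois_integral.intro galois_integral_axioms.intro galois_action_axioms)
  show "left_galois_object (L\<lparr>carrier := M\<rparr>) (A\<lparr>carrier := fixed F\<rparr>) \<delta>"
    using sub_galois by (simp only: fixed_def)
qed (fact F_subgroup M_hopf e_in_fixed e_casimir e_one e_flip e_inv)+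

end

section \<open>The action on the twisted group algebra\<close>

context galois_normality
begin

text \<open>Evaluation of the two factors at \<open>g\<close> and \<open>h\<close> makes
  \<open>k\<^sub>\<alpha>S\<close> a module over \<open>A \<otimes> A\<^sup>o\<^sup>p\<close>;
  \<open>ops_mult\<close> is the module law.\<close>

definition ops :: "'g \<Rightarrow> 'g \<Rightarrow> ('k, 'g \<Rightarrow> 'g \<Rightarrow> 'k, 'g \<Rightarrow> 'g \<Rightarrow> 'k) tensor \<Rightarrow> ('g \<Rightarrow> 'k) \<Rightarrow> 'g \<Rightarrow> 'k" where
  "ops g h t b = tlift A A (\<lambda>p q. p g \<cdot> b \<cdot> q h) t"

lemma ops_bilinear:
  assumes "g \<in> carrier G" "h \<in> carrier G" "b \<in> carrier T"
  shows "bilinear_on A A fun_scl (\<lambda>p q. p g \<cdot> b \<cdot> q h)"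
  using assms T.mult_scl_left T.mult_scl_right T.mult_add_left T.mult_add_right
  by (intro bilinear_onI) (simp_all add: vector_space_fun_scl plus_fun_apply A_scl)

lemma linear_map_ops:
  assumes "g \<in> carrier G" "h \<in> carrier G" "b \<in> carrier T"
  shows "linear_map (tensor A A) T (\<lambda>t. ops g h t b)"
  unfolding ops_def using assms ops_bilinear[OF assms]
  by (intro linear_map_tlift) (simp_all add: A.lspace_axioms lspace_T)

lemma ops_tens:
  "\<lbrakk>g \<in> carrier G; h \<in> carrier G; b \<in> carrier T; p \<in> carrier A; q \<in> carrier A\<rbrakk> \<Longrightarrow>
    ops g h (tens A A p q) b = p g \<cdot> b \<cdot> q h"
  unfolding ops_def by (rule tlift_tens[OF A.lspace_axioms A.lspace_axioms ops_bilinear])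

lemma ops_in: "\<lbrakk>g \<in> carrier G; h \<in> carrier G; b \<in> carrier T; t \<in> AA\<rbrakk> \<Longrightarrow> ops g h t b \<in> carrier T"
  using linear_mapD(1)[OF linear_map_ops] by simp

lemma linear_map_ops_arg:
  assumes "g \<in> carrier G" "h \<in> carrier G" "t \<in> AA"
  shows "linear_map T T (ops g h t)"
  using A.lspace_axioms A.lspace_axioms assms(3)
proof (induction rule: tensor_induct)
  case (tens p q)
  have "linear_map T T (\<lambda>b. p g \<cdot> b \<cdot> q h)"
    by (rule linear_map_comp[OF T.linear_mult_left T.linear_mult_right]) (use tens assms in auto)
  then show ?case
    by (rule linear_map_cong[OF _ lspace_T]) (use tens assms in \<open>simp add: ops_tens\<close>)
next
  case (add t u)
  then have "linear_map T T (\<lambda>b. ops g h t b + ops g h u b)"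
    using T.add_in by (auto simp: linear_map_def fs.scale_right_distrib)
  then show ?case
    by (rule linear_map_cong[OF _ lspace_T])
      (use add assms linear_mapD(2)[OF linear_map_ops] in simp)
qed

lemma ops_mult:
  assumes gh: "g \<in> carrier G" "h \<in> carrier G" and t: "t \<in> AA" and u: "u \<in> AA"
    and b: "b \<in> carrier T"
  shows "ops g h (t \<star> u) b = ops g h t (ops g h u b)"
proof (rule AA_eqI[where f = "\<lambda>t. ops g h (t \<star> u) b", OF
      linear_map_comp[OF linear_map_E_right[OF u] linear_map_ops[OF gh b]] linear_map_ops[OF gh ops_in[OF gh b u]] t])
  fix p q assume pq: "p \<in> carrier A" "q \<in> carrier A"
  then have t: "tens A A p q \<in> AA" by (simp add: tens_in)
  show "ops g h (tens A A p q \<star> u) b = ops g h (tens A A p q) (ops g h u b)"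
    by (rule AA_eqI[where f = "\<lambda>u. ops g h (tens A A p q \<star> u) b", OF
        linear_map_comp[OF linear_map_E_left[OF t] linear_map_ops[OF gh b]]
        linear_map_comp[OF linear_map_ops[OF gh b] linear_map_ops_arg[OF gh t]] u])
      (use pq gh b in \<open>simp add: E_mult_tens ops_tens A_mult T.m_assoc\<close>)
qed

lemma ops_act2:
  assumes "g \<in> carrier G" "h \<in> carrier G" "x \<in> carrier G" "t \<in> AA" "b \<in> carrier T"
  shows "ops g h (act2 x x t) b = ops (g \<otimes> x) (h \<otimes> x) t b"
  by (rule AA_eqI[where f = "\<lambda>t. ops g h (act2 x x t) b", OF
        linear_map_comp[OF linear_map_act2 linear_map_ops] linear_map_ops assms(4)])
    (use assms in \<open>auto simp: act2_tens ops_tens translate_in translate_apply\<close>)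

text \<open>For invariant tensors only the pair \<open>(g, h)\<close> up to simultaneous right
  translation matters. Together with \<open>ops_left\<close> this reduces the relevant pairs to
  those with \<open>g\<close> in \<open>F\<close> and \<open>h = \<one>\<close>.\<close>

lemma ops_inv:
  assumes "inv_tensor t" "g \<in> carrier G" "h \<in> carrier G" "x \<in> carrier G" "b \<in> carrier T"
  shows "ops (g \<otimes> x) (h \<otimes> x) t b = ops g h t b"
  using ops_act2[of g h x t b] assms by (simp add: inv_tensor_def)

lemma ops_cj:
  assumes "g \<in> carrier G" "h \<in> carrier G" "s \<in> S" "t \<in> AA" "b \<in> carrier T"
  shows "cj s (ops g h t b) = ops (s \<otimes> g) (s \<otimes> h) t (cj s b)"
  by (rule AA_eqI[where f = "\<lambda>t. cj s (ops g h t b)", OF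
        linear_map_comp[OF linear_map_ops linear_map_cj] linear_map_ops assms(4)])
    (use assms in \<open>auto simp: ops_tens cj_mult A_equivariant\<close>)

lemma ops_left:
  assumes "g \<in> carrier G" "h \<in> carrier G" "s \<in> S" "t \<in> AA" "b \<in> carrier T"
  shows "ops (s \<otimes> g) h t b = X s \<cdot> ops g h t (XI s \<cdot> b)"
  by (rule AA_eqI[where f = "\<lambda>t. ops (s \<otimes> g) h t b", OF
        linear_map_ops linear_map_comp[OF linear_map_ops T.linear_mult_left] assms(4)])
    (use assms in \<open>auto simp: ops_tens cj_def T.m_assoc A_equivariant\<close>)

text \<open>Suitable sums of the operators isolate the factor at \<open>h\<close>, weighted by a
  trace of the factor at \<open>g\<close>; the trace form is non-degenerate, so the coefficients of
  \<open>t\<close> in basis tensors can be recovered.\<close>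

lemma ops_eqI:
  assumes t: "t \<in> AA" and u: "u \<in> AA"
    and eq: "\<And>g h b. \<lbrakk>g \<in> carrier G; h \<in> carrier G; b \<in> carrier T\<rbrakk> \<Longrightarrow> ops g h t b = ops g h u b"
  shows "t = u"
proof -
  have lin_tr: "linear_map A T (\<lambda>q. q h)" if "h \<in> carrier G" for h
    using that by (rule linear_map_eval)
  \<comment> \<open>The sum encloses \<open>y \<cdot> p g\<close> between \<open>XI \<sigma>\<close>
    and \<open>X \<sigma>\<close>, which by \<open>sum_cj'\<close> gives its trace as a scalar in
    front of \<open>q h\<close>.\<close>
  have "(\<Sum>\<sigma>\<in>S. XI \<sigma> \<cdot> (y \<cdot> ops g h s (X \<sigma>))) = tlift A A (\<lambda>p q. scl A (tr (y \<cdot> p g)) q) s h"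
    if gh: "g \<in> carrier G" "h \<in> carrier G" and y: "y \<in> carrier T" and s: "s \<in> AA" for g h y s
  proof -
    have b: "bilinear_on A A (scl A) (\<lambda>p q. scl A (tr (y \<cdot> p g)) q)"
      using gh y linear_mapD(2,3)[OF linear_map_tr] T.mult_add_right T.mult_scl_right
      by (intro bilinear_onI) (simp_all add: A.ambient plus_fun_apply A_scl A.vs.scale_left_distrib
          A.vs.scale_right_distrib mult.commute)
    have r: "linear_map (tensor A A) A (tlift A A (\<lambda>p q. scl A (tr (y \<cdot> p g)) q))"
      by (rule linear_map_tlift) (auto simp: A.lspace_axioms b A.scl_in)
    show ?thesis
    proof (rule AA_eqI[OF _ linear_map_comp[OF r lin_tr[OF gh(2)]] s])
      show "linear_map (tensor A A) T (\<lambda>s. \<Sum>\<sigma>\<in>S. XI \<sigma> \<cdot> (y \<cdot> ops g h s (X \<sigma>)))"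
        by (intro linear_map_lincomb lspace_T lspace_tensor
            linear_map_comp[OF linear_map_comp[OF linear_map_ops T.linear_mult_left] T.linear_mult_left])
          (use gh y in auto)
      fix p q assume pq: "p \<in> carrier A" "q \<in> carrier A"
      have "(\<Sum>\<sigma>\<in>S. XI \<sigma> \<cdot> (y \<cdot> ops g h (tens A A p q) (X \<sigma>)))
        = (\<Sum>\<sigma>\<in>S. XI \<sigma> \<cdot> (y \<cdot> p g) \<cdot> X \<sigma>) \<cdot> q h"
        using gh y pq by (subst T.mult_sum_left) (auto simp: ops_tens T.m_assoc intro!: sum.cong)
      also have "\<dots> = fun_scl (tr (y \<cdot> p g)) (q h)"
        using gh y pq T.mult_scl_left[of "q h" "\<one>\<^bsub>T\<^esub>"] by (simp add: sum_cj')
      finally show "(\<Sum>\<sigma>\<in>S. XI \<sigma> \<cdot> (y \<cdot> ops g h (tens A A p q) (X \<sigma>)))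
        = tlift A A (\<lambda>p q. scl A (tr (y \<cdot> p g)) q) (tens A A p q) h"
        using pq by (simp add: tlift_tens[OF A.lspace_axioms A.lspace_axioms b] A_scl)
    qed
  qed
  then have slices: "tlift A A (\<lambda>p q. scl A (tr (y \<cdot> p g)) q) t h = tlift A A (\<lambda>p q. scl A (tr (y \<cdot> p g)) q) u h"
    if "g \<in> carrier G" "h \<in> carrier G" "y \<in> carrier T" for g h y
    using that t u eq by (metis (no_types, lifting) X_in sum.cong)
  obtain w where w: "t = (\<Sum>j\<in>Bs. \<Sum>k\<in>Bs. fun_scl (w j k) (tens A A j k))" using t by (rule tensor_basis_expand)
  obtain w' where w': "u = (\<Sum>j\<in>Bs. \<Sum>k\<in>Bs. fun_scl (w' j k) (tens A A j k))" using u by (rule tensor_basis_expand)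
  have "w j k = w' j k" if jk: "j \<in> Bs" "k \<in> Bs" for j k
  proof -
    have col: "(\<Sum>j\<in>Bs. scl A (w j k) j) = (\<Sum>j\<in>Bs. scl A (w' j k) j)" (is "?c w = ?c w'")
    proof (rule A_eqI)
      show c: "?c w \<in> carrier A" "?c w' \<in> carrier A" by (auto intro!: A.sum_in A.scl_in)
      fix g assume g: "g \<in> carrier G"
      have tr_eq: "tr (y \<cdot> ?c w g) = tr (y \<cdot> ?c w' g)" if y: "y \<in> carrier T" for y
      proof -
        let ?f = "\<lambda>p q. scl A (tr (y \<cdot> p g)) q"
        have b: "bilinear_on A A (scl A) ?f"
          using g y linear_mapD(2,3)[OF linear_map_tr] T.mult_add_right T.mult_scl_right
          by (intro bilinear_onI) (simp_all add: A.ambient plus_fun_apply A_scl A.vs.scale_left_distrib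
              A.vs.scale_right_distrib mult.commute)
        have r: "linear_map (tensor A A) A (tlift A A ?f)"
          by (rule linear_map_tlift) (auto simp: A.lspace_axioms b A.scl_in)
        have tu: "tlift A A ?f t = tlift A A ?f u"
          using linear_mapD(1)[OF r] t u g y by (intro A_eqI slices) auto
        have coeff: "crd k (tlift A A ?f (\<Sum>j\<in>Bs. \<Sum>k\<in>Bs. fun_scl (w j k) (tens A A j k))) = tr (y \<cdot> ?c w g)" for w
        proof -
          have r': "linear_map (tensor A A) base_field (\<lambda>t. crd k (tlift A A ?f t))"
            by (rule linear_map_comp[OF r crd_linear[OF jk(2)]])
          have "crd k (tlift A A ?f (\<Sum>j\<in>Bs. \<Sum>k\<in>Bs. fun_scl (w j k) (tens A A j k)))
            = (\<Sum>j\<in>Bs. \<Sum>k'\<in>Bs. w j k' * (tr (y \<cdot> j g) * crd k k'))"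
            by (subst linear_map_sum[OF r' lspace_tensor], force intro: tensor_sum_in tensor_scl_in tens_in,
                rule sum.cong[OF refl], subst linear_map_sum[OF r' lspace_tensor],
                force intro: tensor_sum_in tensor_scl_in tens_in,
                rule sum.cong[OF refl], subst linear_mapD(3)[OF r', simplified])
              (auto simp: tens_in tlift_tens[OF A.lspace_axioms A.lspace_axioms b] crd_scl jk)
          also have "\<dots> = (\<Sum>j\<in>Bs. \<Sum>k'\<in>Bs. if k = k' then w j k' * tr (y \<cdot> j g) else 0)"
            using jk by (intro sum.cong) (auto simp: crd_basis)
          also have "\<dots> = (\<Sum>j\<in>Bs. w j k * tr (y \<cdot> j g))"
            using jk finite_Bs by simp
          also have "\<dots> = tr (y \<cdot> ?c w g)"
          proof -
            have l: "linear_map A base_field (\<lambda>p. tr (y \<cdot> p g))"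
              using g y by (intro linear_map_comp[OF linear_map_comp[OF linear_map_eval T.linear_mult_left] linear_map_tr])
            show ?thesis
              by (subst linear_map_sum[OF l A.lspace_axioms]) (auto simp: A.scl_in linear_mapD(3)[OF l] intro!: sum.cong)
          qed
          finally show ?thesis .
        qed
        show ?thesis using tu coeff[of w, folded w] coeff[of w', folded w'] by simp
      qed
      \<comment> \<open>Expansion by means of the dual basis \<open>XI s\<close>, rescaled by
        \<open>card S\<close>: an element of \<open>T\<close> is determined by its traces against
        all \<open>y\<close>.\<close>
      have "x = (\<Sum>s\<in>S. fun_scl (tr (XI s \<cdot> x) / of_nat (card S)) (X s))" if x: "x \<in> carrier T" for x
      proof (rule linear_map_T_eq[where f = "\<lambda>x. x", OF _ _ _ x])
        have "linear_map T T (\<lambda>x. fun_scl (tr (XI s \<cdot> x) / of_nat (card S)) (X s))" if s: "s \<in> S" for s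
          using s linear_mapD(2,3)[OF linear_map_tr] T.mult_add_right[of "XI s"] T.mult_scl_right[of "XI s"] T.scl_in[of "X s"]
          by (simp add: linear_map_def add_divide_distrib fs.scale_left_distrib)
        then show "linear_map T T (\<lambda>x. \<Sum>s\<in>S. fun_scl (tr (XI s \<cdot> x) / of_nat (card S)) (X s))"
          by (intro linear_map_lincomb lspace_T)
        fix s assume s: "s \<in> S"
        have "(\<Sum>r\<in>S. fun_scl (tr (XI r \<cdot> X s) / of_nat (card S)) (X r)) = (\<Sum>r\<in>S. if r = s then X r else 0)"
          using s card_S by (intro sum.cong) (auto simp: tr_XI_X)
        then show "X s = (\<Sum>r\<in>S. fun_scl (tr (XI r \<cdot> X s) / of_nat (card S)) (X r))"
          using s finite_S by simp
      qed (simp add: linear_map_def)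
      from this[of "?c w g"] this[of "?c w' g"] show "?c w g = ?c w' g"
        using tr_eq g c by (simp cong: sum.cong)
    qed
    have entry: "crd j (?c w) = w j k" for w
      using jk finite_Bs
      by (subst linear_map_sum[OF crd_linear A.lspace_axioms])
        (auto simp: A.scl_in crd_scl crd_basis if_distrib[of "\<lambda>x. _ * x"] cong: if_cong)
    show ?thesis using arg_cong[OF col, of "crd j"] by (simp only: entry)
  qed
  then show ?thesis unfolding w w' by (simp cong: sum.cong)
qed

text \<open>The coset is \<open>g F h\<^sup>-\<^sup>1\<close>, cut down to \<open>S\<close> by the
  support of \<open>b\<close>.\<close>

definition Rst :: "'g \<Rightarrow> 'g \<Rightarrow> ('g \<Rightarrow> 'k) \<Rightarrow> 'g \<Rightarrow> 'k" where
  "Rst g h b = (\<lambda>s. if inv g \<otimes> s \<otimes> h \<in> F then b s else 0)"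

lemma linear_map_Rst: "linear_map T T (Rst g h)"
  by (auto simp: linear_map_def Rst_def T_simps(1) plus_fun_apply fun_scl_apply fun_eq_iff)

lemma Rst_X: "Rst g h (X u) = (if inv g \<otimes> u \<otimes> h \<in> F then X u else 0)"
  by (auto simp: Rst_def delta_def fun_eq_iff zero_fun_apply)

lemma F_cancel: "\<lbrakk>x \<in> carrier G; n \<in> F\<rbrakk> \<Longrightarrow> x \<otimes> n \<in> F \<longleftrightarrow> x \<in> F"
proof
  assume a: "x \<in> carrier G" "n \<in> F" "x \<otimes> n \<in> F"
  have "x \<otimes> n \<otimes> inv n \<in> F"
    by (rule subgroup.m_closed[OF F_subgroup a(3) subgroup.m_inv_closed[OF F_subgroup a(2)]])
  also have "x \<otimes> n \<otimes> inv n = x" using a by (simp add: G.m_assoc)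
  finally show "x \<in> F" .
qed (use F_subgroup in \<open>auto intro: subgroup.m_closed\<close>)

text \<open>On \<open>k\<^sub>\<alpha>S\<close> the integral acts by restriction to a coset of \<open>F\<close>.\<close>

lemma ops_e:
  assumes gh: "g \<in> carrier G" "h \<in> carrier G" and b: "b \<in> carrier T"
  shows "ops g h e b = Rst g h b"
proof (rule linear_map_T_eq[OF linear_map_ops_arg[OF gh e_in_A] linear_map_Rst _ b])
  fix u assume u: "u \<in> S"
  let ?a = "\<lambda>n r. g \<otimes> n \<otimes> inv r" and ?b = "\<lambda>n r. h \<otimes> n \<otimes> inv r"
  let ?m = "inv g \<otimes> u \<otimes> h"
  have m: "?m \<in> carrier G" using gh u by simp
  let ?I = "\<lambda>w. w \<in> S"
  have inner: "(\<Sum>v\<in>S. ops g h (tens A A (z r (X v)) (z r (XI v))) (X u))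
    = (\<Sum>n2\<in>F. \<Sum>n1\<in>F. if n1 = ?m \<otimes> n2 then (if ?b n2 r \<in> S then fun_scl (of_nat (card S)) (X u) else 0) else 0)"
    if r: "r \<in> carrier G" for r
  proof -
    have "ops g h (tens A A (z r (X v)) (z r (XI v))) (X u) =
      (\<Sum>n2\<in>F. \<Sum>n1\<in>F. if ?a n1 r \<in> S \<and> ?b n2 r \<in> S then cj (?a n1 r) (X v) \<cdot> X u \<cdot> cj (?b n2 r) (XI v) else 0)"
      if v: "v \<in> S" for v
    proof -
      have in1: "(if ?a n r \<in> S then cj (?a n r) (X v) else 0) \<in> carrier T" for n
        using v T.zero_in by simp
      have in2: "(if ?b n r \<in> S then cj (?b n r) (XI v) else 0) \<in> carrier T" for n
        using v T.zero_in by simp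
      have "ops g h (tens A A (z r (X v)) (z r (XI v))) (X u)
        = (\<Sum>n\<in>F. if ?a n r \<in> S then cj (?a n r) (X v) else 0) \<cdot> X u \<cdot> (\<Sum>n\<in>F. if ?b n r \<in> S then cj (?b n r) (XI v) else 0)"
        using gh u v r by (simp add: ops_tens z_in z_apply)
      also have "\<dots> = (\<Sum>n2\<in>F. \<Sum>n1\<in>F. (if ?a n1 r \<in> S then cj (?a n1 r) (X v) else 0) \<cdot> X u \<cdot> (if ?b n2 r \<in> S then cj (?b n2 r) (XI v) else 0))"
        using in1 in2 u by (simp only: T.mult_sum_left T.mult_sum_right T.m_closed T.sum_in X_in)
      also have "\<dots> = (\<Sum>n2\<in>F. \<Sum>n1\<in>F. if ?a n1 r \<in> S \<and> ?b n2 r \<in> S then cj (?a n1 r) (X v) \<cdot> X u \<cdot> cj (?b n2 r) (XI v) else 0)"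
        using u v by (intro sum.cong refl) (auto simp: T.mult_zero_left T.mult_zero_right T.zero_in)
      finally show ?thesis .
    qed
    then have "(\<Sum>v\<in>S. ops g h (tens A A (z r (X v)) (z r (XI v))) (X u))
      = (\<Sum>v\<in>S. \<Sum>n2\<in>F. \<Sum>n1\<in>F. if ?a n1 r \<in> S \<and> ?b n2 r \<in> S then cj (?a n1 r) (X v) \<cdot> X u \<cdot> cj (?b n2 r) (XI v) else 0)"
      by simp
    also have "\<dots> = (\<Sum>n2\<in>F. \<Sum>n1\<in>F. \<Sum>v\<in>S. if ?a n1 r \<in> S \<and> ?b n2 r \<in> S then cj (?a n1 r) (X v) \<cdot> X u \<cdot> cj (?b n2 r) (XI v) else 0)"
      by (subst sum.swap, rule sum.cong[OF refl], rule sum.swap)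
    also have "\<dots> = (\<Sum>n2\<in>F. \<Sum>n1\<in>F. if n1 = ?m \<otimes> n2 then (if ?b n2 r \<in> S then fun_scl (of_nat (card S)) (X u) else 0) else 0)"
    proof (intro sum.cong refl)
      fix n2 n1 assume n: "n2 \<in> F" "n1 \<in> F"
      \<comment> \<open>\<open>tr_dual\<close> will ask for \<open>w = u \<otimes> w'\<close>. For
        \<open>w = ?a n1 r\<close> and \<open>w' = ?b n2 r\<close> this determines \<open>n1\<close>
        from \<open>n2\<close>, whatever \<open>r\<close> is.\<close>
      have iff: "?a n1 r = u \<otimes> ?b n2 r \<longleftrightarrow> n1 = ?m \<otimes> n2"
      proof
        assume "?a n1 r = u \<otimes> ?b n2 r"
        then have "inv g \<otimes> ?a n1 r \<otimes> r = inv g \<otimes> (u \<otimes> ?b n2 r) \<otimes> r" by simp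
        moreover have "inv g \<otimes> ?a n1 r \<otimes> r = n1"
          using gh r n G.inv_solve_left[of "n1" g "g \<otimes> n1"] by (simp add: G.m_assoc)
        moreover have "inv g \<otimes> (u \<otimes> ?b n2 r) \<otimes> r = ?m \<otimes> n2"
          using gh r n u by (simp add: G.m_assoc)
        ultimately show "n1 = ?m \<otimes> n2" by simp
      next
        assume n1: "n1 = ?m \<otimes> n2"
        have "g \<otimes> (?m \<otimes> n2) = u \<otimes> h \<otimes> n2"
          using gh n u by (simp add: G.m_assoc[symmetric])
        then show "?a n1 r = u \<otimes> ?b n2 r"
          unfolding n1 using gh r n u by (simp add: G.m_assoc)
      qed
      show "(\<Sum>v\<in>S. if ?a n1 r \<in> S \<and> ?b n2 r \<in> S then cj (?a n1 r) (X v) \<cdot> X u \<cdot> cj (?b n2 r) (XI v) else 0)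
        = (if n1 = ?m \<otimes> n2 then (if ?b n2 r \<in> S then fun_scl (of_nat (card S)) (X u) else 0) else 0)"
      proof (cases "?a n1 r \<in> S \<and> ?b n2 r \<in> S")
        case True
        define w where "w = ?a n1 r"
        define w' where "w' = ?b n2 r"
        have wS: "w \<in> S" "w' \<in> S" using True by (auto simp: w_def w'_def)
        \<comment> \<open>Unfolding both conjugations shows \<open>v\<close> conjugating
          \<open>XI w \<cdot> X u \<cdot> X w'\<close>, so the sum over \<open>v\<close> is a
          trace.\<close>
        have "(\<Sum>v\<in>S. cj w (X v) \<cdot> X u \<cdot> cj w' (XI v)) = (\<Sum>v\<in>S. X w \<cdot> cj v (XI w \<cdot> X u \<cdot> X w') \<cdot> XI w')"
          using wS u by (intro sum.cong) (simp_all add: cj_def T.m_assoc)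
        also have "\<dots> = X w \<cdot> (\<Sum>v\<in>S. cj v (XI w \<cdot> X u \<cdot> X w')) \<cdot> XI w'"
          using wS u by (subst T.mult_sum_right, simp, simp, subst T.mult_sum_left) simp_all
        also have "\<dots> = fun_scl (tr (XI w \<cdot> X u \<cdot> X w')) (X w \<cdot> XI w')"
          using wS u T.mult_scl_right[of "X w" "\<one>\<^bsub>T\<^esub>"] T.mult_scl_left[of "XI w'" "X w"] by (simp add: sum_cj)
        also have "\<dots> = (if w = u \<otimes> w' then fun_scl (of_nat (card S)) (X u) else 0)"
          using u wS by (rule tr_dual)
        finally show ?thesis
          using True wS iff by (simp add: w_def w'_def)
      next
        case False
        have "n1 = ?m \<otimes> n2 \<Longrightarrow> ?b n2 r \<in> S \<Longrightarrow> ?a n1 r \<in> S"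
          using iff u by simp
        with False show ?thesis by auto
      qed
    qed
    finally show ?thesis .
  qed
  have "ops g h e (X u) = fun_scl \<kappa> (\<Sum>r\<in>carrier G. \<Sum>v\<in>S. ops g h (tens A A (z r (X v)) (z r (XI v))) (X u))"
    using linear_map_e[OF linear_map_ops[OF gh X_in[OF u]]] by simp
  also have "(\<Sum>r\<in>carrier G. \<Sum>v\<in>S. ops g h (tens A A (z r (X v)) (z r (XI v))) (X u))
    = (\<Sum>r\<in>carrier G. \<Sum>n2\<in>F. if ?m \<in> F then (if ?b n2 r \<in> S then fun_scl (of_nat (card S)) (X u) else 0) else 0)"
  proof (rule sum.cong[OF refl])
    fix r assume r: "r \<in> carrier G"
    show "(\<Sum>v\<in>S. ops g h (tens A A (z r (X v)) (z r (XI v))) (X u))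
      = (\<Sum>n2\<in>F. if ?m \<in> F then (if ?b n2 r \<in> S then fun_scl (of_nat (card S)) (X u) else 0) else 0)"
      unfolding inner[OF r]
    proof (rule sum.cong[OF refl])
      fix n2 assume "n2 \<in> F"
      \<comment> \<open>The prescribed value of \<open>n1\<close> lies in \<open>F\<close> exactly
        when \<open>?m\<close> does.\<close>
      from F_cancel[OF m this] finite_F
      show "(\<Sum>n1\<in>F. if n1 = ?m \<otimes> n2 then (if ?b n2 r \<in> S then fun_scl (of_nat (card S)) (X u) else 0) else 0)
        = (if ?m \<in> F then (if ?b n2 r \<in> S then fun_scl (of_nat (card S)) (X u) else 0) else 0)"
        by (simp only: sum.delta)
    qed
  qed
  \<comment> \<open>The sum over \<open>r\<close> now counts a coset of \<open>S\<close> and gives a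
    second \<open>card S\<close>, the sum over \<open>n2\<close> gives \<open>card F\<close>;
    together with the \<open>card S\<close> from \<open>tr_dual\<close> they cancel
    \<open>\<kappa>\<close>.\<close>
  also have "\<dots> = (\<Sum>n2\<in>F. \<Sum>r\<in>carrier G. if ?m \<in> F then (if ?b n2 r \<in> S then fun_scl (of_nat (card S)) (X u) else 0) else 0)"
    by (rule sum.swap)
  also have "\<dots> = (\<Sum>n2\<in>F. if ?m \<in> F then fun_scl (of_nat (card S)) (fun_scl (of_nat (card S)) (X u)) else 0)"
    using gh by (intro sum.cong) (auto simp: sum_coset simp del: fs.scale_scale)
  also have "\<dots> = fun_scl (of_nat (card F)) (if ?m \<in> F then fun_scl (of_nat (card S)) (fun_scl (of_nat (card S)) (X u)) else 0)"
    by (rule fs.sum_constant_scale)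
  also have "fun_scl \<kappa> \<dots> = (if ?m \<in> F then fun_scl (\<kappa> * (of_nat (card S) * of_nat (card S) * of_nat (card F))) (X u) else 0)"
    by (simp add: mult_ac)
  also have "\<kappa> * (of_nat (card S) * of_nat (card S) * of_nat (card F)) = 1"
    unfolding \<kappa>_def by (rule left_inverse) (use card_S card_F in simp)
  finally show "ops g h e (X u) = Rst g h (X u)"
    by (simp add: Rst_X)
qed

end

section \<open>Normality\<close>

context galois_normality
begin

definition RF :: "('g \<Rightarrow> 'k) \<Rightarrow> 'g \<Rightarrow> 'k" where
  "RF b = (\<lambda>s. if s \<in> F then b s else 0)"

lemma linear_map_RF: "linear_map T T RF"
  by (auto simp: linear_map_def RF_def T_simps(1) plus_fun_apply fun_scl_apply fun_eq_iff)

lemma RF_in: "b \<in> carrier T \<Longrightarrow> RF b \<in> carrier T"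
  using linear_mapD(1)[OF linear_map_RF] .

lemma RF_X: "RF (X u) = (if u \<in> F then X u else 0)"
  by (auto simp: RF_def delta_def fun_eq_iff zero_fun_apply)

lemma F_cancel_left: "\<lbrakk>x \<in> carrier G; n \<in> F\<rbrakk> \<Longrightarrow> n \<otimes> x \<in> F \<longleftrightarrow> x \<in> F"
proof
  assume a: "x \<in> carrier G" "n \<in> F" "n \<otimes> x \<in> F"
  have "inv n \<otimes> (n \<otimes> x) \<in> F"
    by (rule subgroup.m_closed[OF F_subgroup subgroup.m_inv_closed[OF F_subgroup a(2)] a(3)])
  also have "inv n \<otimes> (n \<otimes> x) = x" using a by (simp add: G.m_assoc[symmetric])
  finally show "x \<in> F" .
qed (use F_subgroup in \<open>auto intro: subgroup.m_closed\<close>)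

lemma Rst_RF:
  assumes "n \<in> F" "b \<in> carrier T"
  shows "Rst n \<one> b = RF b"
proof
  fix s
  have "inv n \<otimes> s \<in> F \<longleftrightarrow> s \<in> F" if "s \<in> S"
    using that assms(1) subgroup.m_inv_closed[OF F_subgroup assms(1)] by (intro F_cancel_left) auto
  moreover have "b s = 0" if "s \<notin> S" using assms(2) that by (simp add: T_simps(1))
  ultimately show "Rst n \<one> b s = RF b s"
    using assms(1) by (cases "s \<in> S") (auto simp: Rst_def RF_def)
qed

lemma sum_act2_inv:
  assumes "t \<in> AA"
  shows "inv_tensor (\<Sum>h\<in>carrier G. act2 h h t)"
  unfolding inv_tensor_def
proof (intro conjI ballI)
  show "(\<Sum>h\<in>carrier G. act2 h h t) \<in> AA"
    using assms by (intro tensor_sum_in act2_in)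
  fix x assume x: "x \<in> carrier G"
  have "act2 x x (\<Sum>h\<in>carrier G. act2 h h t) = (\<Sum>h\<in>carrier G. act2 (x \<otimes> h) (x \<otimes> h) t)"
    using x assms by (subst linear_map_sum[OF linear_map_act2 lspace_tensor]) (auto simp: act2_in act2_act2)
  also have "\<dots> = (\<Sum>h\<in>carrier G. act2 h h t)"
    by (rule sum_translate_left[OF G.subgroup_self x, of "\<lambda>h. act2 h h t"])
  finally show "act2 x x (\<Sum>h\<in>carrier G. act2 h h t) = (\<Sum>h\<in>carrier G. act2 h h t)" .
qed

text \<open>Regrouping exposes the conjugates of \<open>XI s \<cdot> X h\<close>, whose sum is a
  trace that vanishes unless \<open>s = h\<close>.\<close>

lemma sum_cj_dual:
  assumes "s \<in> S" "h \<in> S" "w \<in> carrier T"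
  shows "(\<Sum>\<sigma>\<in>S. cj s (X \<sigma>) \<cdot> cj h (XI \<sigma> \<cdot> w)) = (if s = h then fun_scl (of_nat (card S)) (cj h w) else 0)"
proof -
  have "(\<Sum>\<sigma>\<in>S. cj s (X \<sigma>) \<cdot> cj h (XI \<sigma> \<cdot> w)) = (\<Sum>\<sigma>\<in>S. X s \<cdot> cj \<sigma> (XI s \<cdot> X h) \<cdot> (w \<cdot> XI h))"
    using assms by (intro sum.cong) (simp_all add: cj_def T.m_assoc)
  also have "\<dots> = X s \<cdot> (\<Sum>\<sigma>\<in>S. cj \<sigma> (XI s \<cdot> X h)) \<cdot> (w \<cdot> XI h)"
    using assms by (subst T.mult_sum_right, simp, simp, subst T.mult_sum_left) simp_all
  also have "\<dots> = fun_scl (tr (XI s \<cdot> X h)) (X s \<cdot> (w \<cdot> XI h))"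
    using assms T.mult_scl_right[of "X s" "\<one>\<^bsub>T\<^esub>"] T.mult_scl_left[of "w \<cdot> XI h" "X s"] by (simp add: sum_cj)
  finally show ?thesis using assms by (simp add: tr_XI_X cj_def T.m_assoc)
qed

text \<open>The invariant tensor is the \<open>G\<close>-average of functions supported on \<open>S n\<close> and \<open>S\<close>, chosen so
  that the trace form isolates the elements of \<open>S\<close> commuting with \<open>n\<close>.\<close>

lemma absorb_imp_support:
  assumes absorb: "\<And>t. inv_tensor t \<Longrightarrow> e \<star> t \<star> e = t \<star> e"
    and n: "n \<in> F" and w: "w \<in> carrier T"
  shows "RF (\<Sum>k\<in>{k \<in> S. n \<otimes> k = k \<otimes> n}. cj k w) = (\<Sum>k\<in>{k \<in> S. n \<otimes> k = k \<otimes> n}. cj k w)"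
    (is "RF ?d = ?d")
proof -
  let ?p = "\<lambda>\<sigma>. ind n (X \<sigma>)" and ?q = "\<lambda>\<sigma>. ind \<one> (XI \<sigma> \<cdot> w)"
  have nG: "n \<in> carrier G" using n by simp
  have pq: "?p \<sigma> \<in> carrier A" "?q \<sigma> \<in> carrier A" if "\<sigma> \<in> S" for \<sigma>
    using that n w by (auto intro: ind_in)
  define s where "s = (\<Sum>\<sigma>\<in>S. tens A A (?p \<sigma>) (?q \<sigma>))"
  have s: "s \<in> AA"
    unfolding s_def using pq by (intro tensor_sum_in tens_in)
  define t where "t = (\<Sum>h\<in>carrier G. act2 h h s)"
  have t: "inv_tensor t" unfolding t_def using s by (rule sum_act2_inv)
  then have tA: "t \<in> AA" by (simp add: inv_tensor_def)
  have d: "?d \<in> carrier T" using w by (intro T.sum_in) simp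
  have ops_s: "ops (n \<otimes> h) h s \<one>\<^bsub>T\<^esub> = (if h \<in> {k \<in> S. n \<otimes> k = k \<otimes> n} then fun_scl (of_nat (card S)) (cj h w) else 0)"
    if h: "h \<in> carrier G" for h
  proof -
    \<comment> \<open>\<open>ind n\<close> is based at \<open>n\<close>, so its value at
      \<open>n \<otimes> h\<close> is conjugated by \<open>n h n\<^sup>-\<^sup>1\<close>, while
      \<open>ind \<one>\<close> at \<open>h\<close> is conjugated by \<open>h\<close>. The trace
      asks for these to be equal, that is, for \<open>h\<close> to commute with
      \<open>n\<close>.\<close>
    let ?s = "n \<otimes> h \<otimes> inv n"
    have eq: "?s = h \<longleftrightarrow> n \<otimes> h = h \<otimes> n"
    proof
      assume "?s = h"
      then have "?s \<otimes> n = h \<otimes> n" by simp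
      then show "n \<otimes> h = h \<otimes> n" using h nG by (simp add: G.m_assoc)
    qed (use h nG in \<open>simp add: G.m_assoc\<close>)
    have "ops (n \<otimes> h) h s \<one>\<^bsub>T\<^esub> = (\<Sum>\<sigma>\<in>S. ?p \<sigma> (n \<otimes> h) \<cdot> ?q \<sigma> h)"
      unfolding s_def using h nG pq
      by (subst linear_map_sum[OF linear_map_ops lspace_tensor]) (auto simp: tens_in ops_tens intro!: sum.cong)
    also have "\<dots> = (\<Sum>\<sigma>\<in>S. if ?s \<in> S \<and> h \<in> S then cj ?s (X \<sigma>) \<cdot> cj h (XI \<sigma> \<cdot> w) else 0)"
      using h nG w by (intro sum.cong) (auto simp: ind_apply T.mult_zero_left T.mult_zero_right T.zero_in)
    also have "\<dots> = (if ?s \<in> S \<and> h \<in> S then (if ?s = h then fun_scl (of_nat (card S)) (cj h w) else 0) else 0)"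
      using w by (auto simp: sum_cj_dual)
    finally show ?thesis using eq by auto
  qed
  have "ops n \<one> t \<one>\<^bsub>T\<^esub> = (\<Sum>h\<in>carrier G. ops (n \<otimes> h) h s \<one>\<^bsub>T\<^esub>)"
    unfolding t_def using nG s
    by (subst linear_map_sum[OF linear_map_ops lspace_tensor]) (auto simp: act2_in ops_act2 intro!: sum.cong)
  also have "\<dots> = (\<Sum>h\<in>carrier G. if h \<in> {k \<in> S. n \<otimes> k = k \<otimes> n} then fun_scl (of_nat (card S)) (cj h w) else 0)"
    by (rule sum.cong[OF refl ops_s])
  also have "\<dots> = (\<Sum>h\<in>{k \<in> S. n \<otimes> k = k \<otimes> n}. fun_scl (of_nat (card S)) (cj h w))"
    using finite_G by (intro sum.mono_neutral_cong_right) auto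
  also have "\<dots> = fun_scl (of_nat (card S)) ?d" by (simp add: fs.scale_sum_right)
  finally have ops_t: "ops n \<one> t \<one>\<^bsub>T\<^esub> = fun_scl (of_nat (card S)) ?d" .
  \<comment> \<open>The two operators will be compared on the unit, which restriction to
    \<open>F\<close> fixes.\<close>
  have RF1: "RF \<one>\<^bsub>T\<^esub> = \<one>\<^bsub>T\<^esub>"
    using subgroup.one_closed[OF F_subgroup] by (auto simp: RF_def fun_eq_iff T_simps(3) fun_scl_apply delta_apply)
  have te: "t \<star> e \<in> AA" "e \<star> t \<in> AA"
    using tA e_tensor by (simp_all add: E_mult_in)
  have "ops n \<one> (e \<star> t \<star> e) \<one>\<^bsub>T\<^esub> = RF (ops n \<one> t \<one>\<^bsub>T\<^esub>)"
    using nG n tA te e_tensor by (simp add: ops_mult ops_e Rst_RF RF1 RF_in ops_in)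
  moreover have "ops n \<one> (t \<star> e) \<one>\<^bsub>T\<^esub> = ops n \<one> t \<one>\<^bsub>T\<^esub>"
    using nG n tA e_tensor by (simp add: ops_mult ops_e Rst_RF RF1)
  ultimately have "RF (fun_scl (of_nat (card S)) ?d) = fun_scl (of_nat (card S)) ?d"
    using absorb[OF t] by (simp add: ops_t)
  then have "fun_scl (of_nat (card S)) (RF ?d) = fun_scl (of_nat (card S)) ?d"
    by (simp only: linear_mapD(3)[OF linear_map_RF d, unfolded T_simps(2)])
  then show ?thesis by (rule fs.scale_left_imp_eq[OF card_S])
qed

text \<open>The orbit sum of \<open>x\<^sub>v\<close> under \<open>S \<inter> F\<close> is nonzero and commutes with all elements supported in
  \<open>S \<inter> F\<close>; a double centralizer argument shows that it is supported in the centralizer of \<open>n\<close>.\<close>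

lemma absorb_imp_commute:
  assumes absorb: "\<And>t. inv_tensor t \<Longrightarrow> e \<star> t \<star> e = t \<star> e"
    and v: "v \<in> S" "regular_rel G S \<alpha> F v" and n: "n \<in> F"
  shows "n \<otimes> v = v \<otimes> n"
proof -
  let ?K = "{k \<in> S. n \<otimes> k = k \<otimes> n}"
  have finN: "finite N" using finite_S by simp
  define y where "y = (\<Sum>u\<in>N. cj u (X v))"
  have y: "y \<in> carrier T" unfolding y_def using v by (intro T.sum_in) simp
  \<comment> \<open>The \<open>u\<close> commuting with \<open>v\<close> contribute \<open>1\<close>
    by regularity, all others move \<open>X v\<close> off \<open>v\<close>. The coefficient counts a
    set containing the identity and is non-zero in characteristic zero.\<close>
  have y_v: "y v \<noteq> 0"
  proof -
    have "cj u (X v) v = (if u \<otimes> v = v \<otimes> u then 1 else 0)" if u: "u \<in> N" for u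
    proof (cases "u \<otimes> v = v \<otimes> u")
      case True
      then have "\<alpha> v u = \<alpha> u v"
        using v u by (auto simp: regular_rel_def centralizer_def)
      then show ?thesis
        using True u v by (simp add: cj_X_commute fun_scl_apply delta_apply)
    next
      case False
      obtain c where "cj u (X v) = fun_scl c (X (u \<otimes> v \<otimes> inv u))"
        using u v by (elim IntE) (rule cj_X)
      moreover have "v \<noteq> u \<otimes> v \<otimes> inv u"
      proof
        assume "v = u \<otimes> v \<otimes> inv u"
        then have "v \<otimes> u = u \<otimes> v \<otimes> inv u \<otimes> u" by simp
        then show False using False u v by (simp add: G.m_assoc)
      qed
      ultimately show ?thesis using False by (simp add: fun_scl_apply delta_apply)
    qed
    then have "y v = (\<Sum>u\<in>N. if u \<otimes> v = v \<otimes> u then 1 else 0)"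
      unfolding y_def by (simp add: sum_apply)
    also have "\<dots> = of_nat (card {u \<in> N. u \<otimes> v = v \<otimes> u})"
      using finN by (simp add: sum.If_cases Int_def)
    finally have "y v = of_nat (card {u \<in> N. u \<otimes> v = v \<otimes> u})" .
    moreover have "\<one> \<in> {u \<in> N. u \<otimes> v = v \<otimes> u}"
      using v subgroup.one_closed[OF F_subgroup] by simp
    moreover have "finite {u \<in> N. u \<otimes> v = v \<otimes> u}"
      using finN by (rule finite_subset[rotated]) blast
    ultimately show ?thesis by (metis card_eq_0_iff empty_iff of_nat_eq_0_iff)
  qed
  have y_N: "X s \<cdot> y = y \<cdot> X s" if s: "s \<in> N" for s
  proof -
    have "cj s y = (\<Sum>u\<in>N. cj (s \<otimes> u) (X v))"
      unfolding y_def using s v by (subst linear_map_sum[OF linear_map_cj lspace_T]) (auto simp: cj_cj)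
    also have "\<dots> = y"
      unfolding y_def by (rule sum_translate_left[OF N_subgroup s, of "\<lambda>u. cj u (X v)"])
    finally show ?thesis using cj_eq[of s y] s y by simp
  qed
  \<comment> \<open>An element of \<open>T\<close> fixed by \<open>RF\<close> is a combination of
    the \<open>X s\<close> with \<open>s\<close> in \<open>N\<close>, and \<open>y\<close> commutes
    with these.\<close>
  have comm: "y \<cdot> d = d \<cdot> y" if d: "d \<in> carrier T" "RF d = d" for d
  proof -
    have "fun_scl (d s) (y \<cdot> X s) = fun_scl (d s) (X s \<cdot> y)" if "s \<in> S" for s
    proof (cases "s \<in> F")
      case True
      then show ?thesis using that y_N by simp
    next
      case False
      then have "d s = 0" using fun_cong[OF d(2), of s] by (simp add: RF_def)
      then show ?thesis by simp
    qed
    then have "(\<Sum>s\<in>S. fun_scl (d s) (y \<cdot> X s)) = (\<Sum>s\<in>S. fun_scl (d s) (X s \<cdot> y))"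
      by (rule sum.cong[OF refl])
    moreover have "y \<cdot> d = (\<Sum>s\<in>S. fun_scl (d s) (y \<cdot> X s))"
      using y T.scl_in[of "X _"] T.mult_scl_right[of y "X _"]
      by (subst delta_expand[OF d(1)], subst T.mult_sum_right) auto
    moreover have "d \<cdot> y = (\<Sum>s\<in>S. fun_scl (d s) (X s \<cdot> y))"
      using y T.scl_in[of "X _"] T.mult_scl_left[of y "X _"]
      by (subst delta_expand[OF d(1)], subst T.mult_sum_left) auto
    ultimately show ?thesis by simp
  qed
  \<comment> \<open>By \<open>absorb_imp_support\<close> these sums are supported in
    \<open>F\<close>, so \<open>y\<close> commutes with each of them; it is here that the absorption
    hypothesis is used.\<close>
  define d where "d = (\<lambda>\<sigma>. \<Sum>k\<in>?K. cj k (X \<sigma>))"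
  have d: "d \<sigma> \<in> carrier T" "y \<cdot> d \<sigma> = d \<sigma> \<cdot> y" if "\<sigma> \<in> S" for \<sigma>
  proof -
    show in_T: "d \<sigma> \<in> carrier T" unfolding d_def using that by (intro T.sum_in) auto
    show "y \<cdot> d \<sigma> = d \<sigma> \<cdot> y"
      by (rule comm[OF in_T]) (unfold d_def, rule absorb_imp_support[OF absorb n], use that in auto)
  qed
  \<comment> \<open>Weighted by \<open>XI \<sigma>\<close> and summed,
    \<open>y \<cdot> d \<sigma>\<close> gives a combination of the \<open>XI k\<close>, whereas
    \<open>d \<sigma> \<cdot> y\<close> gives \<open>card S\<close> times \<open>y\<close>. So
    \<open>y\<close> is a combination of inverses of units \<open>X k\<close> with \<open>k\<close>
    commuting with \<open>n\<close>.\<close>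
  have "(\<Sum>\<sigma>\<in>S. XI \<sigma> \<cdot> (y \<cdot> d \<sigma>)) = (\<Sum>\<sigma>\<in>S. \<Sum>k\<in>?K. XI \<sigma> \<cdot> (y \<cdot> X k) \<cdot> X \<sigma> \<cdot> XI k)"
    unfolding d_def using y
    by (intro sum.cong refl, subst T.mult_sum_right, simp, simp, subst T.mult_sum_right)
      (auto simp: cj_def T.m_assoc intro!: sum.cong)
  also have "\<dots> = (\<Sum>k\<in>?K. (\<Sum>\<sigma>\<in>S. XI \<sigma> \<cdot> (y \<cdot> X k) \<cdot> X \<sigma>) \<cdot> XI k)"
    using y by (subst sum.swap) (auto intro!: sum.cong T.mult_sum_left[symmetric])
  also have "\<dots> = (\<Sum>k\<in>?K. fun_scl (tr (y \<cdot> X k)) (XI k))"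
    using y T.mult_scl_left[of "XI _" "\<one>\<^bsub>T\<^esub>"] by (intro sum.cong) (auto simp: sum_cj')
  finally have left: "(\<Sum>\<sigma>\<in>S. XI \<sigma> \<cdot> (y \<cdot> d \<sigma>)) = (\<Sum>k\<in>?K. fun_scl (tr (y \<cdot> X k)) (XI k))" .
  have "(\<Sum>\<sigma>\<in>S. XI \<sigma> \<cdot> (d \<sigma> \<cdot> y)) = (\<Sum>\<sigma>\<in>S. \<Sum>k\<in>?K. XI \<sigma> \<cdot> X k \<cdot> X \<sigma> \<cdot> (XI k \<cdot> y))"
    unfolding d_def using y
    by (intro sum.cong refl, subst T.mult_sum_left, simp, simp, subst T.mult_sum_right)
      (auto simp: cj_def T.m_assoc intro!: sum.cong)
  also have "\<dots> = (\<Sum>k\<in>?K. (\<Sum>\<sigma>\<in>S. XI \<sigma> \<cdot> X k \<cdot> X \<sigma>) \<cdot> (XI k \<cdot> y))"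
    using y by (subst sum.swap) (auto intro!: sum.cong T.mult_sum_left[symmetric])
  also have "\<dots> = (\<Sum>k\<in>?K. fun_scl (tr (X k)) (XI k \<cdot> y))"
    using y T.mult_scl_left[of "XI _ \<cdot> y" "\<one>\<^bsub>T\<^esub>"] by (intro sum.cong) (auto simp: sum_cj')
  also have "\<dots> = (\<Sum>k\<in>?K. if k = \<one> then fun_scl (of_nat (card S)) y else 0)"
  proof (rule sum.cong[OF refl])
    fix k assume k: "k \<in> ?K"
    have "fun_scl (tr (X \<one>)) (XI \<one> \<cdot> y) = fun_scl (of_nat (card S)) y"
      using y T.mult_scl_left[of y "\<one>\<^bsub>T\<^esub>"] T.inv_scl_unit(2)[of "\<one>\<^bsub>T\<^esub>" "\<alpha> \<one> \<one>"]
      by (simp add: tr_X) (simp add: X_one)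
    then show "fun_scl (tr (X k)) (XI k \<cdot> y) = (if k = \<one> then fun_scl (of_nat (card S)) y else 0)"
      using k by (simp add: tr_X)
  qed
  also have "\<dots> = fun_scl (of_nat (card S)) y"
    using finite_S n by (subst sum.delta) auto
  finally have "fun_scl (of_nat (card S)) y = (\<Sum>k\<in>?K. fun_scl (tr (y \<cdot> X k)) (XI k))"
    using left d(2) by (simp cong: sum.cong)
  from fun_cong[OF this, of v] have "of_nat (card S) * y v = (\<Sum>k\<in>?K. tr (y \<cdot> X k) * XI k v)"
    by (simp only: sum_apply fun_scl_apply)
  moreover have "of_nat (card S) * y v \<noteq> 0"
    using y_v card_S by (simp only: mult_eq_0_iff simp_thms)
  ultimately have "(\<Sum>k\<in>?K. tr (y \<cdot> X k) * XI k v) \<noteq> 0" by metis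
  \<comment> \<open>The coefficient of \<open>y\<close> at \<open>v\<close> is non-zero, so some
    \<open>XI k\<close> has a non-zero coefficient there; being a multiple of
    \<open>X (inv k)\<close>, it forces \<open>v = inv k\<close>.\<close>
  then obtain k where k: "k \<in> ?K" "XI k v \<noteq> 0"
    by (metis (no_types, lifting) mult_zero_right sum.neutral)
  obtain c where c: "c \<noteq> 0" "X (inv k) = fun_scl c (XI k)"
    using k(1) by (elim CollectE conjE) (rule X_inv)
  have "X (inv k) v \<noteq> 0" unfolding c(2) using c(1) k(2) by (simp add: fun_scl_apply)
  then have vk: "v = inv k" by (auto simp: delta_apply split: if_splits)
  have kG: "k \<in> carrier G" "n \<otimes> k = k \<otimes> n" and nG: "n \<in> carrier G" using k n by auto
  have "inv k \<otimes> (n \<otimes> k) \<otimes> inv k = inv k \<otimes> (k \<otimes> n) \<otimes> inv k"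
    using kG(2) by simp
  moreover have "inv k \<otimes> (n \<otimes> k) \<otimes> inv k = inv k \<otimes> n"
    using kG(1) nG by (simp add: G.m_assoc)
  moreover have "inv k \<otimes> (k \<otimes> n) = n"
    using kG(1) nG by (simp add: G.m_assoc[symmetric])
  ultimately show ?thesis unfolding vk by simp
qed

text \<open>Restriction to \<open>F\<close> is an average of conjugations by the \<open>(\<alpha>, F)\<close>-regular elements: expand
  both sides from the sum of \<open>x\<^sub>v b x\<^sub>w x\<^sub>v\<^sup>-\<^sup>1 x\<^sub>w\<^sup>-\<^sup>1\<close> over \<open>v\<close> in \<open>S\<close> and \<open>w\<close> in \<open>S \<inter> F\<close>.\<close>

lemma RF_eq_sum_regular:
  assumes central: "\<And>v. \<lbrakk>v \<in> S; regular_rel G S \<alpha> F v\<rbrakk> \<Longrightarrow> F \<subseteq> centralizer G v"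
    and b: "b \<in> carrier T"
  shows "fun_scl (of_nat (card S)) (RF b) = fun_scl (of_nat (card N)) (\<Sum>v\<in>{v \<in> S. regular_rel G S \<alpha> F v}. cj v b)"
    (is "_ = fun_scl _ (\<Sum>v\<in>?R. _)")
proof (rule linear_map_T_eq[OF _ _ _ b])
  have scl: "linear_map T T (fun_scl c)" for c
    using T.scl_in by (auto simp: linear_map_def fs.scale_right_distrib mult.commute)
  show "linear_map T T (\<lambda>b. fun_scl (of_nat (card S)) (RF b))"
    by (rule linear_map_comp[OF linear_map_RF scl])
  show "linear_map T T (\<lambda>b. fun_scl (of_nat (card N)) (\<Sum>v\<in>?R. cj v b))"
    by (intro linear_map_comp[OF linear_map_lincomb scl] lspace_T linear_map_cj) simp
  fix u assume u: "u \<in> S"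
  have finN: "finite N" using finite_S by simp
  \<comment> \<open>First evaluation, with the sum over \<open>v\<close> inside: the trace leaves
    only \<open>w = inv u\<close>, which is in the range of summation exactly when \<open>u\<close>
    is in \<open>F\<close>.\<close>
  have "(\<Sum>w\<in>N. \<Sum>v\<in>S. cj v (X u \<cdot> X w) \<cdot> XI w) = (\<Sum>w\<in>N. fun_scl (tr (X u \<cdot> X w)) (XI w))"
  proof (rule sum.cong[OF refl])
    fix w assume w: "w \<in> N"
    have "(\<Sum>v\<in>S. cj v (X u \<cdot> X w) \<cdot> XI w) = (\<Sum>v\<in>S. cj v (X u \<cdot> X w)) \<cdot> XI w"
      using u w by (intro T.mult_sum_left[symmetric]) auto
    then show "(\<Sum>v\<in>S. cj v (X u \<cdot> X w) \<cdot> XI w) = fun_scl (tr (X u \<cdot> X w)) (XI w)"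
      using u w T.mult_scl_left[of "XI w" "\<one>\<^bsub>T\<^esub>"] by (simp add: sum_cj)
  qed
  also have "\<dots> = (\<Sum>w\<in>N. if w = inv u then fun_scl (of_nat (card S)) (X u) else 0)"
  proof (rule sum.cong[OF refl])
    fix w assume w: "w \<in> N"
    then have wS: "w \<in> S" by simp
    have cancel: "inverse (\<alpha> \<one> \<one>) * x * \<alpha> \<one> \<one> = x" for x
      by (simp add: field_simps)
    have iff: "\<one> = u \<otimes> w \<longleftrightarrow> w = inv u"
      using u w by (metis G.inv_equality G.inv_inv G.r_inv IntD1 S_in)
    \<comment> \<open>\<open>tr_dual\<close> is used with the identity in place of \<open>w\<close>;
      the scalars that \<open>XI \<one>\<close> and \<open>X \<one>\<close> bring in are inverse to
      each other.\<close>
    have one: "XI \<one> \<cdot> X u = fun_scl (inverse (\<alpha> \<one> \<one>)) (X u)" "X \<one> \<cdot> XI w = fun_scl (\<alpha> \<one> \<one>) (XI w)"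
      using u w T.mult_scl_left[of "X u" "\<one>\<^bsub>T\<^esub>"] T.mult_scl_left[of "XI w" "\<one>\<^bsub>T\<^esub>"]
        T.inv_scl_unit(2)[of "\<one>\<^bsub>T\<^esub>" "\<alpha> \<one> \<one>"] by (simp_all add: X_one)
    have "tr (XI \<one> \<cdot> X u \<cdot> X w) = inverse (\<alpha> \<one> \<one>) * tr (X u \<cdot> X w)"
      unfolding one(1) using u w T.mult_scl_left[of "X w" "X u"] linear_mapD(3)[OF linear_map_tr, of "X u \<cdot> X w"] by simp
    then show "fun_scl (tr (X u \<cdot> X w)) (XI w) = (if w = inv u then fun_scl (of_nat (card S)) (X u) else 0)"
      using tr_dual[OF u S_closed(3) wS] by (simp only: one(2) iff fs.scale_scale cancel)
  qed
  also have "\<dots> = fun_scl (of_nat (card S)) (RF (X u))"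
  proof -
    have "inv u \<in> F \<longleftrightarrow> u \<in> F"
      using u subgroup.m_inv_closed[OF F_subgroup, of u] subgroup.m_inv_closed[OF F_subgroup, of "inv u"] by auto
    then show ?thesis using finN u by (simp add: RF_X)
  qed
  finally have 1: "(\<Sum>w\<in>N. \<Sum>v\<in>S. cj v (X u \<cdot> X w) \<cdot> XI w) = fun_scl (of_nat (card S)) (RF (X u))" .
  \<comment> \<open>Second evaluation, with the sum over \<open>w\<close> inside: non-regular
    \<open>v\<close> contribute nothing, and for regular \<open>v\<close> the hypothesis that they
    centralize \<open>F\<close> makes all conjugates of \<open>XI v\<close> equal.\<close>
  have orbit: "(\<Sum>w\<in>N. cj w (XI v)) = (if v \<in> ?R then fun_scl (of_nat (card N)) (XI v) else 0)" if v: "v \<in> S" for v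
  proof (cases "v \<in> ?R")
    case True
    have "cj w (XI v) = XI v" if w: "w \<in> N" for w
    proof -
      have c: "w \<otimes> v = v \<otimes> w" using central[of v] True w by (auto simp: centralizer_def)
      then have "\<alpha> v w = \<alpha> w v" using True w by (auto simp: regular_rel_def centralizer_def)
      then have "cj w (X v) = X v" using w v c by (simp add: cj_X_commute)
      then show ?thesis using w v cj_XI[of w "X v"] by simp
    qed
    then have "(\<Sum>w\<in>N. cj w (XI v)) = (\<Sum>w\<in>N. XI v)" by simp
    also have "\<dots> = fun_scl (of_nat (card N)) (XI v)" by (rule fs.sum_constant_scale)
    finally show ?thesis using True by simp
  next
    case False
    then obtain t where "t \<in> N" "t \<otimes> v = v \<otimes> t" "\<alpha> v t \<noteq> \<alpha> t v"
      using v by (auto simp: regular_rel_def centralizer_def)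
    from sum_cj_zero(2)[OF N_subgroup Int_lower1 v this] False show ?thesis by (simp only: if_False)
  qed
  have "(\<Sum>w\<in>N. \<Sum>v\<in>S. cj v (X u \<cdot> X w) \<cdot> XI w) = (\<Sum>v\<in>S. \<Sum>w\<in>N. X v \<cdot> X u \<cdot> cj w (XI v))"
    using u by (subst sum.swap) (auto simp: cj_def T.m_assoc intro!: sum.cong)
  also have "\<dots> = (\<Sum>v\<in>S. X v \<cdot> X u \<cdot> (\<Sum>w\<in>N. cj w (XI v)))"
    using u by (intro sum.cong refl T.mult_sum_right[symmetric]) auto
  also have "\<dots> = (\<Sum>v\<in>S. if v \<in> ?R then fun_scl (of_nat (card N)) (cj v (X u)) else 0)"
    using u T.mult_scl_right by (intro sum.cong refl) (auto simp: orbit cj_def[of _ "X u"] T.mult_zero_right)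
  also have "\<dots> = (\<Sum>v\<in>?R. fun_scl (of_nat (card N)) (cj v (X u)))"
    using finite_S by (intro sum.mono_neutral_cong_right) auto
  also have "\<dots> = fun_scl (of_nat (card N)) (\<Sum>v\<in>?R. cj v (X u))"
    by (simp add: fs.scale_sum_right)
  finally show "fun_scl (of_nat (card S)) (RF (X u)) = fun_scl (of_nat (card N)) (\<Sum>v\<in>?R. cj v (X u))"
    unfolding 1 .
qed

text \<open>Conjugation by a regular \<open>v\<close> moves the pair \<open>(n, \<one>)\<close> to
  \<open>(v n, v)\<close>, which is \<open>(n v, v)\<close> because \<open>v\<close> centralizes
  \<open>F\<close>; invariance of \<open>t\<close> brings it back. Restriction to \<open>F\<close>
  is a multiple of the sum of these conjugations.\<close>

lemma RF_ops_commute: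
  assumes central: "\<And>v. \<lbrakk>v \<in> S; regular_rel G S \<alpha> F v\<rbrakk> \<Longrightarrow> F \<subseteq> centralizer G v"
    and t: "inv_tensor t" and n: "n \<in> F" and b: "b \<in> carrier T"
  shows "ops n \<one> t (RF b) = RF (ops n \<one> t b)"
proof -
  let ?R = "{v \<in> S. regular_rel G S \<alpha> F v}"
  have tA: "t \<in> AA" using t by (simp add: inv_tensor_def)
  note lin = linear_map_ops_arg[OF F_G[OF n] G.one_closed tA]
  have ob: "ops n \<one> t b \<in> carrier T" using n b tA by (simp add: ops_in)
  have "ops n \<one> t (cj v b) = cj v (ops n \<one> t b)" if v: "v \<in> ?R" for v
  proof -
    have vn: "v \<otimes> n = n \<otimes> v" using central[of v] v n by (auto simp: centralizer_def)
    have "cj v (ops n \<one> t b) = ops (v \<otimes> n) (v \<otimes> \<one>) t (cj v b)"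
      using v n tA b by (intro ops_cj) auto
    also have "\<dots> = ops (n \<otimes> v) (\<one> \<otimes> v) t (cj v b)"
      using v by (simp add: vn)
    also have "\<dots> = ops n \<one> t (cj v b)"
      using v n b by (intro ops_inv[OF t]) auto
    finally show ?thesis ..
  qed
  then have "(\<Sum>v\<in>?R. cj v (ops n \<one> t b)) = ops n \<one> t (\<Sum>v\<in>?R. cj v b)"
    using b by (subst linear_map_sum[OF lin lspace_T]) auto
  then have "fun_scl (of_nat (card S)) (RF (ops n \<one> t b)) = fun_scl (of_nat (card N)) (ops n \<one> t (\<Sum>v\<in>?R. cj v b))"
    by (simp add: RF_eq_sum_regular[OF central ob])
  also have "\<dots> = ops n \<one> t (fun_scl (of_nat (card N)) (\<Sum>v\<in>?R. cj v b))"
  proof -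
    have "(\<Sum>v\<in>?R. cj v b) \<in> carrier T" using b by (intro T.sum_in) auto
    from linear_mapD(3)[OF lin this, of "of_nat (card N)"] show ?thesis by simp
  qed
  also have "\<dots> = ops n \<one> t (fun_scl (of_nat (card S)) (RF b))"
    by (simp add: RF_eq_sum_regular[OF central b])
  also have "\<dots> = fun_scl (of_nat (card S)) (ops n \<one> t (RF b))"
    using linear_mapD(3)[OF lin RF_in[OF b], of "of_nat (card S)"] by simp
  finally show ?thesis by (rule fs.scale_left_imp_eq[OF card_S, symmetric])
qed

text \<open>Tensors are compared by their operators. Where the coset
  \<open>g F h\<^sup>-\<^sup>1\<close> meets \<open>S\<close>, translation reduces the claim to
  \<open>RF_ops_commute\<close>.\<close>

lemma centralizer_imp_central:
  assumes central: "\<And>v. \<lbrakk>v \<in> S; regular_rel G S \<alpha> F v\<rbrakk> \<Longrightarrow> F \<subseteq> centralizer G v"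
    and t: "inv_tensor t"
  shows "t \<star> e = e \<star> t"
proof (rule ops_eqI)
  have tA: "t \<in> AA" using t by (simp add: inv_tensor_def)
  show "t \<star> e \<in> AA" "e \<star> t \<in> AA"
    using tA e_tensor by (simp_all add: E_mult_in)
  fix g h b assume gh: "g \<in> carrier G" "h \<in> carrier G" and b: "b \<in> carrier T"
  have "ops g h t (Rst g h b) = Rst g h (ops g h t b)"
  proof (cases "\<exists>s\<in>S. inv g \<otimes> s \<otimes> h \<in> F")
    \<comment> \<open>The coset misses \<open>S\<close>, so \<open>e\<close> acts by zero on both
      sides.\<close>
    case False
    then have "Rst g h b = 0" if "b \<in> carrier T" for b
      using that by (auto simp: Rst_def fun_eq_iff zero_fun_apply T_simps(1))
    then show ?thesis
      using b ops_in[OF gh b tA] linear_map_zero[OF linear_map_ops_arg[OF gh tA] lspace_T] by simp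
  next
    case True
    then obtain s where s: "s \<in> S" and mF: "inv g \<otimes> s \<otimes> h \<in> F" by blast
    define m where "m = inv g \<otimes> s \<otimes> h"
    have m: "m \<in> F" using mF by (simp add: m_def)
    have sG: "s \<in> carrier G" and mG: "m \<in> carrier G" using s m by auto
    \<comment> \<open>Chosen so that \<open>g = s n h\<close>, with \<open>n\<close> in
      \<open>F\<close> by normality: \<open>ops_left\<close> then strips off \<open>s\<close>, and
      invariance of \<open>t\<close> strips off \<open>h\<close>.\<close>
    define n where "n = h \<otimes> inv m \<otimes> inv h"
    have n: "n \<in> F" unfolding n_def using m gh subgroup.m_inv_closed[OF F_subgroup m] by (intro F_normal)
    have "inv m = inv h \<otimes> (inv s \<otimes> g)"
      unfolding m_def using gh sG by (simp add: G.inv_mult_group G.m_assoc)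
    then have nh: "n \<otimes> h = inv s \<otimes> g"
      unfolding n_def using gh sG by (simp add: G.m_assoc) (simp add: G.m_assoc[symmetric])
    have g_eq: "g = s \<otimes> (n \<otimes> h)"
      unfolding nh using gh sG by (simp add: G.m_assoc[symmetric])
    have ops_eq: "ops g h t x = X s \<cdot> ops n \<one> t (XI s \<cdot> x)" if x: "x \<in> carrier T" for x
    proof -
      have "ops g h t x = X s \<cdot> ops (n \<otimes> h) h t (XI s \<cdot> x)"
        using g_eq ops_left[of "n \<otimes> h" h s t x] n gh s tA x by simp
      also have "ops (n \<otimes> h) h t (XI s \<cdot> x) = ops n \<one> t (XI s \<cdot> x)"
        using ops_inv[OF t, of n "\<one>" h "XI s \<cdot> x"] n gh s x by simp
      finally show ?thesis .
    qed
    have Rst_eq: "Rst g h x = X s \<cdot> RF (XI s \<cdot> x)" if x: "x \<in> carrier T" for x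
    proof (rule linear_map_T_eq[OF linear_map_Rst _ _ x])
      show "linear_map T T (\<lambda>x. X s \<cdot> RF (XI s \<cdot> x))"
        by (rule linear_map_comp[OF linear_map_comp[OF T.linear_mult_left linear_map_RF] T.linear_mult_left])
          (use s in auto)
      fix u assume u: "u \<in> S"
      obtain c where c: "c \<noteq> 0" "X (inv s) = fun_scl c (XI s)" using s by (rule X_inv)
      then have "XI s = fun_scl (inverse c) (X (inv s))" by simp
      then have XX: "XI s \<cdot> X u = fun_scl (inverse c * \<alpha> (inv s) u) (X (inv s \<otimes> u))"
        using s u T.mult_scl_left[of "X u" "X (inv s)" "inverse c"] by (simp add: delta_mult)
      let ?k = "inv s \<otimes> u"
      have kG: "?k \<in> carrier G" using s u by simp
      \<comment> \<open>By normality of \<open>F\<close>, the coset condition on \<open>u\<close>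
        thus becomes \<open>inv s \<otimes> u \<in> F\<close>.\<close>
      have "inv g \<otimes> u \<otimes> h = m \<otimes> (inv h \<otimes> ?k \<otimes> inv (inv h))"
      proof -
        have "m \<otimes> (inv h \<otimes> ?k \<otimes> h) = inv g \<otimes> (s \<otimes> (h \<otimes> inv h) \<otimes> inv s) \<otimes> u \<otimes> h"
          unfolding m_def using gh sG u by (simp only: G.m_assoc G.m_closed G.inv_closed S_in)
        then show ?thesis using gh sG u by simp
      qed
      then have iff: "inv g \<otimes> u \<otimes> h \<in> F \<longleftrightarrow> ?k \<in> F"
        using F_cancel_left[OF _ m] conj_F_iff[OF kG, of "inv h"] gh kG by simp
      have "RF (XI s \<cdot> X u) = (if ?k \<in> F then XI s \<cdot> X u else 0)"
        unfolding XX using linear_mapD(3)[OF linear_map_RF, of "X ?k"] s u by (simp add: RF_X)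
      then show "Rst g h (X u) = X s \<cdot> RF (XI s \<cdot> X u)"
        using s u by (simp add: Rst_X iff T.m_assoc[symmetric] T.mult_zero_right)
    qed
    have cancel: "XI s \<cdot> (X s \<cdot> x) = x" if "x \<in> carrier T" for x
      using that s by (simp add: T.m_assoc[symmetric])
    have on: "ops n \<one> t x \<in> carrier T" if "x \<in> carrier T" for x
      using that n tA by (simp add: ops_in)
    show ?thesis
      using b s on RF_in
      by (simp add: ops_eq Rst_eq cancel RF_ops_commute[OF central t n])
  qed
  then show "ops g h (t \<star> e) b = ops g h (e \<star> t) b"
    using gh b tA e_tensor ops_in[OF gh b tA] by (simp add: ops_mult ops_e)
qed

theorem normal_iff: "normal_hopf_subalgebra L M \<longleftrightarrow>
    (\<forall>s\<in>S. regular_rel G S \<alpha> F s \<longrightarrow> F \<subseteq> centralizer G s)"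
proof
  assume "normal_hopf_subalgebra L M"
  from absorb_imp_commute[OF normal_imp_absorb[OF this]]
  show "\<forall>s\<in>S. regular_rel G S \<alpha> F s \<longrightarrow> F \<subseteq> centralizer G s"
    by (auto simp: centralizer_def)
next
  assume "\<forall>s\<in>S. regular_rel G S \<alpha> F s \<longrightarrow> F \<subseteq> centralizer G s"
  then show "normal_hopf_subalgebra L M"
    by (intro central_imp_normal centralizer_imp_central) auto
qed

end

theorem theorem1p1:
  fixes G :: "('g, 'x) monoid_scheme"
    and G' :: "('h, 'y) monoid_scheme"
    and \<pi> :: "'g \<Rightarrow> 'h"
    and S F :: "'g set"
    and \<alpha> :: "'g \<Rightarrow> 'g \<Rightarrow> 'k::{alg_closed_field, field_char_0}"
    and L :: "('k, 'l::ab_group_add, 'z) hopf_scheme"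
    and \<delta> :: "('g \<Rightarrow> 'g \<Rightarrow> 'k) \<Rightarrow> ('k, 'l, 'g \<Rightarrow> 'g \<Rightarrow> 'k) tensor"
    and L' :: "'l set"
  assumes "group G" and "finite (carrier G)" and "group G'"
    and "\<pi> \<in> epi G G'" and "F = kernel G G' \<pi>"
    and "subgroup S G" and "cocycle2 G S \<alpha>" and "nondegenerate G S \<alpha>"
    and "left_galois_hopf_algebra (function_hopf G) (galois_alg G S \<alpha>) (galois_coaction G S \<alpha>)
           L \<delta>"
    and "corresponding_hopf_subalgebra (function_hopf G) (galois_alg G S \<alpha>)
           (galois_coaction G S \<alpha>) L \<delta> (pullback_functions G G' \<pi>) L'"
  shows "normal_hopf_subalgebra L L' \<longleftrightarrow>
    (\<forall>s\<in>S. regular_rel G S \<alpha> F s \<longrightarrow> F \<subseteq> centralizer G s)"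
proof -
  interpret nondegenerate_twisted G S \<alpha>
    using assms(1,2,6,7,8)
    by (intro nondegenerate_twisted.intro nondegenerate_twisted_axioms.intro twisted.intro twisted_axioms.intro)
  have bi: "bigalois_object L H A \<delta> \<rho>"
    using assms(9) by (simp only: left_galois_hopf_algebra_def)
  then have "left_galois_object L A \<delta>" by (simp add: bigalois_object_def)
  then interpret left: left_galois_object L A \<delta> .
  have hom: "group_hom G G' \<pi>"
    using assms(1,3,4) by (simp add: group_hom_def group_hom_axioms_def epi_def)
  have res: "galois_restriction H A \<rho> (pullback_functions G G' \<pi>) = {f \<in> carrier A. \<forall>n\<in>F. translate G n f = f}"
    unfolding assms(5) by (rule galois_restriction_eq[OF left.A.lspace_axioms assms(3,4)])
  interpret galois_normality G S \<alpha> F L \<delta> L'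
  proof (intro galois_normality.intro galois_normality_axioms.intro nondegenerate_twisted_axioms bi)
    show "F \<lhd> G" unfolding assms(5) by (rule group_hom.normal_kernel[OF hom])
    show "hopf_subalgebra L L'"
      using assms(10) by (simp add: corresponding_hopf_subalgebra_def)
    show "left_galois_object (L\<lparr>carrier := L'\<rparr>) (A\<lparr>carrier := {f \<in> carrier A. \<forall>n\<in>F. translate G n f = f}\<rparr>) \<delta>"
      using assms(10) by (simp add: corresponding_hopf_subalgebra_def bigalois_object_def res)
  qed
  show ?thesis by (rule normal_iff)
qed

end
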